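(* (1) Let $X$ be an $n$-quasifold and let $\mathcal{A}$ and $\mathcal{A}'$ be two atlases of $X$. Then the structure groupoids $\mathbf{G}$ and $\mathbf{G}'$ associated with $\mathcal{A}$ and $\mathcal{A}'$ are equivalent (as categories). (2) The structure groupoids associated with diffeomorphic quasifolds are equivalent: if $X$ and $X'$ are diffeomorphic quasifolds with atlases $\mathcal{A}$ and $\mathcal{A}'$ respectively, then the structure groupoids associated with $\mathcal{A}$ and with $\mathcal{A}'$ are equivalent (as categories).
   Context: Diffeology: a diffeology on a set is a set of parametrizations (maps from open subsets of Euclidean spaces), called plots, containing constants, local in nature, and stable under precomposition by smooth parametrizations. Smooth maps send plots to plots; a diffeomorphism is a smooth bijection with smooth inverse. The D-topology is the finest topology making the plots continuous. Subsets carry the subset diffeology (plots with values in the subset); quotients carry the quotient diffeology (plots are the parametrizations that locally lift to plots upstairs). A local diffeomorphism between diffeological spaces is an injective map from a D-open subset onto a D-open subset, smooth together with its inverse for the subset diffeologies. An $n$-quasifold is a diffeological space $X$ such that for every $x\in X$ there are a countable (possibly infinite) subgroup $\Gamma\subset\mathrm{Aff}(\mathbf{R}^n)$ (depending on $x$) and a local diffeomorphism $f$ from $\mathbf{R}^n/\Gamma$ (quotient diffeology) to $X$, defined on a D-open set, whose image contains $x$. Such local diffeomorphisms are called charts; an atlas is a set of charts whose images cover $X$. Standing assumption: only quasifolds that support a locally finite atlas (every point is covered by finitely many charts) are considered. Strict generating family of an atlas $\mathcal{A}$: for each chart $f\in\mathcal{A}$, defined on $U\subset\mathbf{R}^n/\Gamma$,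 let $F=f\circ\mathrm{class}\restriction\mathrm{class}^{-1}(U)$, where $\mathrm{class}:\mathbf{R}^n\to\mathbf{R}^n/\Gamma$ is the projection; $\mathcal{F}$ is the set of all such $F$. The nebula is $\mathcal{N}=\coprod_{F\in\mathcal{F}}\mathrm{dom}(F)=\{(F,r)\mid F\in\mathcal{F},\ r\in\mathrm{dom}(F)\}$ with the sum diffeology, and the evaluation map is $\mathrm{ev}:\mathcal{N}\to X$, $\mathrm{ev}(F,r)=F(r)$. Structure groupoid $\mathbf{G}$ of $\mathcal{A}$: $\mathrm{Obj}(\mathbf{G})=\mathcal{N}$ and $\mathrm{Mor}(\mathbf{G})=\{\mathrm{germ}(\Phi)_\nu\mid \Phi\in\mathrm{Diff}_{\mathrm{loc}}(\mathcal{N}),\ \nu\in\mathrm{dom}(\Phi),\ \mathrm{ev}\circ\Phi=\mathrm{ev}\restriction\mathrm{dom}(\Phi)\}$, where $\mathrm{Diff}_{\mathrm{loc}}(\mathcal{N})$ is the set of local diffeomorphisms of $\mathcal{N}$; the arrow $\mathrm{germ}(\Phi)_\nu$ has source $\nu$ and target $\Phi(\nu)$, and arrows compose by composition of germs. Equivalence is the usual (Mac Lane) equivalence of categories: a functor $S:A\to C$ is an equivalence if it is full and faithful and each object $c$ of $C$ is isomorphic to $S(a)$ for some object $a$ of $A$. *)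

theory Defs
  imports "HOL-Analysis.Analysis" "HOL-Algebra.Bij"
begin

section \<open>Smooth maps between open subsets of Euclidean spaces\<close>

text \<open>
  Plots have domains in Euclidean spaces of all dimensions, so the dimension is a natural number:
  the space of dimension \<open>n\<close> is the library's \<^term>\<open>Euclidean_space n\<close>, whose points are the
  sequences \<open>x\<close> with \<open>x i = 0\<close> for all \<open>i \<ge> n\<close>.  Functions defined on a subset only
  (parametrizations, charts, local diffeomorphisms) are partial functions, so that their domain
  is part of the data.
\<close>

abbreviation Rn :: "nat \<Rightarrow> (nat \<Rightarrow> real) set" where
  "Rn n \<equiv> topspace (Euclidean_space n)"

text \<open>In \<open>Ck k n U g\<close> the set \<open>U\<close> is meant to be open in \<^term>\<open>Rn n\<close>; only the values of \<open>g\<close>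
  on \<open>U\<close> matter.\<close>

primrec Ck :: "nat \<Rightarrow> nat \<Rightarrow> (nat \<Rightarrow> real) set \<Rightarrow> ((nat \<Rightarrow> real) \<Rightarrow> real) \<Rightarrow> bool" where
  "Ck 0 n U g \<longleftrightarrow> continuous_map (subtopology (Euclidean_space n) U) euclideanreal g"
| "Ck (Suc k) n U g \<longleftrightarrow>
     continuous_map (subtopology (Euclidean_space n) U) euclideanreal g \<and>
     (\<forall>i<n. \<exists>g'. (\<forall>x\<in>U. ((\<lambda>t. g (x(i := t))) has_real_derivative g' x) (at (x i))) \<and> Ck k n U g')"

definition parametrizations :: "'a set \<Rightarrow> (nat \<times> ((nat \<Rightarrow> real) \<rightharpoonup> 'a)) set" where
  "parametrizations A = {(m, p). openin (Euclidean_space m) (dom p) \<and> ran p \<subseteq> A}"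

definition smooth_parametrizations ::
    "nat \<Rightarrow> (nat \<times> ((nat \<Rightarrow> real) \<rightharpoonup> (nat \<Rightarrow> real))) set" where
  "smooth_parametrizations n =
     {(m, p) \<in> parametrizations (Rn n). \<forall>i<n. \<forall>k. Ck k m (dom p) (\<lambda>x. the (p x) i)}"


section \<open>Diffeological spaces\<close>

text \<open>A plot is recorded together with the dimension of the Euclidean space in which its domain
  is open.\<close>

record 'a diffspace =
  points :: "'a set"
  plots :: "(nat \<times> ((nat \<Rightarrow> real) \<rightharpoonup> 'a)) set"

definition diffeology :: "'a diffspace \<Rightarrow> bool" where
  "diffeology X \<longleftrightarrow>
     plots X \<subseteq> parametrizations (points X) \<and>
     (\<forall>m U x. openin (Euclidean_space m) U \<longrightarrow> x \<in> points X \<longrightarrow>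
        (m, (\<lambda>r. Some x) |` U) \<in> plots X) \<and>
     (\<forall>(m, p) \<in> parametrizations (points X).
        (\<forall>r\<in>dom p. \<exists>V. openin (Euclidean_space m) V \<and> r \<in> V \<and> (m, p |` V) \<in> plots X) \<longrightarrow>
        (m, p) \<in> plots X) \<and>
     (\<forall>m p k q. (m, p) \<in> plots X \<longrightarrow> (k, q) \<in> smooth_parametrizations m \<longrightarrow> ran q \<subseteq> dom p \<longrightarrow>
        (k, p \<circ>\<^sub>m q) \<in> plots X)"

definition D_topology :: "'a diffspace \<Rightarrow> 'a topology" where
  "D_topology X = topology (\<lambda>U. U \<subseteq> points X \<and>
     (\<forall>(m, p) \<in> plots X. openin (Euclidean_space m) (p -` Some ` U)))"

definition euclidean_diff :: "nat \<Rightarrow> (nat \<Rightarrow> real) diffspace" where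
  "euclidean_diff n = \<lparr>points = Rn n, plots = smooth_parametrizations n\<rparr>"

definition subset_diff :: "'a diffspace \<Rightarrow> 'a set \<Rightarrow> 'a diffspace" where
  "subset_diff X A = \<lparr>points = points X \<inter> A, plots = {(m, p) \<in> plots X. ran p \<subseteq> A}\<rparr>"

definition quotient_diff :: "'a diffspace \<Rightarrow> ('a \<times> 'a) set \<Rightarrow> 'a set diffspace" where
  "quotient_diff X r =
     \<lparr>points = points X // r,
      plots = {(m, p) \<in> parametrizations (points X // r).
        \<forall>s\<in>dom p. \<exists>q. (m, q) \<in> plots X \<and> s \<in> dom q \<and> dom q \<subseteq> dom p \<and>
          (\<forall>t\<in>dom q. p t = Some (r `` {the (q t)}))}\<rparr>"

definition sum_diff :: "'i set \<Rightarrow> ('i \<Rightarrow> 'a diffspace) \<Rightarrow> ('i \<times> 'a) diffspace" where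
  "sum_diff I X =
     \<lparr>points = Sigma I (\<lambda>i. points (X i)),
      plots = {(m, p) \<in> parametrizations (Sigma I (\<lambda>i. points (X i))).
        \<forall>s\<in>dom p. \<exists>i\<in>I. \<exists>q. (m, q) \<in> plots (X i) \<and> s \<in> dom q \<and> dom q \<subseteq> dom p \<and>
          (\<forall>t\<in>dom q. p t = Some (i, the (q t)))}\<rparr>"

definition smooth_map :: "'a diffspace \<Rightarrow> 'b diffspace \<Rightarrow> ('a \<rightharpoonup> 'b) \<Rightarrow> bool" where
  "smooth_map X Y f \<longleftrightarrow> dom f = points X \<and> ran f \<subseteq> points Y \<and>
     (\<forall>(m, p) \<in> plots X. (m, f \<circ>\<^sub>m p) \<in> plots Y)"

definition map_inv :: "('a \<rightharpoonup> 'b) \<Rightarrow> ('b \<rightharpoonup> 'a)" where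
  "map_inv f y = (if y \<in> ran f then Some (SOME x. f x = Some y) else None)"

definition diffeomorphism :: "'a diffspace \<Rightarrow> 'b diffspace \<Rightarrow> ('a \<rightharpoonup> 'b) \<Rightarrow> bool" where
  "diffeomorphism X Y f \<longleftrightarrow> smooth_map X Y f \<and> inj_on f (dom f) \<and> ran f = points Y \<and>
     smooth_map Y X (map_inv f)"

definition diffeomorphic :: "'a diffspace \<Rightarrow> 'b diffspace \<Rightarrow> bool" where
  "diffeomorphic X Y \<longleftrightarrow> (\<exists>f. diffeomorphism X Y f)"

definition local_diffeo :: "'a diffspace \<Rightarrow> 'b diffspace \<Rightarrow> ('a \<rightharpoonup> 'b) \<Rightarrow> bool" where
  "local_diffeo X Y f \<longleftrightarrow> openin (D_topology X) (dom f) \<and> openin (D_topology Y) (ran f) \<and>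
     diffeomorphism (subset_diff X (dom f)) (subset_diff Y (ran f)) f"


section \<open>Quasifolds\<close>

definition Aff :: "nat \<Rightarrow> ((nat \<Rightarrow> real) \<Rightarrow> (nat \<Rightarrow> real)) monoid" where
  "Aff n = BijGroup (Rn n)
     \<lparr>carrier := {g \<in> Bij (Rn n). \<exists>A b. \<forall>x\<in>Rn n.
        g x = (\<lambda>i. if i < n then (\<Sum>j<n. A i j * x j) + b i else 0)}\<rparr>"

definition orbit_rel ::
    "nat \<Rightarrow> ((nat \<Rightarrow> real) \<Rightarrow> (nat \<Rightarrow> real)) set \<Rightarrow> ((nat \<Rightarrow> real) \<times> (nat \<Rightarrow> real)) set" where
  "orbit_rel n \<Gamma> = {(x, y). x \<in> Rn n \<and> (\<exists>\<gamma>\<in>\<Gamma>. y = \<gamma> x)}"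

text \<open>A chart is recorded together with its group \<open>\<Gamma>\<close>; the elements of the quotient of
  \<^term>\<open>Rn n\<close> by \<open>\<Gamma>\<close> are the orbits.\<close>

type_synonym 'a chart =
  "((nat \<Rightarrow> real) \<Rightarrow> (nat \<Rightarrow> real)) set \<times> ((nat \<Rightarrow> real) set \<rightharpoonup> 'a)"

definition charts :: "nat \<Rightarrow> 'a diffspace \<Rightarrow> 'a chart set" where
  "charts n X = {(\<Gamma>, f). subgroup \<Gamma> (Aff n) \<and> countable \<Gamma> \<and>
     local_diffeo (quotient_diff (euclidean_diff n) (orbit_rel n \<Gamma>)) X f}"

definition quasifold :: "nat \<Rightarrow> 'a diffspace \<Rightarrow> bool" where
  "quasifold n X \<longleftrightarrow> diffeology X \<and>
     (\<forall>x\<in>points X. \<exists>(\<Gamma>, f) \<in> charts n X. x \<in> ran f)"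

definition atlas :: "nat \<Rightarrow> 'a diffspace \<Rightarrow> 'a chart set \<Rightarrow> bool" where
  "atlas n X \<A> \<longleftrightarrow> \<A> \<subseteq> charts n X \<and> (\<Union>(\<Gamma>, f)\<in>\<A>. ran f) = points X"

definition has_locally_finite_atlas :: "nat \<Rightarrow> 'a diffspace \<Rightarrow> bool" where
  "has_locally_finite_atlas n X \<longleftrightarrow>
     (\<exists>\<A>. atlas n X \<A> \<and> (\<forall>x\<in>points X. finite {(\<Gamma>, f) \<in> \<A>. x \<in> ran f}))"


section \<open>Categories and their equivalences\<close>

record ('o, 'm) category =
  Obj :: "'o set"
  Arr :: "'m set"
  Dom :: "'m \<Rightarrow> 'o"
  Cod :: "'m \<Rightarrow> 'o"
  Ident :: "'o \<Rightarrow> 'm"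
  Comp :: "'m \<Rightarrow> 'm \<Rightarrow> 'm"

definition hom_set :: "('o, 'm) category \<Rightarrow> 'o \<Rightarrow> 'o \<Rightarrow> 'm set" where
  "hom_set C a b = {f \<in> Arr C. Dom C f = a \<and> Cod C f = b}"

text \<open>\<open>Comp C g f\<close> is the composite of \<open>f\<close> followed by \<open>g\<close>.\<close>

definition is_category :: "('o, 'm) category \<Rightarrow> bool" where
  "is_category C \<longleftrightarrow>
     (\<forall>f\<in>Arr C. Dom C f \<in> Obj C \<and> Cod C f \<in> Obj C) \<and>
     (\<forall>a\<in>Obj C. Ident C a \<in> hom_set C a a) \<and>
     (\<forall>a\<in>Obj C. \<forall>b\<in>Obj C. \<forall>c\<in>Obj C. \<forall>f\<in>hom_set C a b. \<forall>g\<in>hom_set C b c.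
        Comp C g f \<in> hom_set C a c) \<and>
     (\<forall>a\<in>Obj C. \<forall>b\<in>Obj C. \<forall>f\<in>hom_set C a b.
        Comp C f (Ident C a) = f \<and> Comp C (Ident C b) f = f) \<and>
     (\<forall>a\<in>Obj C. \<forall>b\<in>Obj C. \<forall>c\<in>Obj C. \<forall>d\<in>Obj C.
        \<forall>f\<in>hom_set C a b. \<forall>g\<in>hom_set C b c. \<forall>h\<in>hom_set C c d.
        Comp C h (Comp C g f) = Comp C (Comp C h g) f)"

definition is_functor ::
    "('o, 'm) category \<Rightarrow> ('p, 'n) category \<Rightarrow> ('o \<Rightarrow> 'p) \<Rightarrow> ('m \<Rightarrow> 'n) \<Rightarrow> bool" where
  "is_functor A C So Sm \<longleftrightarrow> is_category A \<and> is_category C \<and>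
     (\<forall>a\<in>Obj A. So a \<in> Obj C) \<and>
     (\<forall>a\<in>Obj A. \<forall>b\<in>Obj A. \<forall>f\<in>hom_set A a b. Sm f \<in> hom_set C (So a) (So b)) \<and>
     (\<forall>a\<in>Obj A. Sm (Ident A a) = Ident C (So a)) \<and>
     (\<forall>a\<in>Obj A. \<forall>b\<in>Obj A. \<forall>c\<in>Obj A. \<forall>f\<in>hom_set A a b. \<forall>g\<in>hom_set A b c.
        Sm (Comp A g f) = Comp C (Sm g) (Sm f))"

definition isomorphic_objects :: "('o, 'm) category \<Rightarrow> 'o \<Rightarrow> 'o \<Rightarrow> bool" where
  "isomorphic_objects C a b \<longleftrightarrow>
     (\<exists>f\<in>hom_set C a b. \<exists>g\<in>hom_set C b a. Comp C g f = Ident C a \<and> Comp C f g = Ident C b)"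

definition is_equivalence ::
    "('o, 'm) category \<Rightarrow> ('p, 'n) category \<Rightarrow> ('o \<Rightarrow> 'p) \<Rightarrow> ('m \<Rightarrow> 'n) \<Rightarrow> bool" where
  "is_equivalence A C So Sm \<longleftrightarrow> is_functor A C So Sm \<and>
     (\<forall>a\<in>Obj A. \<forall>b\<in>Obj A. \<forall>g\<in>hom_set C (So a) (So b). \<exists>f\<in>hom_set A a b. Sm f = g) \<and>
     (\<forall>a\<in>Obj A. \<forall>b\<in>Obj A. inj_on Sm (hom_set A a b)) \<and>
     (\<forall>c\<in>Obj C. \<exists>a\<in>Obj A. isomorphic_objects C (So a) c)"

definition equivalent_categories :: "('o, 'm) category \<Rightarrow> ('p, 'n) category \<Rightarrow> bool" where
  "equivalent_categories A C \<longleftrightarrow> (\<exists>So Sm. is_equivalence A C So Sm)"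


section \<open>Germs\<close>

text \<open>The germ of \<open>\<Phi>\<close> at \<open>\<nu>\<close> is the pair of \<open>\<nu>\<close> and the set of all partial maps that coincide
  with \<open>\<Phi>\<close> on some D-open neighbourhood of \<open>\<nu>\<close>.\<close>

type_synonym 'a germ = "'a \<times> ('a \<rightharpoonup> 'a) set"

definition germ :: "'a diffspace \<Rightarrow> ('a \<rightharpoonup> 'a) \<Rightarrow> 'a \<Rightarrow> 'a germ" where
  "germ N \<Phi> \<nu> = (\<nu>, {\<Psi>. \<exists>V. openin (D_topology N) V \<and> \<nu> \<in> V \<and>
     V \<subseteq> dom \<Phi> \<and> V \<subseteq> dom \<Psi> \<and> \<Phi> |` V = \<Psi> |` V})"

definition germ_source :: "'a germ \<Rightarrow> 'a" where
  "germ_source a = fst a"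

definition germ_target :: "'a germ \<Rightarrow> 'a" where
  "germ_target a = (THE \<mu>. \<exists>\<Phi>\<in>snd a. \<Phi> (fst a) = Some \<mu>)"

text \<open>All choices of representatives in the union below give the same germ, namely that of the
  composite of representatives; see \<open>germ_comp\<close>.\<close>

definition germ_compose :: "'a diffspace \<Rightarrow> 'a germ \<Rightarrow> 'a germ \<Rightarrow> 'a germ" where
  "germ_compose N b a = (fst a, \<Union>\<Phi>\<in>snd a. \<Union>\<Psi>\<in>snd b. snd (germ N (\<Psi> \<circ>\<^sub>m \<Phi>) (fst a)))"


section \<open>The structure groupoid of an atlas\<close>

definition strict_family :: "nat \<Rightarrow> 'a chart set \<Rightarrow> ((nat \<Rightarrow> real) \<rightharpoonup> 'a) set" where
  "strict_family n \<A> = (\<lambda>(\<Gamma>, f). (\<lambda>r. f (orbit_rel n \<Gamma> `` {r})) |` Rn n) ` \<A>"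

definition nebula ::
    "nat \<Rightarrow> ((nat \<Rightarrow> real) \<rightharpoonup> 'a) set \<Rightarrow> (((nat \<Rightarrow> real) \<rightharpoonup> 'a) \<times> (nat \<Rightarrow> real)) diffspace" where
  "nebula n \<F> = sum_diff \<F> (\<lambda>F. subset_diff (euclidean_diff n) (dom F))"

definition ev :: "((nat \<Rightarrow> real) \<rightharpoonup> 'a) \<times> (nat \<Rightarrow> real) \<Rightarrow> 'a" where
  "ev = (\<lambda>(F, r). the (F r))"

definition structure_groupoid :: "nat \<Rightarrow> 'a chart set \<Rightarrow>
    (((nat \<Rightarrow> real) \<rightharpoonup> 'a) \<times> (nat \<Rightarrow> real), (((nat \<Rightarrow> real) \<rightharpoonup> 'a) \<times> (nat \<Rightarrow> real)) germ) category"
  where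
  "structure_groupoid n \<A> = (let N = nebula n (strict_family n \<A>) in
     \<lparr>Obj = points N,
      Arr = {germ N \<Phi> \<nu> | \<Phi> \<nu>. local_diffeo N N \<Phi> \<and> \<nu> \<in> dom \<Phi> \<and>
               (\<forall>\<mu>\<in>dom \<Phi>. ev (the (\<Phi> \<mu>)) = ev \<mu>)},
      Dom = germ_source,
      Cod = germ_target,
      Ident = germ N (Some |` points N),
      Comp = germ_compose N\<rparr>)"


section \<open>Consistency of the encodings\<close>

text \<open>The D-topology is the finest topology making the plots continuous.\<close>

lemma openin_D_topology:
  "openin (D_topology X) U \<longleftrightarrow> U \<subseteq> points X \<and>
     (\<forall>(m, p) \<in> plots X. openin (Euclidean_space m) (p -` Some ` U))"
proof -
  let ?O = "\<lambda>U. U \<subseteq> points X \<and>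
     (\<forall>(m, p) \<in> plots X. openin (Euclidean_space m) (p -` Some ` U))"
  have "?O (S \<inter> T)" if "?O S" "?O T" for S T
  proof -
    have "p -` Some ` (S \<inter> T) = p -` Some ` S \<inter> p -` Some ` T" for p :: "(nat \<Rightarrow> real) \<rightharpoonup> 'a"
      by auto
    then show ?thesis using that by fastforce
  qed
  moreover have "?O (\<Union>\<K>)" if "\<forall>K\<in>\<K>. ?O K" for \<K>
  proof -
    have "p -` Some ` \<Union>\<K> = (\<Union>K\<in>\<K>. p -` Some ` K)" for p :: "(nat \<Rightarrow> real) \<rightharpoonup> 'a"
      by auto
    then show ?thesis using that by fastforce
  qed
  ultimately have "istopology ?O"
    unfolding istopology_def by blast
  from topology_inverse'[OF this] show ?thesis by (simp add: D_topology_def)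
qed

lemma continuous_plot_D_topology:
  assumes "diffeology X" "(m, p) \<in> plots X"
  shows "continuous_map (subtopology (Euclidean_space m) (dom p)) (D_topology X) (\<lambda>r. the (p r))"
proof -
  have p: "openin (Euclidean_space m) (dom p)" "ran p \<subseteq> points X"
    using assms unfolding diffeology_def parametrizations_def by auto
  have sub: "dom p \<subseteq> Rn m" using p(1) openin_subset by blast
  have "openin (D_topology X) (points X)"
    unfolding openin_D_topology
  proof (intro conjI ballI, simp, clarify)
    fix k q assume "(k, q) \<in> plots X"
    then have "openin (Euclidean_space k) (dom q)" "ran q \<subseteq> points X"
      using assms unfolding diffeology_def parametrizations_def by auto
    moreover from this have "q -` Some ` points X = dom q" by (auto simp: ran_def)
    ultimately show "openin (Euclidean_space k) (q -` Some ` points X)" by simp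
  qed
  then have top: "topspace (D_topology X) = points X"
    by (metis openin_D_topology openin_subset openin_topspace subset_antisym)
  show ?thesis
    unfolding continuous_map_def
  proof (intro conjI allI impI)
    show "(\<lambda>r. the (p r)) \<in> topspace (subtopology (Euclidean_space m) (dom p)) \<rightarrow>
        topspace (D_topology X)"
      using p(2) by (auto simp: top ran_def)
    fix U assume "openin (D_topology X) U"
    then have "openin (Euclidean_space m) (p -` Some ` U)"
      using assms(2) by (auto simp: openin_D_topology)
    moreover have "p -` Some ` U =
      {x \<in> topspace (subtopology (Euclidean_space m) (dom p)). the (p x) \<in> U}"
      using sub by force
    moreover have "p -` Some ` U \<subseteq> dom p" by auto
    ultimately show "openin (subtopology (Euclidean_space m) (dom p))
      {x \<in> topspace (subtopology (Euclidean_space m) (dom p)). the (p x) \<in> U}"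
      by (metis openin_subtopology inf.absorb_iff1)
  qed
qed

lemma D_topology_finest:
  assumes "diffeology X" "topspace T = points X"
    and "\<And>m p. (m, p) \<in> plots X \<Longrightarrow>
           continuous_map (subtopology (Euclidean_space m) (dom p)) T (\<lambda>r. the (p r))"
    and U: "openin T U"
  shows "openin (D_topology X) U"
  unfolding openin_D_topology
proof (intro conjI ballI, use openin_subset[OF U] assms(2) in simp, clarify)
  fix m p assume mp: "(m, p) \<in> plots X"
  then have p: "openin (Euclidean_space m) (dom p)"
    using assms(1) unfolding diffeology_def parametrizations_def by auto
  have "openin (subtopology (Euclidean_space m) (dom p))
      {x \<in> topspace (subtopology (Euclidean_space m) (dom p)). the (p x) \<in> U}"
    using assms(3)[OF mp] U by (rule openin_continuous_map_preimage)
  moreover have "{x \<in> topspace (subtopology (Euclidean_space m) (dom p)). the (p x) \<in> U}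
      = p -` Some ` U"
    using openin_subset[OF p] by force
  ultimately show "openin (Euclidean_space m) (p -` Some ` U)"
    using openin_trans_full[OF _ p] by simp
qed

lemma Ck_const: "Ck k n U (\<lambda>x. c)"
  by (induction k arbitrary: c) (auto intro!: exI[of _ "\<lambda>x. 0"])

lemma Ck_cong:
  assumes "openin (Euclidean_space m) U" "Ck k m U g" "\<And>x. x \<in> U \<Longrightarrow> g x = h x"
  shows "Ck k m U h"
proof -
  have U: "U \<subseteq> Rn m" using assms(1) openin_subset by blast
  have cont_eq: "continuous_map (subtopology (Euclidean_space m) U) euclideanreal h"
    if "continuous_map (subtopology (Euclidean_space m) U) euclideanreal g" "\<And>x. x \<in> U \<Longrightarrow> g x = h x"
    for g h
    using that(1) by (rule continuous_map_eq) (use that(2) in auto)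
  show ?thesis
    using assms(2,3)
  proof (induction k arbitrary: g h)
    case 0
    then show ?case using cont_eq[of g h] by auto
  next
    case (Suc k)
    have c: "continuous_map (subtopology (Euclidean_space m) U) euclideanreal h"
      using cont_eq[of g h] Suc.prems by auto
    have "\<exists>g'. (\<forall>x\<in>U. ((\<lambda>t. h (x(l := t))) has_real_derivative g' x) (at (x l))) \<and> Ck k m U g'"
      if l: "l < m" for l
    proof -
      obtain g' where g': "\<forall>x\<in>U. ((\<lambda>t. g (x(l := t))) has_real_derivative g' x) (at (x l))"
          "Ck k m U g'"
        using Suc.prems(1) l by auto
      have "((\<lambda>t. h (x(l := t))) has_real_derivative g' x) (at (x l))" if x: "x \<in> U" for x
      proof -
        have "continuous_map euclideanreal (powertop_real UNIV) (\<lambda>t. x(l := t))"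
          unfolding continuous_map_componentwise
        proof (intro conjI ballI)
          fix k :: nat
          show "continuous_map euclideanreal euclideanreal (\<lambda>t. (x(l := t)) k)"
            by (cases "k = l") simp_all
        qed simp
        moreover have "(x(l := t)) \<in> Rn m" for t
          using U x l by (auto simp: topspace_Euclidean_space)
        ultimately have "continuous_map euclideanreal (Euclidean_space m) (\<lambda>t. x(l := t))"
          unfolding Euclidean_space_def by (auto simp: continuous_map_in_subtopology topspace_Euclidean_space)
        then have "openin euclideanreal {t \<in> topspace euclideanreal. x(l := t) \<in> U}"
          using assms(1) by (rule openin_continuous_map_preimage)
        then have op: "open {t. x(l := t) \<in> U}" by simp
        have mem: "x l \<in> {t. x(l := t) \<in> U}" using x by simp
        have der: "((\<lambda>t. g (x(l := t))) has_real_derivative g' x) (at (x l))"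
          using g'(1) x by blast
        have eq: "g (x(l := t)) = h (x(l := t))" if "t \<in> {t. x(l := t) \<in> U}" for t
          using Suc.prems(2) that by simp
        show ?thesis
          by (rule has_field_derivative_transform_within_open[OF der op mem eq])
      qed
      then show ?thesis using g'(2) by blast
    qed
    then show ?case using c by simp
  qed
qed

lemma inclusion_smooth:
  assumes "openin (Euclidean_space m) U"
  shows "(m, Some |` U) \<in> smooth_parametrizations m"
proof -
  have U: "U \<subseteq> Rn m" using assms openin_subset by blast
  have d: "dom (Some |` U) = U" by auto
  have cont: "continuous_map (subtopology (Euclidean_space m) U) euclideanreal (\<lambda>x. x i)" for i
  proof -
    have "continuous_map (powertop_real UNIV) euclideanreal (\<lambda>x. x i)"
      by (rule continuous_map_product_projection) simp
    then show ?thesis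
      unfolding Euclidean_space_def subtopology_subtopology
      by (rule continuous_map_from_subtopology)
  qed
  have Ckx: "Ck k m U (\<lambda>x. x i)" for i k
  proof (cases k)
    case (Suc j)
    have "\<exists>g'. (\<forall>x\<in>U. ((\<lambda>t. (x(l := t)) i) has_real_derivative g' x) (at (x l))) \<and> Ck j m U g'" for l
      by (rule exI[of _ "\<lambda>x. if l = i then 1 else 0"]) (auto simp: Ck_const)
    then show ?thesis using Suc cont by simp
  qed (simp add: cont)
  have eq: "Ck k m U (\<lambda>x. the ((Some |` U) x) i)" for k i
    by (rule Ck_cong[OF assms Ckx]) simp
  have "ran (Some |` U) \<subseteq> Rn m"
    using U by (auto simp: ran_def restrict_map_def split: if_splits)
  then show ?thesis
    unfolding smooth_parametrizations_def parametrizations_def mem_Collect_eq prod.case d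
    using assms eq by blast
qed

lemma plot_restrict:
  assumes "diffeology X" "(m, p) \<in> plots X" "openin (Euclidean_space m) U" "U \<subseteq> dom p"
  shows "(m, p |` U) \<in> plots X"
proof -
  have "ran (Some |` U) \<subseteq> dom p" using assms(4) by (auto simp: ran_def restrict_map_def split: if_splits)
  then have "(m, p \<circ>\<^sub>m (Some |` U)) \<in> plots X"
    using assms inclusion_smooth[OF assms(3)] unfolding diffeology_def by blast
  moreover have "p \<circ>\<^sub>m (Some |` U) = p |` U"
    by (auto simp: map_comp_def restrict_map_def)
  ultimately show ?thesis by simp
qed

lemma local_diffeo_preimage:
  assumes "diffeology X" "diffeology Y" "local_diffeo X Y f" "openin (D_topology Y) V"
  shows "openin (D_topology X) (f -` Some ` V)"
proof -
  have dom: "openin (D_topology X) (dom f)" and sm: "smooth_map (subset_diff X (dom f)) (subset_diff Y (ran f)) f"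
    using assms(3) unfolding local_diffeo_def diffeomorphism_def by auto
  have fV: "f -` Some ` V \<subseteq> dom f" by auto
  have "openin (Euclidean_space m) (p -` Some ` (f -` Some ` V))" if mp: "(m, p) \<in> plots X" for m p
  proof -
    define U where "U = p -` Some ` dom f"
    have U: "openin (Euclidean_space m) U" "U \<subseteq> dom p"
      using dom mp by (auto simp: openin_D_topology U_def)
    have "(m, p |` U) \<in> plots X" using plot_restrict assms(1) mp U by blast
    moreover have "ran (p |` U) \<subseteq> dom f" by (auto simp: U_def ran_def restrict_map_def split: if_splits)
    ultimately have "(m, f \<circ>\<^sub>m (p |` U)) \<in> plots Y"
      using sm unfolding smooth_map_def subset_diff_def by fastforce
    then have "openin (Euclidean_space m) ((f \<circ>\<^sub>m (p |` U)) -` Some ` V)"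
      using assms(4) by (auto simp: openin_D_topology)
    moreover have "(f \<circ>\<^sub>m (p |` U)) -` Some ` V = p -` Some ` (f -` Some ` V)"
      by (auto simp: map_comp_def restrict_map_def U_def image_iff split: option.splits if_splits)
    ultimately show ?thesis by simp
  qed
  then show ?thesis using fV dom by (auto simp: openin_D_topology)
qed

lemma germ_source_germ: "germ_source (germ N \<Phi> \<nu>) = \<nu>"
  by (simp add: germ_source_def germ_def)

lemma germ_target_germ:
  assumes "local_diffeo N N \<Phi>" "\<Phi> \<nu> = Some \<mu>"
  shows "germ_target (germ N \<Phi> \<nu>) = \<mu>"
proof -
  have "openin (D_topology N) (dom \<Phi>)" using assms(1) by (simp add: local_diffeo_def)
  then have mem: "\<Phi> \<in> snd (germ N \<Phi> \<nu>)" using assms(2) by (auto simp: germ_def)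
  have val: "\<Psi> \<nu> = Some \<mu>" if "\<Psi> \<in> snd (germ N \<Phi> \<nu>)" for \<Psi>
    using that assms(2) by (auto simp: germ_def restrict_map_def fun_eq_iff split: if_splits)
  show ?thesis
    unfolding germ_target_def
  proof (rule the_equality)
    show "\<exists>\<Phi>'\<in>snd (germ N \<Phi> \<nu>). \<Phi>' (fst (germ N \<Phi> \<nu>)) = Some \<mu>"
      using mem assms(2) by (intro bexI[of _ \<Phi>]) (simp_all add: germ_def)
    fix \<mu>' assume "\<exists>\<Phi>'\<in>snd (germ N \<Phi> \<nu>). \<Phi>' (fst (germ N \<Phi> \<nu>)) = Some \<mu>'"
    then obtain \<Phi>' where "\<Phi>' \<in> snd (germ N \<Phi> \<nu>)" "\<Phi>' \<nu> = Some \<mu>'"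
      by (auto simp: germ_def)
    then show "\<mu>' = \<mu>" using val by fastforce
  qed
qed

lemma germ_comp:
  assumes N: "diffeology N" and \<Phi>: "local_diffeo N N \<Phi>" and \<Psi>: "local_diffeo N N \<Psi>"
    and \<nu>: "\<Phi> \<nu> = Some \<mu>" "\<mu> \<in> dom \<Psi>"
  shows "germ_compose N (germ N \<Psi> \<mu>) (germ N \<Phi> \<nu>) = germ N (\<Psi> \<circ>\<^sub>m \<Phi>) \<nu>"
proof -
  have mem: "\<Phi> \<in> snd (germ N \<Phi> \<nu>)" "\<Psi> \<in> snd (germ N \<Psi> \<mu>)"
    using \<Phi> \<Psi> \<nu> by (auto simp: germ_def local_diffeo_def)
  have eq: "germ N (\<Psi>' \<circ>\<^sub>m \<Phi>') \<nu> = germ N (\<Psi> \<circ>\<^sub>m \<Phi>) \<nu>"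
    if rep: "\<Phi>' \<in> snd (germ N \<Phi> \<nu>)" "\<Psi>' \<in> snd (germ N \<Psi> \<mu>)" for \<Phi>' \<Psi>'
  proof -
    obtain V where V: "openin (D_topology N) V" "\<nu> \<in> V" "V \<subseteq> dom \<Phi>" "\<Phi> |` V = \<Phi>' |` V"
      using rep(1) unfolding germ_def snd_conv by blast
    obtain W where W: "openin (D_topology N) W" "\<mu> \<in> W" "W \<subseteq> dom \<Psi>" "\<Psi> |` W = \<Psi>' |` W"
      using rep(2) unfolding germ_def snd_conv by blast
    define Z where "Z = V \<inter> \<Phi> -` Some ` W"
    have Z: "openin (D_topology N) Z" "\<nu> \<in> Z"
      using V W \<nu> local_diffeo_preimage[OF N N \<Phi> W(1)] by (auto simp: Z_def)
    have e: "(\<Psi>' \<circ>\<^sub>m \<Phi>') z = (\<Psi> \<circ>\<^sub>m \<Phi>) z" if z: "z \<in> Z" for z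
    proof -
      obtain w where w: "\<Phi> z = Some w" "w \<in> W" using z by (auto simp: Z_def)
      have "\<Phi>' z = Some w" using fun_cong[OF V(4), of z] z w by (simp add: Z_def)
      moreover have "\<Psi>' w = \<Psi> w" using fun_cong[OF W(4), of w] w by simp
      ultimately show ?thesis using w by (simp add: map_comp_def)
    qed
    have half: "snd (germ N g \<nu>) \<subseteq> snd (germ N h \<nu>)" if "\<And>z. z \<in> Z \<Longrightarrow> g z = h z" for g h
    proof
      fix \<theta> assume "\<theta> \<in> snd (germ N g \<nu>)"
      then obtain T where T: "openin (D_topology N) T" "\<nu> \<in> T" "T \<subseteq> dom g" "T \<subseteq> dom \<theta>" "g |` T = \<theta> |` T"
        unfolding germ_def snd_conv by blast
      have "openin (D_topology N) (T \<inter> Z)" "\<nu> \<in> T \<inter> Z" "T \<inter> Z \<subseteq> dom \<theta>" using T Z by auto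
      moreover have "T \<inter> Z \<subseteq> dom h"
        using T(3) that by (metis IntD1 IntD2 domIff subset_iff)
      moreover have "h |` (T \<inter> Z) = \<theta> |` (T \<inter> Z)"
      proof
        fix z show "(h |` (T \<inter> Z)) z = (\<theta> |` (T \<inter> Z)) z"
          using fun_cong[OF T(5), of z] that[of z] by (auto simp: restrict_map_def)
      qed
      ultimately show "\<theta> \<in> snd (germ N h \<nu>)" unfolding germ_def snd_conv by blast
    qed
    have "snd (germ N (\<Psi>' \<circ>\<^sub>m \<Phi>') \<nu>) = snd (germ N (\<Psi> \<circ>\<^sub>m \<Phi>) \<nu>)"
    proof (rule subset_antisym)
      show "snd (germ N (\<Psi>' \<circ>\<^sub>m \<Phi>') \<nu>) \<subseteq> snd (germ N (\<Psi> \<circ>\<^sub>m \<Phi>) \<nu>)"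
        by (rule half) (rule e)
      show "snd (germ N (\<Psi> \<circ>\<^sub>m \<Phi>) \<nu>) \<subseteq> snd (germ N (\<Psi>' \<circ>\<^sub>m \<Phi>') \<nu>)"
        by (rule half) (rule e[symmetric])
    qed
    then show ?thesis by (simp add: germ_def)
  qed
  have "fst (germ N \<Phi> \<nu>) = \<nu>" "fst (germ N (\<Psi> \<circ>\<^sub>m \<Phi>) \<nu>) = \<nu>"
    by (simp_all add: germ_def)
  moreover have "(\<Union>\<Phi>'\<in>snd (germ N \<Phi> \<nu>). \<Union>\<Psi>'\<in>snd (germ N \<Psi> \<mu>). snd (germ N (\<Psi>' \<circ>\<^sub>m \<Phi>') \<nu>))
      = snd (germ N (\<Psi> \<circ>\<^sub>m \<Phi>) \<nu>)"
  proof -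
    have const: "(\<Union>a\<in>A. \<Union>b\<in>B. S a b) = T"
      if "a0 \<in> A" "b0 \<in> B" "\<And>a b. a \<in> A \<Longrightarrow> b \<in> B \<Longrightarrow> S a b = T" for a0 b0 A B S T
      using that by blast
    show ?thesis
      by (rule const[OF mem]) (rule arg_cong[OF eq])
  qed
  ultimately show ?thesis unfolding germ_compose_def prod_eq_iff fst_conv snd_conv by simp
qed

end

theory Submission
  imports Defs
begin

text \<open>
  Identify the two quasifolds by the given diffeomorphism.  Then any two points of the two nebulas
  that lie over the same point of the quasifold are joined by a local diffeomorphism compatible
  with the evaluation maps (\<open>link_charts\<close>).  Granting this, the equivalence is formal
  (\<open>germ_groupoids_equivalent\<close>): for every point \<open>\<nu>\<close> of the first nebula choose a point \<open>S \<nu>\<close> of the second one over the same point, and a local diffeomorphism \<open>\<Theta> \<nu>\<close>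
  from \<open>\<nu>\<close> to \<open>S \<nu>\<close>; conjugating germs by the \<open>\<Theta> \<nu>\<close> is a functor, it is bijective on arrows
  between two given objects because conjugation can be undone, and it is essentially surjective
  because all points of a nebula over the same point are joined by arrows.

  To join \<open>r\<close> in the domain of \<open>F\<close> with \<open>r'\<close> in the domain of \<open>F'\<close>, note that \<open>F\<close> is a plot,
  that the second chart identifies a D-open set with a part of the quotient by \<open>\<Gamma>'\<close>, and
  that plots of a quotient lift locally.  Hence there is a smooth \<open>q\<close> near \<open>r\<close> with
  \<open>F' \<circ> q = F\<close>, and an element of \<open>\<Gamma>'\<close> corrects it so that \<open>q r = r'\<close>
  (\<open>lift_plot_through_chart\<close>).  Exchanging the roles gives \<open>p\<close> near \<open>r'\<close> with \<open>F \<circ> p = F'\<close>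
  and \<open>p r' = r\<close>.  Now \<open>p \<circ> q\<close> is a smooth map that moves every point inside its orbit under
  the countable group \<open>\<Gamma>\<close>.  Such a map agrees near \<open>r\<close> with a single element of \<open>\<Gamma>\<close>
  (\<open>countable_affine_rigidity\<close>); so \<open>q\<close> has a smooth left inverse near \<open>r\<close>, and the same
  argument on the other side makes it a two-sided inverse.

  The rigidity statement rests on a fact about one real variable.  Along a straight line, a
  coordinate of such a map is a \<open>C\<^sup>1\<close> function whose graph is covered by countably many straight
  lines.  Its derivative is the slope of one of these lines at all parameters except the isolated
  points of the coincidence sets, of which there are countably many.  So the derivative is
  continuous with countable image, hence constant
  (\<open>derivative_constant_if_countably_many_lines\<close>), and the map equals its first order Taylor
  expansion on a cube around \<open>r\<close>.  A single element of the group coincides with this affine map at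
  infinitely many points of a moment curve, and a polynomial with infinitely many zeros vanishes, so
  that element is the map.

  The statement about one quasifold with two atlases is the case of the identity diffeomorphism.
\<close>

section \<open>Differential calculus with coordinatewise derivatives\<close>

lemma continuous_coordinate:
  "continuous_map (subtopology (Euclidean_space m) U) euclideanreal (\<lambda>x. x i)"
  unfolding Euclidean_space_def subtopology_subtopology
  by (rule continuous_map_from_subtopology, rule continuous_map_product_projection) simp

definition box_nbhd :: "nat \<Rightarrow> (nat \<Rightarrow> real) \<Rightarrow> real \<Rightarrow> (nat \<Rightarrow> real) set" where
  "box_nbhd m a e = {z \<in> Rn m. \<forall>i<m. \<bar>z i - a i\<bar> < e}"

lemma openin_box_nbhd: "openin (Euclidean_space m) (box_nbhd m a e)"
proof -
  have "openin (Euclidean_space m) {z \<in> Rn m. z i \<in> {a i - e <..< a i + e}}" for i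
  proof -
    have "continuous_map (Euclidean_space m) euclideanreal (\<lambda>x. x i)"
      using continuous_coordinate[of m UNIV] by simp
    from openin_continuous_map_preimage[OF this, of "{a i - e <..< a i + e}"]
    show ?thesis by simp
  qed
  then have "openin (Euclidean_space m)
      (Rn m \<inter> (\<Inter>i\<in>{..<m}. {z \<in> Rn m. z i \<in> {a i - e <..< a i + e}}))"
    by (cases "m = 0") (auto intro!: openin_Int openin_INT)
  moreover have "Rn m \<inter> (\<Inter>i\<in>{..<m}. {z \<in> Rn m. z i \<in> {a i - e <..< a i + e}}) = box_nbhd m a e"
    by (auto simp: box_nbhd_def abs_less_iff algebra_simps)
  ultimately show ?thesis by simp
qed

text \<open>
  A neighbourhood in the product topology restricts finitely many coordinates only, and a point of
  \<open>Rn m\<close> has only \<open>m\<close> coordinates that are not fixed.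
\<close>
lemma box_nbhd_subset_open:
  assumes U: "openin (Euclidean_space m) U" and a: "a \<in> U"
  obtains e where "0 < e" "box_nbhd m a e \<subseteq> U"
proof -
  obtain T where T: "openin (powertop_real UNIV) T" "U = T \<inter> Rn m"
    using U unfolding Euclidean_space_def openin_subtopology by auto
  then obtain V where V: "\<And>i. open (V i)" "a \<in> Pi\<^sub>E UNIV V" "Pi\<^sub>E UNIV V \<subseteq> T"
    using a unfolding openin_product_topology_alt by (auto simp: Ball_def) metis
  have "\<exists>d>0. \<forall>s. \<bar>s - a i\<bar> < d \<longrightarrow> s \<in> V i" for i
    using V(1)[of i] V(2) by (auto simp: open_dist dist_real_def PiE_iff)
  then obtain d where d: "\<And>i. d i > 0" "\<And>i s. \<bar>s - a i\<bar> < d i \<Longrightarrow> s \<in> V i"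
    by metis
  define e where "e = Min (insert 1 (d ` {..<m}))"
  have e: "0 < e" "\<And>i. i < m \<Longrightarrow> e \<le> d i"
    unfolding e_def using d(1) by (auto intro: Min_le)
  have "box_nbhd m a e \<subseteq> U"
  proof
    fix z assume z: "z \<in> box_nbhd m a e"
    have "z i \<in> V i" for i
    proof (cases "i < m")
      case True then show ?thesis using z e(2)[of i] by (intro d(2)) (force simp: box_nbhd_def)
    next
      case False
      then have "z i = a i" using z a T(2) by (simp add: box_nbhd_def topspace_Euclidean_space)
      then show ?thesis using d(1) by (intro d(2)) simp
    qed
    then show "z \<in> U" using z V(3) T(2) by (auto simp: box_nbhd_def)
  qed
  then show thesis using that e(1) by blast
qed

lemma center_in_box_nbhd: "a \<in> Rn m \<Longrightarrow> 0 < e \<Longrightarrow> a \<in> box_nbhd m a e"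
  by (simp add: box_nbhd_def)

lemma open_line_preimage:
  assumes "openin (Euclidean_space m) U" "x \<in> U" "i < m"
  shows "open {t. x(i := t) \<in> U}"
proof -
  have x: "x \<in> Rn m" using assms openin_subset by blast
  have "continuous_map euclideanreal (powertop_real UNIV) (\<lambda>t. x(i := t))"
    unfolding continuous_map_componentwise
  proof (intro conjI ballI)
    fix k :: nat
    show "continuous_map euclideanreal euclideanreal (\<lambda>t. (x(i := t)) k)"
      by (cases "k = i") simp_all
  qed simp
  then have "continuous_map euclideanreal (Euclidean_space m) (\<lambda>t. x(i := t))"
    unfolding Euclidean_space_def using x assms(3)
    by (auto simp: continuous_map_in_subtopology topspace_Euclidean_space)
  from openin_continuous_map_preimage[OF this assms(1)] show ?thesis by simp
qed

lemma continuous_map_into_Euclidean: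
  assumes "\<And>i. i < n \<Longrightarrow> continuous_map T euclideanreal (\<lambda>x. q x i)"
    and "\<And>x. x \<in> topspace T \<Longrightarrow> q x \<in> Rn n"
  shows "continuous_map T (Euclidean_space n) q"
proof -
  have "continuous_map T (Euclidean_space n) (\<lambda>x i. if i < n then q x i else 0)"
    using assms(1) by (simp add: continuous_map_componentwise_Euclidean_space)
  then show ?thesis
    by (rule continuous_map_eq) (use assms(2) in \<open>auto simp: topspace_Euclidean_space\<close>)
qed

lemma continuous_family_near_box:
  fixes D :: "nat \<Rightarrow> (nat \<Rightarrow> real) \<Rightarrow> real"
  assumes U: "openin (Euclidean_space m) U" and a: "a \<in> U" and "0 < \<eta>"
    and D: "\<And>j. j < m \<Longrightarrow> continuous_map (subtopology (Euclidean_space m) U) euclideanreal (D j)"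
  obtains e where "0 < e" "box_nbhd m a e \<subseteq> U"
    "\<And>z j. z \<in> box_nbhd m a e \<Longrightarrow> j < m \<Longrightarrow> \<bar>D j z - D j a\<bar> < \<eta>"
proof -
  have UR: "U \<subseteq> Rn m" using U openin_subset by blast
  have "openin (Euclidean_space m) {z \<in> U. \<bar>D j z - D j a\<bar> < \<eta>}" if "j < m" for j
  proof -
    have eq: "{x \<in> topspace (subtopology (Euclidean_space m) U). D j x \<in> {D j a - \<eta> <..< D j a + \<eta>}}
      = {z \<in> U. \<bar>D j z - D j a\<bar> < \<eta>}" using UR by auto
    have "openin (subtopology (Euclidean_space m) U) {z \<in> U. \<bar>D j z - D j a\<bar> < \<eta>}"
      using openin_continuous_map_preimage[OF D[OF that], of "{D j a - \<eta> <..< D j a + \<eta>}"]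
      unfolding eq by simp
    then show ?thesis using U openin_trans_full by blast
  qed
  then have "openin (Euclidean_space m) (U \<inter> (\<Inter>j\<in>{..<m}. {z \<in> U. \<bar>D j z - D j a\<bar> < \<eta>}))"
    using U by (cases "m = 0") (auto intro!: openin_Int openin_INT)
  moreover have "a \<in> U \<inter> (\<Inter>j\<in>{..<m}. {z \<in> U. \<bar>D j z - D j a\<bar> < \<eta>})"
    using a \<open>0 < \<eta>\<close> by simp
  ultimately obtain e where "0 < e" "box_nbhd m a e \<subseteq> U \<inter> (\<Inter>j\<in>{..<m}. {z \<in> U. \<bar>D j z - D j a\<bar> < \<eta>})"
    using box_nbhd_subset_open by blast
  then show thesis using that[of e] by blast
qed

text \<open>
  Differentiability from continuous partial derivatives: pass from \<open>a\<close> to \<open>z\<close> by changing one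
  coordinate at a time and apply the mean value theorem to each of the \<open>m\<close> steps.  The points
  in between stay in the cube, where the partial derivatives are close to those at \<open>a\<close>.
\<close>
lemma increment_estimate:
  fixes D :: "nat \<Rightarrow> (nat \<Rightarrow> real) \<Rightarrow> real"
  assumes a: "a \<in> Rn m"
    and der: "\<And>x j. x \<in> box_nbhd m a e \<Longrightarrow> j < m \<Longrightarrow>
                ((\<lambda>t. g (x(j := t))) has_real_derivative D j x) (at (x j))"
    and near: "\<And>x j. x \<in> box_nbhd m a e \<Longrightarrow> j < m \<Longrightarrow> \<bar>D j x - D j a\<bar> < \<eta>"
    and z: "z \<in> box_nbhd m a e"
  shows "\<bar>g z - g a - (\<Sum>j<m. D j a * (z j - a j))\<bar> \<le> \<eta> * (\<Sum>j<m. \<bar>z j - a j\<bar>)"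
proof -
  define w where "w k = (\<lambda>i. if i < k then z i else a i)" for k :: nat
  have zR: "z \<in> Rn m" and zd: "\<And>i. i < m \<Longrightarrow> \<bar>z i - a i\<bar> < e" using z by (auto simp: box_nbhd_def)
  have step: "\<bar>g (w (Suc j)) - g (w j) - D j a * (z j - a j)\<bar> \<le> \<eta> * \<bar>z j - a j\<bar>" if j: "j < m" for j
  proof -
    define \<phi> where "\<phi> t = g ((w j)(j := t))" for t
    have ends: "\<phi> (z j) = g (w (Suc j))" "\<phi> (a j) = g (w j)"
      unfolding \<phi>_def w_def by (auto intro!: arg_cong[where f = g])
    have box: "(w j)(j := t) \<in> box_nbhd m a e" if "\<bar>t - a j\<bar> \<le> \<bar>z j - a j\<bar>" for t
      using le_less_trans[OF that zd[OF j]] zd a zR j le_less_trans[OF abs_ge_zero zd[OF j]]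
      unfolding box_nbhd_def w_def by (auto simp: topspace_Euclidean_space)
    have d: "(\<phi> has_real_derivative D j ((w j)(j := t))) (at t)" if "\<bar>t - a j\<bar> \<le> \<bar>z j - a j\<bar>" for t
      using der[OF box[OF that] j] unfolding \<phi>_def by simp
    have "\<exists>t. \<bar>t - a j\<bar> \<le> \<bar>z j - a j\<bar> \<and> \<phi> (z j) - \<phi> (a j) = (z j - a j) * D j ((w j)(j := t))"
    proof (cases "z j" "a j" rule: linorder_cases)
      case less
      from MVT2[OF less, of \<phi> "\<lambda>t. D j ((w j)(j := t))"] d less
      obtain t where "z j < t" "t < a j" "\<phi> (a j) - \<phi> (z j) = (a j - z j) * D j ((w j)(j := t))"
        by force
      then show ?thesis by (intro exI[of _ t]) (auto simp: algebra_simps)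
    next
      case equal then show ?thesis by auto
    next
      case greater
      from MVT2[OF greater, of \<phi> "\<lambda>t. D j ((w j)(j := t))"] d greater
      obtain t where "a j < t" "t < z j" "\<phi> (z j) - \<phi> (a j) = (z j - a j) * D j ((w j)(j := t))"
        by force
      then show ?thesis by (intro exI[of _ t]) auto
    qed
    then obtain t where t: "\<bar>t - a j\<bar> \<le> \<bar>z j - a j\<bar>"
      "\<phi> (z j) - \<phi> (a j) = (z j - a j) * D j ((w j)(j := t))" by blast
    have "g (w (Suc j)) - g (w j) - D j a * (z j - a j) = (D j ((w j)(j := t)) - D j a) * (z j - a j)"
      using t(2) ends by (simp add: algebra_simps)
    then show ?thesis
      using near[OF box[OF t(1)] j] by (simp add: abs_mult mult_right_mono)
  qed
  have "w m = z" "w 0 = a"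
    using zR a by (auto simp: w_def topspace_Euclidean_space)
  moreover have "(\<Sum>j<m. g (w (Suc j)) - g (w j)) = g (w m) - g (w 0)"
    by (rule sum_lessThan_telescope)
  ultimately have "g z - g a - (\<Sum>j<m. D j a * (z j - a j))
      = (\<Sum>j<m. g (w (Suc j)) - g (w j) - D j a * (z j - a j))"
    by (simp add: sum_subtractf)
  also have "\<bar>\<dots>\<bar> \<le> (\<Sum>j<m. \<eta> * \<bar>z j - a j\<bar>)"
    by (rule order_trans[OF sum_abs]) (auto intro!: sum_mono step)
  finally show ?thesis by (simp add: sum_distrib_left)
qed

text \<open>
  The chain rule is stated for curves because both uses reduce to them: a partial derivative of a
  composite is a derivative along the image of a coordinate line, and rigidity restricts maps to
  straight lines.
\<close>
lemma chain_rule_curve: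
  fixes D :: "nat \<Rightarrow> (nat \<Rightarrow> real) \<Rightarrow> real" and c :: "real \<Rightarrow> nat \<Rightarrow> real"
  assumes U: "openin (Euclidean_space m) U" and a: "c t0 \<in> U"
    and der: "\<And>x j. x \<in> U \<Longrightarrow> j < m \<Longrightarrow>
                ((\<lambda>t. g (x(j := t))) has_real_derivative D j x) (at (x j))"
    and cont: "\<And>j. j < m \<Longrightarrow> continuous_map (subtopology (Euclidean_space m) U) euclideanreal (D j)"
    and cR: "\<forall>\<^sub>F t in at t0. c t \<in> Rn m"
    and c': "\<And>j. j < m \<Longrightarrow> ((\<lambda>t. c t j) has_real_derivative c' j) (at t0)"
  shows "((\<lambda>t. g (c t)) has_real_derivative (\<Sum>j<m. D j (c t0) * c' j)) (at t0)"
proof -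
  define a where "a = c t0"
  have aU: "a \<in> U" and aR: "a \<in> Rn m" using assms(2) U openin_subset by (auto simp: a_def)
  define E where "E z = g z - g a - (\<Sum>j<m. D j a * (z j - a j))" for z
  define S where "S t = (\<Sum>j<m. \<bar>(c t j - a j) / (t - t0)\<bar>)" for t
  have quot: "((\<lambda>t. (c t j - a j) / (t - t0)) \<longlongrightarrow> c' j) (at t0)" if "j < m" for j
    using c'[OF that] unfolding has_field_derivative_iff a_def .
  have S: "(S \<longlongrightarrow> (\<Sum>j<m. \<bar>c' j\<bar>)) (at t0)"
    unfolding S_def by (intro tendsto_sum tendsto_rabs quot) simp
  have small: "((\<lambda>t. E (c t) / (t - t0)) \<longlongrightarrow> 0) (at t0)"
  proof (rule tendstoI)
    fix \<epsilon> :: real assume "0 < \<epsilon>"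
    define M where "M = (\<Sum>j<m. \<bar>c' j\<bar>) + 1"
    have M: "0 < M" unfolding M_def by (simp add: add_nonneg_pos sum_nonneg)
    define \<eta> where "\<eta> = \<epsilon> / (2 * M)"
    have \<eta>: "0 < \<eta>" using M \<open>0 < \<epsilon>\<close> by (simp add: \<eta>_def)
    obtain e where e: "0 < e" "box_nbhd m a e \<subseteq> U"
      "\<And>z j. z \<in> box_nbhd m a e \<Longrightarrow> j < m \<Longrightarrow> \<bar>D j z - D j a\<bar> < \<eta>"
      by (rule continuous_family_near_box[OF U aU \<eta>, of D]) (use cont in auto)
    have "\<forall>\<^sub>F t in at t0. \<bar>c t j - a j\<bar> < e" if "j < m" for j
    proof -
      have "((\<lambda>t. c t j) \<longlongrightarrow> a j) (at t0)"
        using DERIV_isCont[OF c'[OF that]] by (simp add: isCont_def a_def)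
      from tendstoD[OF this e(1)] show ?thesis by (simp add: dist_real_def)
    qed
    then have "\<forall>\<^sub>F t in at t0. \<forall>j\<in>{..<m}. \<bar>c t j - a j\<bar> < e"
      by (intro eventually_ball_finite) auto
    then have box: "\<forall>\<^sub>F t in at t0. c t \<in> box_nbhd m a e"
      using cR by eventually_elim (auto simp: box_nbhd_def)
    have "\<forall>\<^sub>F t in at t0. S t < M"
      using S by (rule order_tendstoD) (simp add: M_def)
    moreover have "\<forall>\<^sub>F t in at t0. t \<noteq> t0" by (simp add: eventually_at_filter)
    ultimately show "\<forall>\<^sub>F t in at t0. dist (E (c t) / (t - t0)) 0 < \<epsilon>"
      using box
    proof eventually_elim
      case (elim t)
      have "\<bar>E (c t)\<bar> \<le> \<eta> * (\<Sum>j<m. \<bar>c t j - a j\<bar>)"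
        unfolding E_def
        by (rule increment_estimate[OF aR der[OF subsetD[OF e(2)]] e(3) elim(3)])
      then have "\<bar>E (c t)\<bar> / \<bar>t - t0\<bar> \<le> \<eta> * (\<Sum>j<m. \<bar>c t j - a j\<bar>) / \<bar>t - t0\<bar>"
        by (rule divide_right_mono) simp
      also have "\<dots> = \<eta> * S t"
        by (simp add: S_def abs_divide flip: sum_divide_distrib)
      also have "\<dots> \<le> \<eta> * M" using elim(1) \<eta> by simp
      also have "\<dots> < \<epsilon>" using M \<open>0 < \<epsilon>\<close> by (simp add: \<eta>_def)
      finally show ?case by (simp add: abs_divide)
    qed
  qed
  have "((\<lambda>t. (\<Sum>j<m. D j a * ((c t j - a j) / (t - t0))) + E (c t) / (t - t0))
      \<longlongrightarrow> (\<Sum>j<m. D j a * c' j) + 0) (at t0)"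
    by (intro tendsto_add tendsto_sum tendsto_mult tendsto_const quot small) simp
  moreover have "(\<Sum>j<m. D j a * ((c t j - a j) / (t - t0))) + E (c t) / (t - t0)
      = (g (c t) - g a) / (t - t0)" for t
    by (simp add: E_def flip: sum_divide_distrib add_divide_distrib)
  ultimately show ?thesis
    unfolding has_field_derivative_iff a_def[symmetric] by simp
qed

lemma Ck_continuous: "Ck k n U g \<Longrightarrow> continuous_map (subtopology (Euclidean_space n) U) euclideanreal g"
  by (cases k) auto

lemma Ck_Suc_imp: "Ck (Suc k) n U g \<Longrightarrow> Ck k n U g"
proof (induction k arbitrary: g)
  case (Suc k)
  then show ?case by (subst Ck.simps(2)) (metis Ck.simps(2))
qed (auto dest: Ck_continuous)

lemma Ck_add: "Ck k n U f \<Longrightarrow> Ck k n U g \<Longrightarrow> Ck k n U (\<lambda>x. f x + g x)"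
proof (induction k arbitrary: f g)
  case (Suc k)
  show ?case unfolding Ck.simps
  proof (intro conjI allI impI)
    show "continuous_map (subtopology (Euclidean_space n) U) euclideanreal (\<lambda>x. f x + g x)"
      using Suc.prems by (intro continuous_map_add) auto
    fix i assume "i < n"
    then obtain f' g' where "\<forall>x\<in>U. ((\<lambda>t. f (x(i := t))) has_real_derivative f' x) (at (x i))" "Ck k n U f'"
      "\<forall>x\<in>U. ((\<lambda>t. g (x(i := t))) has_real_derivative g' x) (at (x i))" "Ck k n U g'"
      using Suc.prems by fastforce
    then show "\<exists>h'. (\<forall>x\<in>U. ((\<lambda>t. f (x(i := t)) + g (x(i := t))) has_real_derivative h' x) (at (x i))) \<and> Ck k n U h'"
      using Suc.IH by (intro exI[of _ "\<lambda>x. f' x + g' x"]) (auto intro!: DERIV_add)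
  qed
qed (auto intro: continuous_map_add)

lemma Ck_mult: "Ck k n U f \<Longrightarrow> Ck k n U g \<Longrightarrow> Ck k n U (\<lambda>x. f x * g x)"
proof (induction k arbitrary: f g)
  case (Suc k)
  show ?case unfolding Ck.simps
  proof (intro conjI allI impI)
    show "continuous_map (subtopology (Euclidean_space n) U) euclideanreal (\<lambda>x. f x * g x)"
      using Suc.prems by (intro continuous_map_real_mult) auto
    fix i assume "i < n"
    then obtain f' g' where fg: "\<forall>x\<in>U. ((\<lambda>t. f (x(i := t))) has_real_derivative f' x) (at (x i))" "Ck k n U f'"
      "\<forall>x\<in>U. ((\<lambda>t. g (x(i := t))) has_real_derivative g' x) (at (x i))" "Ck k n U g'"
      using Suc.prems by fastforce
    have "((\<lambda>t. f (x(i := t)) * g (x(i := t))) has_real_derivative f' x * g x + g' x * f x) (at (x i))"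
      if "x \<in> U" for x
      using DERIV_mult[OF fg(1)[rule_format, OF that] fg(3)[rule_format, OF that]] by simp
    moreover have "Ck k n U (\<lambda>x. f' x * g x + g' x * f x)"
      by (intro Ck_add Suc.IH fg Suc.prems[THEN Ck_Suc_imp])
    ultimately show "\<exists>h'. (\<forall>x\<in>U. ((\<lambda>t. f (x(i := t)) * g (x(i := t))) has_real_derivative h' x) (at (x i))) \<and> Ck k n U h'"
      by (intro exI[of _ "\<lambda>x. f' x * g x + g' x * f x"]) simp
  qed
qed (auto intro: continuous_map_real_mult)

lemma Ck_sum: "(\<And>j. j \<in> J \<Longrightarrow> Ck k n U (f j)) \<Longrightarrow> Ck k n U (\<lambda>x. \<Sum>j\<in>J. f j x)"
  by (induction J rule: infinite_finite_induct) (auto simp: Ck_const Ck_add)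

text \<open>
  The partial derivatives of \<open>g \<circ> q\<close> are sums of products of derivatives of \<open>q\<close> with
  composites \<open>D j \<circ> q\<close> of one order less, to which the induction hypothesis for \<open>D j\<close> applies.
\<close>
lemma Ck_compose:
  assumes U: "openin (Euclidean_space m) U" and V: "openin (Euclidean_space l) V"
    and q: "\<And>x. x \<in> V \<Longrightarrow> q x \<in> U"
    and "Ck k m U g" "\<And>j. j < m \<Longrightarrow> Ck k l V (\<lambda>x. q x j)"
  shows "Ck k l V (\<lambda>x. g (q x))"
  using assms(4,5)
proof (induction k arbitrary: g)
  have UR: "U \<subseteq> Rn m" and VR: "V \<subseteq> Rn l" using U V openin_subset by blast+
  have cont: "continuous_map (subtopology (Euclidean_space l) V) euclideanreal (\<lambda>x. g (q x))"
    if "Ck k m U g" "\<And>j. j < m \<Longrightarrow> Ck k l V (\<lambda>x. q x j)" for k g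
  proof -
    have "continuous_map (subtopology (Euclidean_space l) V) (Euclidean_space m) q"
      using that(2)[THEN Ck_continuous] q UR by (intro continuous_map_into_Euclidean) auto
    then have "continuous_map (subtopology (Euclidean_space l) V) (subtopology (Euclidean_space m) U) q"
      using q by (auto simp: continuous_map_in_subtopology)
    from continuous_map_compose[OF this Ck_continuous[OF that(1)]] show ?thesis
      by (simp add: o_def)
  qed
  {
    case 0 then show ?case using cont[of 0 g] by simp
  next
    case (Suc k)
    have "\<forall>j. \<exists>D. j < m \<longrightarrow> (\<forall>x\<in>U. ((\<lambda>t. g (x(j := t))) has_real_derivative D x) (at (x j))) \<and> Ck k m U D"
      using Suc.prems(1) by auto
    from choice[OF this] obtain D where D: "\<And>j x. j < m \<Longrightarrow> x \<in> U \<Longrightarrow> ((\<lambda>t. g (x(j := t))) has_real_derivative D j x) (at (x j))"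
      "\<And>j. j < m \<Longrightarrow> Ck k m U (D j)"
      by blast
    have "\<exists>h'. (\<forall>x\<in>V. ((\<lambda>t. g (q (x(i := t)))) has_real_derivative h' x) (at (x i))) \<and> Ck k l V h'"
      if i: "i < l" for i
    proof -
      have "\<forall>j. \<exists>d. j < m \<longrightarrow> (\<forall>x\<in>V. ((\<lambda>t. q (x(i := t)) j) has_real_derivative d x) (at (x i))) \<and> Ck k l V d"
        using Suc.prems(2) i by auto
      from choice[OF this] obtain d where d: "\<And>j x. j < m \<Longrightarrow> x \<in> V \<Longrightarrow> ((\<lambda>t. q (x(i := t)) j) has_real_derivative d j x) (at (x i))"
        "\<And>j. j < m \<Longrightarrow> Ck k l V (d j)"
        by blast
      have "((\<lambda>t. g (q (x(i := t)))) has_real_derivative (\<Sum>j<m. D j (q x) * d j x)) (at (x i))"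
        if x: "x \<in> V" for x
      proof -
        have "\<forall>\<^sub>F t in at (x i). x(i := t) \<in> V"
          using open_line_preimage[OF V x i] x unfolding eventually_at_topological by force
        then have "\<forall>\<^sub>F t in at (x i). q (x(i := t)) \<in> Rn m"
          by eventually_elim (use q UR in blast)
        from chain_rule_curve[OF U, where c = "\<lambda>t. q (x(i := t))" and g = g and D = D and c' = "\<lambda>j. d j x", OF _ D(1) _ this]
        show ?thesis using x q d(1) D(2)[THEN Ck_continuous] by simp
      qed
      moreover have "Ck k l V (\<lambda>x. \<Sum>j<m. D j (q x) * d j x)"
      proof (intro Ck_sum Ck_mult)
        fix j assume "j \<in> {..<m}"
        then have j: "j < m" by simp
        \<comment> \<open>the induction hypothesis is one order below the assumption on the coordinates of \<open>q\<close>\<close>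
        show "Ck k l V (\<lambda>x. D j (q x))"
          by (rule Suc.IH[OF D(2)[OF j] Ck_Suc_imp[OF Suc.prems(2)]])
        show "Ck k l V (d j)" by (rule d(2)[OF j])
      qed
      ultimately show ?thesis
        by (intro exI[of _ "\<lambda>x. \<Sum>j<m. D j (q x) * d j x"]) simp
    qed
    then show ?case using cont[OF Suc.prems] by simp
  }
qed

section \<open>Smooth maps that move points inside countable affine orbits\<close>

text \<open>
  A member of a countable basis that isolates a point of \<open>Z\<close> determines this point.
\<close>
lemma countable_isolated_points:
  fixes Z :: "real set"
  shows "countable {t \<in> Z. \<not> t islimpt Z}"
proof -
  obtain B :: "real set set" where B: "countable B" "topological_basis B"
    using ex_countable_basis by blast
  have "{t \<in> Z. \<not> t islimpt Z} \<subseteq> (\<lambda>b. THE t. b \<inter> Z = {t}) ` B"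
  proof
    fix t assume "t \<in> {t \<in> Z. \<not> t islimpt Z}"
    then obtain S where S: "t \<in> Z" "open S" "t \<in> S" "\<forall>y\<in>Z. y \<in> S \<longrightarrow> y = t"
      unfolding islimpt_def by blast
    obtain b where b: "b \<in> B" "t \<in> b" "b \<subseteq> S"
      by (rule topological_basisE[OF B(2) S(2,3)])
    then have "b \<inter> Z = {t}" using S by blast
    then have "(THE t. b \<inter> Z = {t}) = t" by auto
    then show "t \<in> (\<lambda>b. THE t. b \<inter> Z = {t}) ` B" using b(1) by force
  qed
  then show ?thesis by (rule countable_subset) (simp add: B(1))
qed

lemma derivative_at_limit_of_agreement:
  fixes c :: "real \<Rightarrow> real"
  assumes "(c has_real_derivative d) (at t)" "c t = a + b * t" "t islimpt {s. c s = a + b * s}"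
  shows "d = b"
proof (rule ccontr)
  assume "d \<noteq> b"
  have "((\<lambda>s. c s - (a + b * s)) has_real_derivative d - b) (at t)"
    by (auto intro!: derivative_eq_intros assms(1))
  then have "((\<lambda>s. (c s - (a + b * s)) / (s - t)) \<longlongrightarrow> d - b) (at t)"
    using assms(2) by (simp add: has_field_derivative_iff)
  then have "\<forall>\<^sub>F s in at t. (c s - (a + b * s)) / (s - t) \<noteq> 0"
    using \<open>d \<noteq> b\<close> by (intro tendsto_imp_eventually_ne) auto
  then have "\<forall>\<^sub>F s in at t. \<not> c s = a + b * s" by eventually_elim simp
  then show False using assms(3) by (auto simp: islimpt_conv_frequently_at frequently_def)
qed

text \<open>
  The set \<open>J\<close> of isolated points of the coincidence sets is countable, and outside \<open>J\<close> the
  derivative is one of the countably many slopes.  A connected set of reals with more than one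
  point is uncountable.
\<close>
lemma derivative_constant_if_countably_many_lines:
  fixes c c' :: "real \<Rightarrow> real"
  assumes I: "connected I"
    and der: "\<And>t. t \<in> I \<Longrightarrow> (c has_real_derivative c' t) (at t)"
    and cont: "continuous_on I c'"
    and L: "countable L"
    and lines: "\<And>t. t \<in> I \<Longrightarrow> \<exists>(a, b)\<in>L. c t = a + b * t"
    and st: "s \<in> I" "t \<in> I"
  shows "c' s = c' t"
proof -
  define Z where "Z = (\<lambda>(a, b). {t. c t = a + b * t})"
  define J where "J = (\<Union>l\<in>L. {t \<in> Z l. \<not> t islimpt Z l})"
  have "countable J" unfolding J_def by (intro countable_UN L countable_isolated_points)
  have "c' ` I \<subseteq> snd ` L \<union> c' ` J"
  proof
    fix y assume "y \<in> c' ` I"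
    then obtain t where t: "t \<in> I" "y = c' t" by blast
    then obtain a b where ab: "(a, b) \<in> L" "c t = a + b * t" using lines by blast
    show "y \<in> snd ` L \<union> c' ` J"
    proof (cases "t islimpt Z (a, b)")
      case True
      then have "c' t = b"
        using derivative_at_limit_of_agreement[OF der[OF t(1)] ab(2)] by (simp add: Z_def)
      then show ?thesis using ab t by force
    next
      case False
      then have "t \<in> J" using ab by (auto simp: J_def Z_def)
      then show ?thesis using t by blast
    qed
  qed
  then have cnt: "countable (c' ` I)"
    by (rule countable_subset) (simp add: L \<open>countable J\<close>)
  have "connected (c' ` I)" using cont I by (rule connected_continuous_image)
  then show ?thesis
    using cnt st connected_uncountable[of "c' ` I" "c' s" "c' t"] by blast
qed

section \<open>Smooth parametrizations\<close>

lemma smooth_parametrization_iff: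
  "(m, p) \<in> smooth_parametrizations n \<longleftrightarrow> openin (Euclidean_space m) (dom p) \<and> ran p \<subseteq> Rn n \<and>
     (\<forall>i<n. \<forall>k. Ck k m (dom p) (\<lambda>x. the (p x) i))"
  by (simp add: smooth_parametrizations_def parametrizations_def)

lemma smooth_parametrization_continuous:
  assumes "(m, p) \<in> smooth_parametrizations n"
  shows "continuous_map (subtopology (Euclidean_space m) (dom p)) (Euclidean_space n) (\<lambda>x. the (p x))"
  using assms unfolding smooth_parametrization_iff
  by (intro continuous_map_into_Euclidean) (auto intro!: Ck_continuous[of 0] simp: ran_def simp del: Ck.simps)

lemma smooth_parametrization_preimage:
  assumes p: "(m, p) \<in> smooth_parametrizations n" and U: "openin (Euclidean_space n) U"
  shows "openin (Euclidean_space m) (p -` Some ` U)"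
proof -
  have d: "openin (Euclidean_space m) (dom p)" using p by (simp add: smooth_parametrization_iff)
  have "{x \<in> topspace (subtopology (Euclidean_space m) (dom p)). the (p x) \<in> U} = p -` Some ` U"
    using openin_subset[OF d] by force
  then show ?thesis
    using openin_continuous_map_preimage[OF smooth_parametrization_continuous[OF p] U]
      openin_trans_full[OF _ d] by simp
qed

text \<open>
  The domain of the composite shrinks to the preimage of \<open>dom q\<close>, so that the inner map has to be
  restricted first.  This restriction is itself a composition, with the inclusion.
\<close>
lemma smooth_parametrization_compose:
  assumes q: "(m, q) \<in> smooth_parametrizations n" and r: "(l, r) \<in> smooth_parametrizations m"
  shows "(l, q \<circ>\<^sub>m r) \<in> smooth_parametrizations n"
proof -
  have dom: "dom (q \<circ>\<^sub>m r) = r -` Some ` dom q"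
    by (force simp: map_comp_def split: option.splits)
  have o: "openin (Euclidean_space m) (dom q)" "openin (Euclidean_space l) (dom r)"
    using q r by (auto simp: smooth_parametrization_iff)
  have dopen: "openin (Euclidean_space l) (dom (q \<circ>\<^sub>m r))"
    unfolding dom using r o(1) by (rule smooth_parametrization_preimage)
  have sub: "dom (q \<circ>\<^sub>m r) \<subseteq> dom r" by (auto simp: map_comp_def split: option.splits)
  have ransub: "ran (q \<circ>\<^sub>m r) \<subseteq> ran q" by (auto simp: ran_def map_comp_def split: option.splits)
  have incl: "Ck k l (dom (q \<circ>\<^sub>m r)) (\<lambda>x. x i)" if "i < l" for k i
  proof (rule Ck_cong[OF dopen])
    have "dom (Some |` dom (q \<circ>\<^sub>m r)) = dom (q \<circ>\<^sub>m r)" by auto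
    then show "Ck k l (dom (q \<circ>\<^sub>m r)) (\<lambda>x. the ((Some |` dom (q \<circ>\<^sub>m r)) x) i)"
      using inclusion_smooth[OF dopen] that by (simp add: smooth_parametrization_iff)
  qed simp
  have Ckr: "Ck k l (dom (q \<circ>\<^sub>m r)) (\<lambda>x. the (r x) j)" if "j < m" for k j
    using o(2) dopen by (rule Ck_compose[where q = "\<lambda>x. x"])
      (use sub r that incl in \<open>auto simp: smooth_parametrization_iff\<close>)
  have "Ck k l (dom (q \<circ>\<^sub>m r)) (\<lambda>x. the ((q \<circ>\<^sub>m r) x) i)" if "i < n" for k i
  proof (rule Ck_cong[OF dopen])
    show "Ck k l (dom (q \<circ>\<^sub>m r)) (\<lambda>x. the (q (the (r x))) i)"
      using o(1) dopen by (rule Ck_compose[where q = "\<lambda>x. the (r x)" and g = "\<lambda>y. the (q y) i"])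
        (use q that Ckr in \<open>auto simp: smooth_parametrization_iff dom\<close>)
  qed (auto simp: map_comp_def split: option.splits)
  then show ?thesis
    using q dopen ransub unfolding smooth_parametrization_iff by blast
qed

lemma smooth_parametrization_restrict:
  assumes "(m, p) \<in> smooth_parametrizations n" "openin (Euclidean_space m) U"
  shows "(m, p |` U) \<in> smooth_parametrizations n"
proof -
  have "p \<circ>\<^sub>m (Some |` U) = p |` U" by (auto simp: map_comp_def restrict_map_def)
  then show ?thesis
    using smooth_parametrization_compose[OF assms(1) inclusion_smooth[OF assms(2)]] by simp
qed

definition affine_on :: "nat \<Rightarrow> ((nat \<Rightarrow> real) \<Rightarrow> (nat \<Rightarrow> real)) \<Rightarrow> bool" where
  "affine_on n g \<longleftrightarrow> (\<exists>A b. \<forall>x\<in>Rn n. g x = (\<lambda>i. if i < n then (\<Sum>j<n. A i j * x j) + b i else 0))"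

lemma smooth_parametrization_affine:
  assumes q: "(m, q) \<in> smooth_parametrizations n" and g: "affine_on n g"
  shows "(m, map_option g \<circ> q) \<in> smooth_parametrizations n"
proof -
  obtain A b where Ab: "\<And>x. x \<in> Rn n \<Longrightarrow> g x = (\<lambda>i. if i < n then (\<Sum>j<n. A i j * x j) + b i else 0)"
    using g unfolding affine_on_def by blast
  have dom: "dom (map_option g \<circ> q) = dom q" by auto
  have d: "openin (Euclidean_space m) (dom q)" and rq: "ran q \<subseteq> Rn n"
    using q by (auto simp: smooth_parametrization_iff)
  have "Ck k m (dom q) (\<lambda>x. the ((map_option g \<circ> q) x) i)" if "i < n" for k i
  proof (rule Ck_cong[OF d])
    show "Ck k m (dom q) (\<lambda>x. (\<Sum>j<n. A i j * the (q x) j) + b i)"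
      using q by (intro Ck_add Ck_sum Ck_mult Ck_const) (auto simp: smooth_parametrization_iff)
    show "(\<Sum>j<n. A i j * the (q x) j) + b i = the ((map_option g \<circ> q) x) i" if "x \<in> dom q" for x
      using that \<open>i < n\<close> rq Ab[of "the (q x)"] by (auto simp: ran_def)
  qed
  moreover have "ran (map_option g \<circ> q) \<subseteq> Rn n"
  proof
    fix y assume "y \<in> ran (map_option g \<circ> q)"
    then obtain z where z: "z \<in> ran q" "y = g z" by (auto simp: ran_def)
    then show "y \<in> Rn n" using Ab[of z] rq by (auto simp: topspace_Euclidean_space)
  qed
  ultimately show ?thesis
    using d unfolding smooth_parametrization_iff dom by blast
qed

text \<open>
  Only first derivatives at \<open>x0\<close> enter the conclusion: the curve \<open>t \<mapsto> f (x0 + t v)\<close> has constant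
  derivative, so its increment from \<open>0\<close> to \<open>1\<close> is its derivative at \<open>0\<close>.  The bound \<open>e / 2\<close> leaves
  room for a parameter interval that is open around \<open>[0, 1]\<close>.
\<close>
lemma affine_along_ray:
  fixes h :: "(nat \<Rightarrow> real) \<Rightarrow> nat \<Rightarrow> real"
  assumes W: "openin (Euclidean_space n) W" and e: "box_nbhd n x0 e \<subseteq> W"
    and x0: "x0 \<in> Rn n"
    and der: "\<And>x j. x \<in> W \<Longrightarrow> j < n \<Longrightarrow> ((\<lambda>t. f (x(j := t))) has_real_derivative D j x) (at (x j))"
    and cont: "\<And>j. j < n \<Longrightarrow> continuous_map (subtopology (Euclidean_space n) W) euclideanreal (D j)"
    and L: "countable L"
    and lines: "\<And>x. x \<in> W \<Longrightarrow> \<exists>(A, b)\<in>L. f x = (\<Sum>j<n. A j * x j) + b"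
    and v: "v \<in> Rn n" "\<And>i. i < n \<Longrightarrow> \<bar>v i\<bar> < e / 2"
  shows "f (\<lambda>i. x0 i + v i) = f x0 + (\<Sum>j<n. D j x0 * v j)"
proof -
  define c where "c t = (\<lambda>i. x0 i + t * v i)" for t
  define I where "I = {-1<..<2::real}"
  define c' where "c' t = (\<Sum>j<n. D j (c t) * v j)" for t
  have cR: "c t \<in> Rn n" for t using x0 v by (simp add: c_def topspace_Euclidean_space)
  have cW: "c t \<in> W" if "t \<in> I" for t
  proof -
    have "\<bar>t * v i\<bar> < e" if "i < n" for i
    proof -
      have "\<bar>t * v i\<bar> \<le> 2 * \<bar>v i\<bar>" using \<open>t \<in> I\<close> by (auto simp: I_def abs_mult intro!: mult_right_mono)
      then show ?thesis using v(2)[OF that] by linarith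
    qed
    then show ?thesis using e cR[of t] by (auto simp: box_nbhd_def c_def)
  qed
  have cder: "((\<lambda>t. f (c t)) has_real_derivative c' t) (at t)" if "t \<in> I" for t
    unfolding c'_def
  proof (rule chain_rule_curve[where g = f and c = c, OF W cW[OF that] der cont])
    show "((\<lambda>t. c t j) has_real_derivative v j) (at t)" for j
      unfolding c_def by (auto intro!: derivative_eq_intros)
  qed (simp_all add: cR)
  have "continuous_map (top_of_set I) (Euclidean_space n) c"
  proof (rule continuous_map_into_Euclidean)
    show "continuous_map (top_of_set I) euclideanreal (\<lambda>t. c t i)" for i
      unfolding c_def by (auto intro!: continuous_intros)
  qed (rule cR)
  then have cW': "continuous_map (top_of_set I) (subtopology (Euclidean_space n) W) c"
    using cW by (auto simp: continuous_map_in_subtopology)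
  have "continuous_map (top_of_set I) euclideanreal (\<lambda>t. D j (c t))" if "j < n" for j
    using continuous_map_compose[OF cW' cont[OF that]] by (simp add: o_def)
  then have "continuous_on I (\<lambda>t. D j (c t))" if "j < n" for j using that by auto
  then have "continuous_on I c'"
    unfolding c'_def by (auto intro!: continuous_intros)
  define L' where "L' = (\<lambda>(A, b). ((\<Sum>j<n. A j * x0 j) + b, \<Sum>j<n. A j * v j)) ` L"
  have lines': "\<exists>(a, b)\<in>L'. f (c t) = a + b * t" if t: "t \<in> I" for t
  proof -
    obtain A b where "(A, b) \<in> L" "f (c t) = (\<Sum>j<n. A j * c t j) + b"
      using lines[of "c t"] cW[OF t] by blast
    moreover have "(\<Sum>j<n. A j * c t j) + b = ((\<Sum>j<n. A j * x0 j) + b) + (\<Sum>j<n. A j * v j) * t"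
      by (simp add: c_def distrib_left sum.distrib sum_distrib_left mult_ac)
    ultimately show ?thesis by (force simp: L'_def)
  qed
  have "countable L'" using L by (simp add: L'_def)
  have const: "c' t = c' 0" if "t \<in> I" for t
    by (rule derivative_constant_if_countably_many_lines[of I "\<lambda>t. f (c t)" c' L'])
      (use cder \<open>continuous_on I c'\<close> \<open>countable L'\<close> lines' that in \<open>auto simp: I_def\<close>)
  have "\<exists>t. 0 < t \<and> t < 1 \<and> f (c 1) - f (c 0) = (1 - 0) * c' t"
    by (rule MVT2) (auto intro!: cder simp: I_def)
  then obtain t where "0 < t" "t < 1" "f (c 1) - f (c 0) = c' t" by auto
  moreover have "c' t = c' 0" using calculation by (intro const) (simp add: I_def)
  ultimately show ?thesis
    by (simp add: c'_def c_def)
qed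

text \<open>
  On the curve \<open>(t, t\<^sup>2, \<dots>, t\<^sup>n)\<close> an affine function becomes a polynomial with the same coefficients.
  So it is determined by its values at infinitely many points of the curve.
\<close>
lemma moment_curve_coefficients:
  fixes A :: "nat \<Rightarrow> real"
  assumes "infinite T" "\<And>t. t \<in> T \<Longrightarrow> (\<Sum>j<n. A j * t ^ Suc j) + b = 0"
  shows "b = 0" "j < n \<Longrightarrow> A j = 0"
proof -
  define c where "c i = (case i of 0 \<Rightarrow> b | Suc j \<Rightarrow> A j)" for i
  have "(\<Sum>i\<le>n. c i * t ^ i) = (\<Sum>j<n. A j * t ^ Suc j) + b" for t
    unfolding lessThan_Suc_atMost[symmetric] sum.lessThan_Suc_shift by (simp add: c_def)
  then have "T \<subseteq> {t. (\<Sum>i\<le>n. c i * t ^ i) = 0}" using assms(2) by auto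
  then have "infinite {t. (\<Sum>i\<le>n. c i * t ^ i) = 0}" using assms(1) by (rule infinite_super)
  then have z: "\<And>i. i \<le> n \<Longrightarrow> c i = 0" using polyfun_finite_roots[of c n] by blast
  show "b = 0" using z[of 0] by (simp add: c_def)
  show "A j = 0" if "j < n" using z[of "Suc j"] that by (simp add: c_def)
qed

text \<open>
  By \<open>affine_along_ray\<close> the map is affine on a cube.  To find which element of \<open>\<Gamma>\<close> it is, follow the
  moment curve through \<open>r\<close>: uncountably many parameters are distributed among countably many
  elements, so some \<open>\<gamma>\<close> takes care of infinitely many of them, and then all coefficients agree.
\<close>
theorem countable_affine_rigidity:
  assumes h: "(n, h) \<in> smooth_parametrizations n" and r: "r \<in> dom h"
    and \<Gamma>: "countable \<Gamma>" "\<And>\<gamma>. \<gamma> \<in> \<Gamma> \<Longrightarrow> affine_on n \<gamma>"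
    and vals: "\<And>x. x \<in> dom h \<Longrightarrow> \<exists>\<gamma>\<in>\<Gamma>. h x = Some (\<gamma> x)"
  obtains \<gamma> U where "\<gamma> \<in> \<Gamma>" "openin (Euclidean_space n) U" "r \<in> U" "U \<subseteq> dom h"
    "\<And>x. x \<in> U \<Longrightarrow> h x = Some (\<gamma> x)"
proof -
  have W: "openin (Euclidean_space n) (dom h)" and hR: "ran h \<subseteq> Rn n"
    and hC: "\<And>i k. i < n \<Longrightarrow> Ck k n (dom h) (\<lambda>x. the (h x) i)"
    using h by (auto simp: smooth_parametrization_iff)
  have WR: "dom h \<subseteq> Rn n" using W openin_subset by blast
  then have rR: "r \<in> Rn n" using r by blast
  have "\<forall>\<gamma>. \<exists>Ab. \<gamma> \<in> \<Gamma> \<longrightarrow> (\<forall>x\<in>Rn n. \<gamma> x = (\<lambda>i. if i < n then (\<Sum>j<n. fst Ab i j * x j) + snd Ab i else 0))"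
  proof (intro allI)
    fix \<gamma>
    show "\<exists>Ab. \<gamma> \<in> \<Gamma> \<longrightarrow> (\<forall>x\<in>Rn n. \<gamma> x = (\<lambda>i. if i < n then (\<Sum>j<n. fst Ab i j * x j) + snd Ab i else 0))"
    proof (cases "\<gamma> \<in> \<Gamma>")
      case True
      then obtain A b where "\<forall>x\<in>Rn n. \<gamma> x = (\<lambda>i. if i < n then (\<Sum>j<n. A i j * x j) + b i else 0)"
        using \<Gamma>(2) unfolding affine_on_def by blast
      then show ?thesis unfolding split_paired_Ex fst_conv snd_conv by blast
    qed simp
  qed
  from choice[OF this] obtain Ab where Ab0: "\<forall>\<gamma>. \<gamma> \<in> \<Gamma> \<longrightarrow> (\<forall>x\<in>Rn n. \<gamma> x = (\<lambda>i. if i < n then (\<Sum>j<n. fst (Ab \<gamma>) i j * x j) + snd (Ab \<gamma>) i else 0))"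
    ..
  define A where "A \<gamma> = fst (Ab \<gamma>)" for \<gamma>
  define b where "b \<gamma> = snd (Ab \<gamma>)" for \<gamma>
  have Ab: "\<gamma> x = (\<lambda>i. if i < n then (\<Sum>j<n. A \<gamma> i j * x j) + b \<gamma> i else 0)"
    if "\<gamma> \<in> \<Gamma>" "x \<in> Rn n" for \<gamma> x
    unfolding A_def b_def using Ab0 that by blast
  obtain e where e: "0 < e" "box_nbhd n r e \<subseteq> dom h"
    using box_nbhd_subset_open[OF W r] by blast
  have expansion: "\<exists>d. \<forall>v\<in>Rn n. (\<forall>i<n. \<bar>v i\<bar> < e / 2) \<longrightarrow>
      the (h (\<lambda>i. r i + v i)) i = the (h r) i + (\<Sum>j<n. d j * v j)" if i: "i < n" for i
  proof -
    have "\<forall>j. \<exists>D. j < n \<longrightarrow> (\<forall>x\<in>dom h. ((\<lambda>t. the (h (x(j := t))) i) has_real_derivative D x) (at (x j)))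
        \<and> Ck 0 n (dom h) D"
      using hC[OF i, of "Suc 0"] unfolding Ck.simps by blast
    from choice[OF this] obtain D where D:
      "\<And>j x. x \<in> dom h \<Longrightarrow> j < n \<Longrightarrow> ((\<lambda>t. the (h (x(j := t))) i) has_real_derivative D j x) (at (x j))"
      "\<And>j. j < n \<Longrightarrow> continuous_map (subtopology (Euclidean_space n) (dom h)) euclideanreal (D j)"
      by auto
    define L where "L = (\<lambda>\<gamma>. (A \<gamma> i, b \<gamma> i)) ` \<Gamma>"
    have "countable L" using \<Gamma>(1) by (simp add: L_def)
    have lines: "\<exists>(A, b)\<in>L. the (h x) i = (\<Sum>j<n. A j * x j) + b" if x: "x \<in> dom h" for x
    proof -
      obtain \<gamma> where \<gamma>: "\<gamma> \<in> \<Gamma>" "h x = Some (\<gamma> x)" using vals[OF x] by blast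
      have "the (h x) i = (\<Sum>j<n. A \<gamma> i j * x j) + b \<gamma> i"
        using fun_cong[OF Ab[OF \<gamma>(1) subsetD[OF WR x]], of i] \<gamma>(2) i by simp
      then show ?thesis using \<gamma>(1) by (auto simp: L_def intro!: bexI[of _ \<gamma>])
    qed
    show ?thesis
      using affine_along_ray[where f = "\<lambda>x. the (h x) i" and D = D, OF W e(2) rR D(1) D(2) \<open>countable L\<close> lines]
      by (intro exI[of _ "\<lambda>j. D j r"]) blast
  qed
  have "\<forall>i. \<exists>d. i < n \<longrightarrow> (\<forall>v\<in>Rn n. (\<forall>i<n. \<bar>v i\<bar> < e / 2) \<longrightarrow>
      the (h (\<lambda>i. r i + v i)) i = the (h r) i + (\<Sum>j<n. d j * v j))"
    using expansion by blast
  from choice[OF this] obtain d where d: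
    "\<And>v i. i < n \<Longrightarrow> v \<in> Rn n \<Longrightarrow> (\<And>i. i < n \<Longrightarrow> \<bar>v i\<bar> < e / 2) \<Longrightarrow>
      the (h (\<lambda>i. r i + v i)) i = the (h r) i + (\<Sum>j<n. d i j * v j)"
    by blast
  define \<delta> where "\<delta> = min 1 (e / 2)"
  \<comment> \<open>with \<open>t < 1\<close> every positive power of \<open>t\<close> is at most \<open>t < e / 2\<close>, so the moment curve stays in the cube\<close>
  define v where "v t = (\<lambda>j. if j < n then t ^ Suc j else 0)" for t :: real
  define T where "T \<gamma> = {t \<in> {0<..<\<delta>}. h (\<lambda>i. r i + v t i) = Some (\<gamma> (\<lambda>i. r i + v t i))}" for \<gamma>
  have vR: "v t \<in> Rn n" "(\<lambda>i. r i + v t i) \<in> Rn n" for t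
    using rR by (auto simp: v_def topspace_Euclidean_space)
  have vsmall: "\<bar>v t i\<bar> < e / 2" if "i < n" "t \<in> {0<..<\<delta>}" for t i
  proof -
    have "t ^ Suc i \<le> t ^ 1" using that by (intro power_decreasing) (auto simp: \<delta>_def)
    moreover have "0 < t ^ Suc i" using that by simp
    ultimately show ?thesis using that by (simp add: v_def \<delta>_def del: power_Suc)
  qed
  have vdom: "(\<lambda>i. r i + v t i) \<in> dom h" if "t \<in> {0<..<\<delta>}" for t
    using vsmall[OF _ that] vR[of t] e by (force simp: box_nbhd_def)
  have "{0<..<\<delta>} \<subseteq> (\<Union>\<gamma>\<in>\<Gamma>. T \<gamma>)"
  proof
    fix t assume t: "t \<in> {0<..<\<delta>}"
    show "t \<in> (\<Union>\<gamma>\<in>\<Gamma>. T \<gamma>)" using vals[OF vdom[OF t]] t by (auto simp: T_def)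
  qed
  moreover have "uncountable {0<..<\<delta>}" using e by (intro uncountable_open_interval[THEN iffD2]) (simp add: \<delta>_def)
  ultimately have "\<not> countable (\<Union>\<gamma>\<in>\<Gamma>. T \<gamma>)"
    using countable_subset by metis
  then have "\<not> (\<forall>\<gamma>\<in>\<Gamma>. countable (T \<gamma>))" using \<Gamma>(1) by auto
  then obtain \<gamma> where \<gamma>: "\<gamma> \<in> \<Gamma>" "infinite (T \<gamma>)" by (auto dest: countable_finite)
  have coeff: "the (h r) i = (\<Sum>j<n. A \<gamma> i j * r j) + b \<gamma> i" "\<And>j. j < n \<Longrightarrow> d i j = A \<gamma> i j" if i: "i < n" for i
  proof -
    have eq: "(\<Sum>j<n. (d i j - A \<gamma> i j) * t ^ Suc j) + (the (h r) i - (\<Sum>j<n. A \<gamma> i j * r j) - b \<gamma> i) = 0"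
      if t: "t \<in> T \<gamma>" for t
    proof -
      have "the (h (\<lambda>i. r i + v t i)) i = the (h r) i + (\<Sum>j<n. d i j * v t j)"
        using t i vR vsmall by (intro d) (auto simp: T_def)
      also have "(\<Sum>j<n. d i j * v t j) = (\<Sum>j<n. d i j * t ^ Suc j)" by (simp add: v_def)
      finally have "the (h (\<lambda>i. r i + v t i)) i = the (h r) i + (\<Sum>j<n. d i j * t ^ Suc j)" .
      moreover have "the (h (\<lambda>i. r i + v t i)) i = (\<Sum>j<n. A \<gamma> i j * (r j + v t j)) + b \<gamma> i"
        using t i Ab[OF \<gamma>(1) vR(2)] by (simp add: T_def)
      moreover have "(\<Sum>j<n. A \<gamma> i j * (r j + v t j)) = (\<Sum>j<n. A \<gamma> i j * r j) + (\<Sum>j<n. A \<gamma> i j * t ^ Suc j)"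
        by (simp add: v_def distrib_left sum.distrib)
      ultimately show ?thesis by (simp add: left_diff_distrib sum_subtractf)
    qed
    from moment_curve_coefficients[OF \<gamma>(2) eq]
    show "the (h r) i = (\<Sum>j<n. A \<gamma> i j * r j) + b \<gamma> i" "\<And>j. j < n \<Longrightarrow> d i j = A \<gamma> i j" by auto
  qed
  have "h x = Some (\<gamma> x)" if x: "x \<in> box_nbhd n r (e / 2)" for x
  proof -
    have xd: "x \<in> dom h" and xR: "x \<in> Rn n" using x e by (force simp: box_nbhd_def)+
    have "the (h x) i = \<gamma> x i" for i
    proof (cases "i < n")
      case True
      have "the (h (\<lambda>k. r k + (x k - r k))) i = the (h r) i + (\<Sum>j<n. d i j * (x j - r j))"
        using x rR True by (intro d) (auto simp: box_nbhd_def topspace_Euclidean_space)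
      also have "\<dots> = (\<Sum>j<n. A \<gamma> i j * r j) + b \<gamma> i + (\<Sum>j<n. A \<gamma> i j * (x j - r j))"
        using coeff[OF True] by simp
      also have "\<dots> = (\<Sum>j<n. A \<gamma> i j * x j) + b \<gamma> i"
        by (simp add: right_diff_distrib sum_subtractf)
      finally show ?thesis using Ab[OF \<gamma>(1) xR] True by simp
    next
      case False
      obtain y where y: "h x = Some y" "y \<in> Rn n" using xd hR by (auto simp: ran_def)
      then show ?thesis using Ab[OF \<gamma>(1) xR] False by (simp add: topspace_Euclidean_space)
    qed
    then have "the (h x) = \<gamma> x" by blast
    then show ?thesis using xd by auto
  qed
  moreover have "box_nbhd n r (e / 2) \<subseteq> dom h" using e by (force simp: box_nbhd_def)
  ultimately show thesis
    using that[OF \<gamma>(1) openin_box_nbhd[of n r "e / 2"]] center_in_box_nbhd[OF rR] e by simp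
qed

section \<open>Subgroups of the affine group\<close>

text \<open>
  The matrix of the inverse has the columns \<open>f (E j) - f 0\<close>; the affine map with this matrix and
  translation part \<open>f 0\<close> is a right inverse of \<open>g\<close> by linearity, and thus equal to \<open>f\<close>.
\<close>
lemma affine_on_inverse:
  assumes g: "affine_on n g" "\<And>y. y \<in> Rn n \<Longrightarrow> f y \<in> Rn n" "\<And>y. y \<in> Rn n \<Longrightarrow> g (f y) = y" "\<And>x. x \<in> Rn n \<Longrightarrow> f (g x) = x"
  shows "affine_on n f"
proof -
  obtain A b where Ab: "\<And>x. x \<in> Rn n \<Longrightarrow> g x = (\<lambda>i. if i < n then (\<Sum>j<n. A i j * x j) + b i else 0)"
    using g(1) unfolding affine_on_def by blast
  define u where "u = f (\<lambda>_. 0)"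
  define E where "E j = (\<lambda>i. if i = j then 1 else (0::real))" for j :: nat
  define w where "w j k = f (E j) k - u k" for j k
  have R: "(\<lambda>_. 0) \<in> Rn n" "\<And>j. j < n \<Longrightarrow> E j \<in> Rn n" by (auto simp: E_def topspace_Euclidean_space)
  have gu: "(\<Sum>k<n. A i k * u k) + b i = 0" if "i < n" for i
    using fun_cong[OF g(3)[OF R(1)], of i] Ab[OF g(2)[OF R(1)]] that by (simp add: u_def)
  have gw: "(\<Sum>k<n. A i k * w j k) = E j i" if "i < n" "j < n" for i j
  proof -
    have "(\<Sum>k<n. A i k * f (E j) k) + b i = E j i"
      using fun_cong[OF g(3)[OF R(2)[OF that(2)]], of i] Ab[OF g(2)[OF R(2)[OF that(2)]]] that by simp
    then show ?thesis using gu[OF that(1)] by (simp add: w_def right_diff_distrib sum_subtractf)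
  qed
  have "f y = (\<lambda>i. if i < n then (\<Sum>j<n. w j i * y j) + u i else 0)" (is "_ = ?z") if y: "y \<in> Rn n" for y
  proof -
    have zR: "?z \<in> Rn n" by (simp add: topspace_Euclidean_space)
    have "g ?z i = y i" for i
    proof (cases "i < n")
      case True
      have "g ?z i = (\<Sum>k<n. A i k * ((\<Sum>j<n. w j k * y j) + u k)) + b i"
        using Ab[OF zR] True by simp
      also have "\<dots> = (\<Sum>k<n. \<Sum>j<n. A i k * w j k * y j) + ((\<Sum>k<n. A i k * u k) + b i)"
        by (simp add: distrib_left sum.distrib sum_distrib_left mult.assoc)
      also have "(\<Sum>k<n. \<Sum>j<n. A i k * w j k * y j) = (\<Sum>j<n. (\<Sum>k<n. A i k * w j k) * y j)"
        by (subst sum.swap) (simp add: sum_distrib_right)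
      also have "\<dots> = (\<Sum>j<n. E j i * y j)" using gw True by simp
      also have "\<dots> = (\<Sum>j<n. if j = i then y j else 0)" by (intro sum.cong) (auto simp: E_def)
      also have "\<dots> = y i" using True by simp
      finally show ?thesis using gu[OF True] by simp
    next
      case False then show ?thesis using Ab[OF zR] y by (simp add: topspace_Euclidean_space)
    qed
    then have "g ?z = y" by blast
    then show ?thesis using g(4)[OF zR] by simp
  qed
  then show ?thesis
    unfolding affine_on_def by (intro exI[of _ "\<lambda>i j. w j i"] exI[of _ u]) simp
qed

lemma Aff_carrier: "g \<in> carrier (Aff n) \<longleftrightarrow> g \<in> Bij (Rn n) \<and> affine_on n g"
  by (simp add: Aff_def affine_on_def)

text \<open>
  The inverse in \<open>Aff n\<close> is defined by a description over the smaller carrier.  It is the inverse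
  bijection because that map is affine as well.
\<close>
lemma Aff_inv:
  assumes g: "g \<in> carrier (Aff n)"
  shows "inv\<^bsub>Aff n\<^esub> g = inv\<^bsub>BijGroup (Rn n)\<^esub> g"
proof -
  interpret B: group "BijGroup (Rn n)" by (rule group_BijGroup)
  define f where "f = inv\<^bsub>BijGroup (Rn n)\<^esub> g"
  have gB: "g \<in> carrier (BijGroup (Rn n))" "bij_betw g (Rn n) (Rn n)"
    using g by (auto simp: Aff_carrier BijGroup_def Bij_def)
  have fe: "f = (\<lambda>x\<in>Rn n. inv_into (Rn n) g x)"
    using inv_BijGroup g unfolding f_def Aff_carrier by blast
  have "affine_on n f"
  proof (rule affine_on_inverse)
    show "affine_on n g" using g by (simp add: Aff_carrier)
    fix y assume y: "y \<in> Rn n"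
    show "f y \<in> Rn n" "g (f y) = y"
      using y gB(2) fe by (auto simp: bij_betw_def inv_into_into f_inv_into_f)
    have "g y \<in> Rn n" using y gB(2) by (rule bij_betwE[rule_format, rotated])
    then show "f (g y) = y" using y gB(2) fe by (auto simp: bij_betw_def)
  qed
  then have fA: "f \<in> carrier (Aff n)"
    using B.inv_closed[OF gB(1)] unfolding Aff_carrier f_def[symmetric]
    by (simp add: BijGroup_def)
  have sub: "carrier (Aff n) \<subseteq> carrier (BijGroup (Rn n))" by (auto simp: Aff_def BijGroup_def)
  have ops: "x \<otimes>\<^bsub>Aff n\<^esub> y = x \<otimes>\<^bsub>BijGroup (Rn n)\<^esub> y" "\<one>\<^bsub>Aff n\<^esub> = \<one>\<^bsub>BijGroup (Rn n)\<^esub>" for x y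
    by (simp_all add: Aff_def)
  show ?thesis
    unfolding m_inv_def[of "Aff n"] f_def[symmetric]
  proof (rule the_equality)
    show "f \<in> carrier (Aff n) \<and> g \<otimes>\<^bsub>Aff n\<^esub> f = \<one>\<^bsub>Aff n\<^esub> \<and> f \<otimes>\<^bsub>Aff n\<^esub> g = \<one>\<^bsub>Aff n\<^esub>"
      using fA B.r_inv[OF gB(1)] B.l_inv[OF gB(1)] unfolding ops f_def[symmetric] by blast
    fix y assume "y \<in> carrier (Aff n) \<and> g \<otimes>\<^bsub>Aff n\<^esub> y = \<one>\<^bsub>Aff n\<^esub> \<and> y \<otimes>\<^bsub>Aff n\<^esub> g = \<one>\<^bsub>Aff n\<^esub>"
    then show "y = f"
      using B.inv_equality[OF _ gB(1), of y] sub unfolding f_def ops by auto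
  qed
qed

lemma
  assumes \<Gamma>: "subgroup \<Gamma> (Aff n)"
  shows affine_group_maps: "\<gamma> \<in> \<Gamma> \<Longrightarrow> x \<in> Rn n \<Longrightarrow> \<gamma> x \<in> Rn n"
    and affine_group_affine: "\<gamma> \<in> \<Gamma> \<Longrightarrow> affine_on n \<gamma>"
    and affine_group_id: "\<exists>\<iota>\<in>\<Gamma>. \<forall>x\<in>Rn n. \<iota> x = x"
    and affine_group_comp: "\<gamma> \<in> \<Gamma> \<Longrightarrow> \<delta> \<in> \<Gamma> \<Longrightarrow> \<exists>\<epsilon>\<in>\<Gamma>. \<forall>x\<in>Rn n. \<epsilon> x = \<gamma> (\<delta> x)"
    and affine_group_inv: "\<gamma> \<in> \<Gamma> \<Longrightarrow> \<exists>\<delta>\<in>\<Gamma>. \<forall>x\<in>Rn n. \<delta> (\<gamma> x) = x"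
proof -
  interpret B: group "BijGroup (Rn n)" by (rule group_BijGroup)
  have car: "\<gamma> \<in> carrier (Aff n)" if "\<gamma> \<in> \<Gamma>" for \<gamma> using \<Gamma> that by (rule subgroup.mem_carrier)
  have bij: "bij_betw \<gamma> (Rn n) (Rn n)" "\<gamma> \<in> Bij (Rn n)" if "\<gamma> \<in> \<Gamma>" for \<gamma>
    using car[OF that] by (auto simp: Aff_carrier Bij_def)
  show maps: "\<gamma> x \<in> Rn n" if "\<gamma> \<in> \<Gamma>" "x \<in> Rn n" for \<gamma> x
    using bij(1)[OF that(1)] that(2) by (rule bij_betwE[rule_format])
  show "affine_on n \<gamma>" if "\<gamma> \<in> \<Gamma>" for \<gamma> using car[OF that] by (simp add: Aff_carrier)
  show "\<exists>\<iota>\<in>\<Gamma>. \<forall>x\<in>Rn n. \<iota> x = x"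
    using subgroup.one_closed[OF \<Gamma>] by (intro bexI[of _ "\<one>\<^bsub>Aff n\<^esub>"]) (auto simp: Aff_def BijGroup_def)
  show "\<exists>\<epsilon>\<in>\<Gamma>. \<forall>x\<in>Rn n. \<epsilon> x = \<gamma> (\<delta> x)" if "\<gamma> \<in> \<Gamma>" "\<delta> \<in> \<Gamma>" for \<gamma> \<delta>
    using subgroup.m_closed[OF \<Gamma> that] bij(2)[OF that(1)] bij(2)[OF that(2)]
    by (intro bexI[of _ "\<gamma> \<otimes>\<^bsub>Aff n\<^esub> \<delta>"]) (auto simp: Aff_def BijGroup_def compose_def)
  show "\<exists>\<delta>\<in>\<Gamma>. \<forall>x\<in>Rn n. \<delta> (\<gamma> x) = x" if "\<gamma> \<in> \<Gamma>" for \<gamma>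
  proof (intro bexI ballI)
    show "inv\<^bsub>Aff n\<^esub> \<gamma> \<in> \<Gamma>" by (rule subgroup.m_inv_closed[OF \<Gamma> that])
    show "(inv\<^bsub>Aff n\<^esub> \<gamma>) (\<gamma> x) = x" if "x \<in> Rn n" for x
      using bij[OF \<open>\<gamma> \<in> \<Gamma>\<close>] maps[OF \<open>\<gamma> \<in> \<Gamma>\<close> that] that
      unfolding Aff_inv[OF car[OF \<open>\<gamma> \<in> \<Gamma>\<close>]] by (simp add: inv_BijGroup bij_betw_def)
  qed
qed

section \<open>Local diffeomorphisms and their inverses\<close>

lemma map_comp_assoc: "(f \<circ>\<^sub>m g) \<circ>\<^sub>m h = f \<circ>\<^sub>m (g \<circ>\<^sub>m h)"
  by (rule ext) (simp add: map_comp_def split: option.splits)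

lemma map_comp_eq_Some: "(f \<circ>\<^sub>m g) x = Some z \<longleftrightarrow> (\<exists>y. g x = Some y \<and> f y = Some z)"
  by (auto simp: map_comp_def split: option.splits)

definition local_smooth :: "'a diffspace \<Rightarrow> 'b diffspace \<Rightarrow> ('a \<rightharpoonup> 'b) \<Rightarrow> bool" where
  "local_smooth X Y f \<longleftrightarrow> openin (D_topology X) (dom f) \<and> ran f \<subseteq> points Y \<and>
     (\<forall>m p. (m, p) \<in> plots X \<longrightarrow> ran p \<subseteq> dom f \<longrightarrow> (m, f \<circ>\<^sub>m p) \<in> plots Y)"

text \<open>
  Carrying the inverse along makes the notion of local diffeomorphism symmetric, and inverses of
  composites become explicit.
\<close>
definition local_diffeo_pair :: "'a diffspace \<Rightarrow> 'b diffspace \<Rightarrow> ('a \<rightharpoonup> 'b) \<Rightarrow> ('b \<rightharpoonup> 'a) \<Rightarrow> bool" where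
  "local_diffeo_pair X Y f g \<longleftrightarrow> local_smooth X Y f \<and> local_smooth Y X g \<and>
     (\<forall>x y. f x = Some y \<longleftrightarrow> g y = Some x)"

lemma map_inv_eq_Some:
  assumes "inj_on f (dom f)"
  shows "map_inv f y = Some x \<longleftrightarrow> f x = Some y"
proof -
  have "(SOME x. f x = Some y) = x" if "f x = Some y" for x
  proof (rule some_equality)
    show "f x = Some y" by (rule that)
    fix z assume "f z = Some y"
    then show "z = x" by (intro inj_onD[OF assms]) (use that in auto)
  qed
  then show ?thesis by (auto simp: map_inv_def ran_def)
qed

lemma map_inv_unique:
  assumes "\<And>x y. f x = Some y \<longleftrightarrow> g y = Some x"
  shows "map_inv f = g" "inj_on f (dom f)"
proof -
  show inj: "inj_on f (dom f)"
  proof (rule inj_onI)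
    fix x y assume "x \<in> dom f" "y \<in> dom f" "f x = f y"
    then obtain z where "f x = Some z" "f y = Some z" by auto
    then have "g z = Some x" "g z = Some y" using assms by auto
    then show "x = y" by simp
  qed
  have "map_inv f y = Some x \<longleftrightarrow> g y = Some x" for x y
    using map_inv_eq_Some[OF inj] assms by simp
  then show "map_inv f = g" by (metis ext option.exhaust)
qed

lemma openin_D_topology_points: "openin (D_topology X) U \<Longrightarrow> U \<subseteq> points X"
  by (simp add: openin_D_topology)

lemma openin_D_topology_all:
  assumes "diffeology X"
  shows "openin (D_topology X) (points X)"
  unfolding openin_D_topology
proof (intro conjI ballI, simp, clarify)
  fix m p assume "(m, p) \<in> plots X"
  then have "openin (Euclidean_space m) (dom p)" "ran p \<subseteq> points X"
    using assms unfolding diffeology_def parametrizations_def by auto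
  moreover from this have "p -` Some ` points X = dom p" by (auto simp: ran_def)
  ultimately show "openin (Euclidean_space m) (p -` Some ` points X)" by simp
qed

lemma dom_map_comp: "dom (f \<circ>\<^sub>m g) = g -` Some ` dom f"
  by (force simp: map_comp_def split: option.splits)

lemma ran_map_comp: "ran (f \<circ>\<^sub>m g) \<subseteq> ran f"
  by (auto simp: ran_def map_comp_eq_Some)

lemma local_diffeo_iff_pair: "local_diffeo X Y f \<longleftrightarrow> (\<exists>g. local_diffeo_pair X Y f g)"
proof
  assume L: "local_diffeo X Y f"
  then have o: "openin (D_topology X) (dom f)" "openin (D_topology Y) (ran f)"
    and inj: "inj_on f (dom f)"
    and s: "smooth_map (subset_diff X (dom f)) (subset_diff Y (ran f)) f"
      "smooth_map (subset_diff Y (ran f)) (subset_diff X (dom f)) (map_inv f)"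
    unfolding local_diffeo_def diffeomorphism_def by auto
  have "dom (map_inv f) = ran f" by (auto simp: map_inv_def split: if_splits)
  moreover have "ran (map_inv f) = dom f"
    using map_inv_eq_Some[OF inj] by (auto simp: ran_def dom_def)
  ultimately have "local_diffeo_pair X Y f (map_inv f)"
    using o s map_inv_eq_Some[OF inj] openin_D_topology_points
    unfolding local_diffeo_pair_def local_smooth_def smooth_map_def subset_diff_def by auto
  then show "\<exists>g. local_diffeo_pair X Y f g" by blast
next
  assume "\<exists>g. local_diffeo_pair X Y f g"
  then obtain g where g: "local_diffeo_pair X Y f g" ..
  then have fg: "f x = Some y \<longleftrightarrow> g y = Some x" for x y by (simp add: local_diffeo_pair_def)
  have dr: "dom g = ran f" "ran g = dom f" using fg by (auto simp: ran_def dom_def)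
  have o: "openin (D_topology X) (dom f)" "openin (D_topology Y) (ran f)"
    using g by (auto simp: local_diffeo_pair_def local_smooth_def simp flip: dr)
  have sub: "dom f \<subseteq> points X" "ran f \<subseteq> points Y" using o openin_D_topology_points by auto
  have "ran (f \<circ>\<^sub>m p) \<subseteq> ran f" for p :: "(nat \<Rightarrow> real) \<rightharpoonup> 'a" by (rule ran_map_comp)
  moreover have "ran (g \<circ>\<^sub>m p) \<subseteq> dom f" for p :: "(nat \<Rightarrow> real) \<rightharpoonup> 'b"
    using ran_map_comp[of g p] dr by simp
  ultimately show "local_diffeo X Y f"
    using g o sub dr map_inv_unique[of f g, OF fg]
    unfolding local_diffeo_def diffeomorphism_def smooth_map_def subset_diff_def
      local_diffeo_pair_def local_smooth_def by auto
qed

lemma local_diffeo_pair_sym: "local_diffeo_pair X Y f g \<Longrightarrow> local_diffeo_pair Y X g f"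
  by (auto simp: local_diffeo_pair_def)

lemma local_diffeo_pair_preimage:
  assumes "diffeology X" "diffeology Y" "local_diffeo_pair X Y f g" "openin (D_topology Y) V"
  shows "openin (D_topology X) (f -` Some ` V)"
  using assms local_diffeo_preimage local_diffeo_iff_pair by blast

lemma local_smooth_comp:
  assumes "diffeology X" "diffeology Y" and f: "local_diffeo_pair X Y f f'" and g: "local_smooth Y Z g"
  shows "local_smooth X Z (g \<circ>\<^sub>m f)"
  unfolding local_smooth_def
proof (intro conjI allI impI)
  have dg: "openin (D_topology Y) (dom g)" and rg: "ran g \<subseteq> points Z"
    using g by (auto simp: local_smooth_def)
  show "openin (D_topology X) (dom (g \<circ>\<^sub>m f))"
    unfolding dom_map_comp by (rule local_diffeo_pair_preimage[OF assms(1-3) dg])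
  show "ran (g \<circ>\<^sub>m f) \<subseteq> points Z" using ran_map_comp[of g f] rg by auto
  fix m p assume p: "(m, p) \<in> plots X" "ran p \<subseteq> dom (g \<circ>\<^sub>m f)"
  then have "ran p \<subseteq> dom f" "ran (f \<circ>\<^sub>m p) \<subseteq> dom g"
    by (auto simp: ran_def map_comp_eq_Some dom_map_comp)
  then have "(m, g \<circ>\<^sub>m (f \<circ>\<^sub>m p)) \<in> plots Z"
    using f g p by (auto simp: local_diffeo_pair_def local_smooth_def)
  then show "(m, (g \<circ>\<^sub>m f) \<circ>\<^sub>m p) \<in> plots Z" by (simp add: map_comp_assoc)
qed

lemma local_diffeo_pair_comp:
  assumes "diffeology X" "diffeology Y" "diffeology Z"
    and f: "local_diffeo_pair X Y f f'" and g: "local_diffeo_pair Y Z g g'"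
  shows "local_diffeo_pair X Z (g \<circ>\<^sub>m f) (f' \<circ>\<^sub>m g')"
  unfolding local_diffeo_pair_def
proof (intro conjI allI)
  show "local_smooth X Z (g \<circ>\<^sub>m f)"
    by (rule local_smooth_comp[OF assms(1,2) f]) (use g in \<open>simp add: local_diffeo_pair_def\<close>)
  show "local_smooth Z X (f' \<circ>\<^sub>m g')"
    by (rule local_smooth_comp[OF assms(3,2) local_diffeo_pair_sym[OF g]])
      (use f in \<open>simp add: local_diffeo_pair_def\<close>)
  show "(g \<circ>\<^sub>m f) x = Some z \<longleftrightarrow> (f' \<circ>\<^sub>m g') z = Some x" for x z
    using f g unfolding map_comp_eq_Some local_diffeo_pair_def by blast
qed

lemma identity_comp_plot:
  assumes "diffeology X" "(m, p) \<in> plots X"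
  shows "(Some |` points X) \<circ>\<^sub>m p = p"
proof
  fix x
  have "ran p \<subseteq> points X" using assms by (auto simp: diffeology_def parametrizations_def)
  then show "((Some |` points X) \<circ>\<^sub>m p) x = p x"
    by (auto simp: map_comp_def ran_def restrict_map_def split: option.splits)
qed

lemma local_diffeo_pair_id:
  assumes "diffeology X"
  shows "local_diffeo_pair X X (Some |` points X) (Some |` points X)"
proof -
  have "(Some |` points X) \<circ>\<^sub>m p = p" if "(m, p) \<in> plots X" for m p
    by (rule identity_comp_plot[OF assms that])
  moreover have "dom (Some |` points X) = points X" "ran (Some |` points X) \<subseteq> points X"
    by (auto simp: ran_def restrict_map_def split: if_splits)
  ultimately show ?thesis
    using openin_D_topology_all[OF assms]
    by (auto simp: local_diffeo_pair_def local_smooth_def restrict_map_def split: if_splits)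
qed

text \<open>
  Morphisms over a common base: \<open>e\<close> and \<open>e'\<close> play the role of evaluation maps.
\<close>
definition local_diffeo_over ::
    "'a diffspace \<Rightarrow> ('a \<Rightarrow> 'x) \<Rightarrow> 'b diffspace \<Rightarrow> ('b \<Rightarrow> 'x) \<Rightarrow> ('a \<rightharpoonup> 'b) \<Rightarrow> ('b \<rightharpoonup> 'a) \<Rightarrow> bool" where
  "local_diffeo_over N e N' e' f g \<longleftrightarrow> local_diffeo_pair N N' f g \<and>
     (\<forall>x y. f x = Some y \<longrightarrow> e' y = e x)"

lemma local_diffeo_over_imp: "local_diffeo_over N e N' e' f g \<Longrightarrow> local_diffeo N N' f"
  unfolding local_diffeo_over_def local_diffeo_iff_pair by blast

lemma local_diffeo_over_sym: "local_diffeo_over N e N' e' f g \<Longrightarrow> local_diffeo_over N' e' N e g f"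
  by (auto simp: local_diffeo_over_def local_diffeo_pair_def)

lemma local_diffeo_over_comp:
  assumes "diffeology X" "diffeology Y" "diffeology Z"
    and "local_diffeo_over X a Y b f f'" "local_diffeo_over Y b Z c g g'"
  shows "local_diffeo_over X a Z c (g \<circ>\<^sub>m f) (f' \<circ>\<^sub>m g')"
  using assms local_diffeo_pair_comp[OF assms(1-3)]
  unfolding local_diffeo_over_def map_comp_eq_Some by metis

lemma local_diffeo_over_id:
  "diffeology X \<Longrightarrow> local_diffeo_over X e X e (Some |` points X) (Some |` points X)"
  unfolding local_diffeo_over_def
  by (intro conjI local_diffeo_pair_id) (auto simp: restrict_map_def split: if_splits)

lemma local_diffeo_over_open:
  assumes "local_diffeo_over N e N' e' f g"
  shows "openin (D_topology N) (dom f)"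
  using assms by (simp add: local_diffeo_over_def local_diffeo_pair_def local_smooth_def)

lemma local_diffeo_over_inverse:
  "local_diffeo_over N e N' e' f g \<Longrightarrow> f x = Some y \<longleftrightarrow> g y = Some x"
  by (simp add: local_diffeo_over_def local_diffeo_pair_def)

lemma local_diffeo_over_preimage:
  assumes "diffeology X" "diffeology Y" "local_diffeo_over X a Y b f g" "openin (D_topology Y) V"
  shows "openin (D_topology X) (f -` Some ` V)"
  using assms local_diffeo_pair_preimage unfolding local_diffeo_over_def by blast

lemma germ_eqI:
  assumes V: "openin (D_topology N) V" "\<nu> \<in> V" and eq: "\<And>x. x \<in> V \<Longrightarrow> \<Phi> x = \<Psi> x"
  shows "germ N \<Phi> \<nu> = germ N \<Psi> \<nu>"
proof -
  have half: "snd (germ N g \<nu>) \<subseteq> snd (germ N h \<nu>)" if gh: "\<And>z. z \<in> V \<Longrightarrow> g z = h z" for g h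
  proof
    fix \<theta> assume "\<theta> \<in> snd (germ N g \<nu>)"
    then obtain T where T: "openin (D_topology N) T" "\<nu> \<in> T" "T \<subseteq> dom g" "T \<subseteq> dom \<theta>" "g |` T = \<theta> |` T"
      unfolding germ_def snd_conv by blast
    have "openin (D_topology N) (T \<inter> V)" "\<nu> \<in> T \<inter> V" "T \<inter> V \<subseteq> dom \<theta>" using T V by auto
    moreover have "T \<inter> V \<subseteq> dom h" using T(3) gh by (metis IntD1 IntD2 domIff subset_iff)
    moreover have "h |` (T \<inter> V) = \<theta> |` (T \<inter> V)"
    proof
      fix z show "(h |` (T \<inter> V)) z = (\<theta> |` (T \<inter> V)) z"
        using fun_cong[OF T(5), of z] gh[of z] by (auto simp: restrict_map_def)
    qed
    ultimately show "\<theta> \<in> snd (germ N h \<nu>)" unfolding germ_def snd_conv by blast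
  qed
  have "snd (germ N \<Phi> \<nu>) = snd (germ N \<Psi> \<nu>)"
    using half[of \<Phi> \<Psi>] half[of \<Psi> \<Phi>] eq by auto
  then show ?thesis by (simp add: germ_def)
qed

text \<open>
  The converse of \<open>germ_eqI\<close> needs \<open>\<Psi>\<close> to be defined near \<open>\<nu>\<close>: only then does \<open>\<Psi>\<close> belong to its
  own germ, and comparing the germs yields a neighbourhood of agreement.
\<close>
lemma germ_eqD:
  assumes "openin (D_topology N) (dom \<Psi>)" "\<Psi> \<nu> = Some \<mu>" "germ N \<Phi> \<nu> = germ N \<Psi> \<nu>"
  obtains V where "openin (D_topology N) V" "\<nu> \<in> V" "\<forall>x\<in>V. \<exists>y. \<Phi> x = Some y \<and> \<Psi> x = Some y"
proof -
  have "\<Psi> \<in> snd (germ N \<Psi> \<nu>)" using assms(1,2) by (auto simp: germ_def)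
  then have "\<Psi> \<in> snd (germ N \<Phi> \<nu>)" using assms(3) by simp
  then obtain V where V: "openin (D_topology N) V" "\<nu> \<in> V" "V \<subseteq> dom \<Phi>" "\<Phi> |` V = \<Psi> |` V"
    unfolding germ_def snd_conv by blast
  have "\<exists>y. \<Phi> x = Some y \<and> \<Psi> x = Some y" if x: "x \<in> V" for x
    using fun_cong[OF V(4), of x] subsetD[OF V(3) x] x by (simp add: domIff split: option.splits)
  then show thesis using that V by blast
qed

section \<open>Groupoids of germs over a base\<close>

text \<open>
  The structure groupoid for an arbitrary diffeological space with a map to a set.  Allowing any map
  \<open>e\<close> lets an atlas of \<open>X\<close> be compared with one of a diffeomorphic \<open>X'\<close>: both are put over \<open>X'\<close>.
\<close>
definition germ_groupoid :: "'a diffspace \<Rightarrow> ('a \<Rightarrow> 'x) \<Rightarrow> ('a, 'a germ) category" where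
  "germ_groupoid N e =
     \<lparr>Obj = points N,
      Arr = {germ N \<Phi> \<nu> | \<Phi> \<nu>. local_diffeo N N \<Phi> \<and> \<nu> \<in> dom \<Phi> \<and>
               (\<forall>\<mu>\<in>dom \<Phi>. e (the (\<Phi> \<mu>)) = e \<mu>)},
      Dom = germ_source,
      Cod = germ_target,
      Ident = germ N (Some |` points N),
      Comp = germ_compose N\<rparr>"

lemma germ_groupoid_simps:
  "Obj (germ_groupoid N e) = points N"
  "Dom (germ_groupoid N e) = germ_source"
  "Cod (germ_groupoid N e) = germ_target"
  "Ident (germ_groupoid N e) = germ N (Some |` points N)"
  "Comp (germ_groupoid N e) = germ_compose N"
  by (simp_all add: germ_groupoid_def)

lemma Arr_germ_groupoid:
  "f \<in> Arr (germ_groupoid N e) \<longleftrightarrow>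
     (\<exists>\<Phi> \<Psi> a b. local_diffeo_over N e N e \<Phi> \<Psi> \<and> \<Phi> a = Some b \<and> f = germ N \<Phi> a)"
proof -
  have "f \<in> Arr (germ_groupoid N e) \<longleftrightarrow> (\<exists>\<Phi> a. (\<exists>\<Psi>. local_diffeo_pair N N \<Phi> \<Psi>) \<and> a \<in> dom \<Phi> \<and>
      (\<forall>\<mu>\<in>dom \<Phi>. e (the (\<Phi> \<mu>)) = e \<mu>) \<and> f = germ N \<Phi> a)"
    unfolding local_diffeo_iff_pair[symmetric] by (auto simp: germ_groupoid_def)
  moreover have "(\<forall>\<mu>\<in>dom \<Phi>. e (the (\<Phi> \<mu>)) = e \<mu>) \<longleftrightarrow> (\<forall>x y. \<Phi> x = Some y \<longrightarrow> e y = e x)" for \<Phi>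
    by (force simp: dom_def)
  ultimately show ?thesis unfolding local_diffeo_over_def by blast
qed

lemma germ_target_over:
  assumes "local_diffeo_over N e N e \<Phi> \<Psi>" "\<Phi> a = Some b"
  shows "germ_target (germ N \<Phi> a) = b"
  by (rule germ_target_germ[OF local_diffeo_over_imp[OF assms(1)] assms(2)])

lemma hom_germ_groupoid:
  "f \<in> hom_set (germ_groupoid N e) a b \<longleftrightarrow>
     (\<exists>\<Phi> \<Psi>. local_diffeo_over N e N e \<Phi> \<Psi> \<and> \<Phi> a = Some b \<and> f = germ N \<Phi> a)"
proof
  assume "f \<in> hom_set (germ_groupoid N e) a b"
  then obtain \<Phi> \<Psi> a' b' where *: "local_diffeo_over N e N e \<Phi> \<Psi>" "\<Phi> a' = Some b'" "f = germ N \<Phi> a'"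
    "germ_source f = a" "germ_target f = b"
    unfolding hom_set_def Arr_germ_groupoid germ_groupoid_simps by blast
  then have "a' = a" "b' = b"
    using germ_target_over[OF *(1,2)] germ_source_germ[of N \<Phi> a'] by simp_all
  then show "\<exists>\<Phi> \<Psi>. local_diffeo_over N e N e \<Phi> \<Psi> \<and> \<Phi> a = Some b \<and> f = germ N \<Phi> a" using * by blast
next
  assume "\<exists>\<Phi> \<Psi>. local_diffeo_over N e N e \<Phi> \<Psi> \<and> \<Phi> a = Some b \<and> f = germ N \<Phi> a"
  then obtain \<Phi> \<Psi> where *: "local_diffeo_over N e N e \<Phi> \<Psi>" "\<Phi> a = Some b" "f = germ N \<Phi> a"
    by blast
  have "f \<in> Arr (germ_groupoid N e)" unfolding Arr_germ_groupoid using * by blast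
  moreover have "germ_source f = a" "germ_target f = b"
    using germ_target_over[OF *(1,2)] germ_source_germ[of N \<Phi> a] *(3) by simp_all
  ultimately show "f \<in> hom_set (germ_groupoid N e) a b" by (simp add: hom_set_def germ_groupoid_simps)
qed

lemma germ_compose_over:
  assumes "diffeology N" "local_diffeo_over N e N e \<Phi> \<Phi>'" "local_diffeo_over N e N e \<Psi> \<Psi>'"
    "\<Phi> a = Some b" "\<Psi> b = Some c"
  shows "germ_compose N (germ N \<Psi> b) (germ N \<Phi> a) = germ N (\<Psi> \<circ>\<^sub>m \<Phi>) a"
proof (rule germ_comp[of N \<Phi> \<Psi> a b, OF assms(1) _ _ assms(4)])
  show "local_diffeo N N \<Phi>" "local_diffeo N N \<Psi>"
    using assms(2,3) by (simp_all add: local_diffeo_over_imp)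
  show "b \<in> dom \<Psi>" using assms(5) by blast
qed

lemma local_diffeo_over_points:
  assumes "local_diffeo_over N e N' e' \<Phi> \<Psi>" "\<Phi> a = Some b"
  shows "a \<in> points N" "b \<in> points N'"
proof -
  show "a \<in> points N"
    using openin_D_topology_points[OF local_diffeo_over_open[OF assms(1)]] assms(2) by blast
  have "\<Psi> b = Some a" using assms local_diffeo_over_inverse by metis
  then show "b \<in> points N'"
    using openin_D_topology_points[OF local_diffeo_over_open[OF local_diffeo_over_sym[OF assms(1)]]] by blast
qed

lemma germ_groupoid_category:
  assumes N: "diffeology N"
  shows "is_category (germ_groupoid N e)"
  unfolding is_category_def germ_groupoid_simps
proof (intro conjI ballI)
  fix f assume "f \<in> Arr (germ_groupoid N e)"
  then obtain \<Phi> \<Psi> a b where *: "local_diffeo_over N e N e \<Phi> \<Psi>" "\<Phi> a = Some b" "f = germ N \<Phi> a"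
    unfolding Arr_germ_groupoid by blast
  show "germ_source f \<in> points N" "germ_target f \<in> points N"
    using local_diffeo_over_points[OF *(1,2)] germ_target_over[OF *(1,2)] by (simp_all add: *(3) germ_source_germ)
next
  fix a assume "a \<in> points N"
  then show "germ N (Some |` points N) a \<in> hom_set (germ_groupoid N e) a a"
    unfolding hom_germ_groupoid using local_diffeo_over_id[OF N, of e]
    by (intro exI[of _ "Some |` points N"] conjI) auto
next
  fix a b c f g assume "f \<in> hom_set (germ_groupoid N e) a b" "g \<in> hom_set (germ_groupoid N e) b c"
  then obtain \<Phi> \<Phi>' \<Psi> \<Psi>' where *: "local_diffeo_over N e N e \<Phi> \<Phi>'" "\<Phi> a = Some b" "f = germ N \<Phi> a"
    "local_diffeo_over N e N e \<Psi> \<Psi>'" "\<Psi> b = Some c" "g = germ N \<Psi> b"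
    unfolding hom_germ_groupoid by blast
  have "(\<Psi> \<circ>\<^sub>m \<Phi>) a = Some c" using *(2,5) by simp
  then show "germ_compose N g f \<in> hom_set (germ_groupoid N e) a c"
    unfolding hom_germ_groupoid *(3,6) germ_compose_over[OF N *(1,4,2,5)]
    using local_diffeo_over_comp[OF N N N *(1,4)] by blast
next
  fix a b f assume ab: "a \<in> points N" "b \<in> points N" and "f \<in> hom_set (germ_groupoid N e) a b"
  then obtain \<Phi> \<Phi>' where *: "local_diffeo_over N e N e \<Phi> \<Phi>'" "\<Phi> a = Some b" "f = germ N \<Phi> a"
    unfolding hom_germ_groupoid by blast
  note id = local_diffeo_over_id[OF N, of e]
  have "\<Phi> \<circ>\<^sub>m (Some |` points N) = \<Phi>" "(Some |` points N) \<circ>\<^sub>m \<Phi> = \<Phi>"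
    using local_diffeo_over_points[OF *(1)]
    by (auto simp: map_comp_def restrict_map_def fun_eq_iff split: option.splits) (metis option.exhaust)+
  then show "germ_compose N f (germ N (Some |` points N) a) = f"
    "germ_compose N (germ N (Some |` points N) b) f = f"
    using germ_compose_over[OF N id *(1) _ *(2), of a] germ_compose_over[OF N *(1) id *(2), of b] ab
    by (simp_all add: *(3))
next
  fix a b c d f g h
  assume "f \<in> hom_set (germ_groupoid N e) a b" "g \<in> hom_set (germ_groupoid N e) b c"
    "h \<in> hom_set (germ_groupoid N e) c d"
  then obtain \<Phi> \<Phi>' \<Psi> \<Psi>' \<Xi> \<Xi>' where *: "local_diffeo_over N e N e \<Phi> \<Phi>'" "\<Phi> a = Some b" "f = germ N \<Phi> a"
    "local_diffeo_over N e N e \<Psi> \<Psi>'" "\<Psi> b = Some c" "g = germ N \<Psi> b"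
    "local_diffeo_over N e N e \<Xi> \<Xi>'" "\<Xi> c = Some d" "h = germ N \<Xi> c"
    unfolding hom_germ_groupoid by blast
  have c: "(\<Psi> \<circ>\<^sub>m \<Phi>) a = Some c" "(\<Xi> \<circ>\<^sub>m \<Psi>) b = Some d" using * by (simp_all add: map_comp_eq_Some)
  show "germ_compose N h (germ_compose N g f) = germ_compose N (germ_compose N h g) f"
    unfolding *(3,6,9) germ_compose_over[OF N *(1,4,2,5)] germ_compose_over[OF N *(4,7,5,8)]
      germ_compose_over[OF N local_diffeo_over_comp[OF N N N *(1,4)] *(7) c(1) *(8)]
      germ_compose_over[OF N *(1) local_diffeo_over_comp[OF N N N *(4,7)] *(2) c(2)]
    by (simp add: map_comp_assoc)
qed

text \<open>
  Conjugation by chosen local diffeomorphisms \<open>\<Theta> \<nu>\<close> from \<open>\<nu>\<close> to \<open>S \<nu>\<close>.  The assumption \<open>link\<close> is used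
  twice: for the choice of \<open>\<Theta>\<close>, and to reach an arbitrary object \<open>c\<close> of the second groupoid from
  \<open>S a\<close>, by going back along \<open>\<Theta> a\<close> and then from \<open>a\<close> to \<open>c\<close>.
\<close>
theorem germ_groupoids_equivalent:
  assumes N: "diffeology N" and N': "diffeology N'"
    and link: "\<And>\<nu> \<nu>'. \<nu> \<in> points N \<Longrightarrow> \<nu>' \<in> points N' \<Longrightarrow> e \<nu> = e' \<nu>' \<Longrightarrow>
                 \<exists>f g. local_diffeo_over N e N' e' f g \<and> f \<nu> = Some \<nu>'"
    and image: "e ` points N = e' ` points N'"
  shows "equivalent_categories (germ_groupoid N e) (germ_groupoid N' e')"
proof -
  let ?G = "germ_groupoid N e" and ?G' = "germ_groupoid N' e'"
  have "\<forall>\<nu>. \<exists>z. \<nu> \<in> points N \<longrightarrow> local_diffeo_over N e N' e' (fst z) (fst (snd z)) \<and> (fst z) \<nu> = Some (snd (snd z))"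
  proof (intro allI)
    fix \<nu>
    show "\<exists>z. \<nu> \<in> points N \<longrightarrow> local_diffeo_over N e N' e' (fst z) (fst (snd z)) \<and> (fst z) \<nu> = Some (snd (snd z))"
    proof (cases "\<nu> \<in> points N")
      case True
      then have "e \<nu> \<in> e' ` points N'" using image by blast
      then obtain \<nu>' where "\<nu>' \<in> points N'" "e \<nu> = e' \<nu>'" by blast
      with link[OF True] show ?thesis unfolding split_paired_Ex fst_conv snd_conv by blast
    qed simp
  qed
  from choice[OF this] obtain z where z: "\<And>\<nu>. \<nu> \<in> points N \<Longrightarrow>
      local_diffeo_over N e N' e' (fst (z \<nu>)) (fst (snd (z \<nu>))) \<and> (fst (z \<nu>)) \<nu> = Some (snd (snd (z \<nu>)))"
    by blast
  define \<Theta> where "\<Theta> \<nu> = fst (z \<nu>)" for \<nu>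
  define \<Theta>' where "\<Theta>' \<nu> = fst (snd (z \<nu>))" for \<nu>
  define S where "S \<nu> = snd (snd (z \<nu>))" for \<nu>
  have \<Theta>: "local_diffeo_over N e N' e' (\<Theta> \<nu>) (\<Theta>' \<nu>)" "\<Theta> \<nu> \<nu> = Some (S \<nu>)"
    if "\<nu> \<in> points N" for \<nu>
    using z[OF that] by (simp_all add: \<Theta>_def \<Theta>'_def S_def)
  have S: "S \<nu> \<in> points N'" "\<Theta>' \<nu> (S \<nu>) = Some \<nu>" if "\<nu> \<in> points N" for \<nu>
    using local_diffeo_over_points(2)[OF \<Theta>[OF that]] local_diffeo_over_inverse[OF \<Theta>(1)[OF that]] \<Theta>(2)[OF that]
    by simp_all
  define conj where "conj a b \<Phi> = \<Theta> b \<circ>\<^sub>m (\<Phi> \<circ>\<^sub>m \<Theta>' a)" for a b \<Phi>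
  \<comment> \<open>arrows are bare germs, so a representative has to be chosen; the result \<open>M\<close> does not depend on it\<close>
  define rep where "rep f = (SOME \<Phi>. (\<exists>\<Psi>. local_diffeo_over N e N e \<Phi> \<Psi>) \<and>
      \<Phi> (germ_source f) = Some (germ_target f) \<and> f = germ N \<Phi> (germ_source f))" for f
  define M where "M f = germ N' (conj (germ_source f) (germ_target f) (rep f)) (S (germ_source f))" for f
  have conj_over: "\<exists>\<Psi>'. local_diffeo_over N' e' N' e' (conj a b \<Phi>) \<Psi>'" "conj a b \<Phi> (S a) = Some (S b)"
    if "local_diffeo_over N e N e \<Phi> \<Psi>" "\<Phi> a = Some b" for a b \<Phi> \<Psi>
  proof -
    have ab: "a \<in> points N" "b \<in> points N" using local_diffeo_over_points[OF that] by auto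
    show "\<exists>\<Psi>'. local_diffeo_over N' e' N' e' (conj a b \<Phi>) \<Psi>'"
      unfolding conj_def
      using local_diffeo_over_comp[OF N' N N' local_diffeo_over_comp[OF N' N N
          local_diffeo_over_sym[OF \<Theta>(1)[OF ab(1)]] that(1)] \<Theta>(1)[OF ab(2)]] by blast
    show "conj a b \<Phi> (S a) = Some (S b)"
      unfolding conj_def map_comp_eq_Some using S(2)[OF ab(1)] that(2) \<Theta>(2)[OF ab(2)] by blast
  qed
  have M: "M (germ N \<Phi> a) = germ N' (conj a b \<Phi>) (S a)"
    if \<Phi>: "local_diffeo_over N e N e \<Phi> \<Psi>" "\<Phi> a = Some b" for a b \<Phi> \<Psi>
  proof -
    have src: "germ_source (germ N \<Phi> a) = a" by (rule germ_source_germ)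
    have tgt: "germ_target (germ N \<Phi> a) = b" by (rule germ_target_over[OF \<Phi>])
    have a: "a \<in> points N" using local_diffeo_over_points[OF \<Phi>] by simp
    define \<Phi>1 where "\<Phi>1 = rep (germ N \<Phi> a)"
    have "(\<exists>\<Psi>. local_diffeo_over N e N e \<Phi>1 \<Psi>) \<and> \<Phi>1 a = Some b \<and> germ N \<Phi> a = germ N \<Phi>1 a"
      unfolding \<Phi>1_def rep_def src tgt by (rule someI[of _ \<Phi>]) (use \<Phi> in blast)
    then obtain \<Psi>1 where \<Phi>1: "local_diffeo_over N e N e \<Phi>1 \<Psi>1" "\<Phi>1 a = Some b" "germ N \<Phi> a = germ N \<Phi>1 a"
      by blast
    obtain V where V: "openin (D_topology N) V" "a \<in> V" "\<forall>x\<in>V. \<exists>y. \<Phi> x = Some y \<and> \<Phi>1 x = Some y"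
      using germ_eqD[OF local_diffeo_over_open[OF \<Phi>1(1)] \<Phi>1(2) \<Phi>1(3)] by blast
    have "germ N' (conj a b \<Phi>1) (S a) = germ N' (conj a b \<Phi>) (S a)"
    proof (rule germ_eqI)
      show "openin (D_topology N') (\<Theta>' a -` Some ` V)"
        by (rule local_diffeo_over_preimage[OF N' N local_diffeo_over_sym[OF \<Theta>(1)[OF a]] V(1)])
      show "S a \<in> \<Theta>' a -` Some ` V" using S(2)[OF a] V(2) by simp
      show "conj a b \<Phi>1 x = conj a b \<Phi> x" if "x \<in> \<Theta>' a -` Some ` V" for x
        using that V(3) by (force simp: conj_def map_comp_def)
    qed
    then show ?thesis unfolding M_def src tgt \<Phi>1_def .
  qed
  have functorial: "is_functor ?G ?G' S M"
    unfolding is_functor_def germ_groupoid_simps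
  proof (intro conjI ballI)
    show "is_category ?G" "is_category ?G'" using N N' by (simp_all add: germ_groupoid_category)
  next
    fix a assume "a \<in> points N" then show "S a \<in> points N'" by (rule S)
  next
    fix a b f assume "f \<in> hom_set ?G a b"
    then obtain \<Phi> \<Psi> where *: "local_diffeo_over N e N e \<Phi> \<Psi>" "\<Phi> a = Some b" "f = germ N \<Phi> a"
      unfolding hom_germ_groupoid by blast
    show "M f \<in> hom_set ?G' (S a) (S b)"
      unfolding hom_germ_groupoid *(3) M[OF *(1,2)] using conj_over[OF *(1,2)] by blast
  next
    fix a assume a: "a \<in> points N"
    have "M (germ N (Some |` points N) a) = germ N' (conj a a (Some |` points N)) (S a)"
      by (rule M[OF local_diffeo_over_id[OF N]]) (simp add: a)
    also have "\<dots> = germ N' (Some |` points N') (S a)"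
    proof (rule germ_eqI)
      note \<Theta>a' = local_diffeo_over_sym[OF \<Theta>(1)[OF a]]
      show "openin (D_topology N') (dom (\<Theta>' a))" by (rule local_diffeo_over_open[OF \<Theta>a'])
      show "S a \<in> dom (\<Theta>' a)" using S(2)[OF a] by blast
      fix x assume "x \<in> dom (\<Theta>' a)"
      then obtain y where y: "\<Theta>' a x = Some y" by blast
      have "\<Theta> a y = Some x" using y local_diffeo_over_inverse[OF \<Theta>(1)[OF a]] by simp
      then show "conj a a (Some |` points N) x = (Some |` points N') x"
        using y local_diffeo_over_points[OF \<Theta>a' y] by (simp add: conj_def map_comp_def)
    qed
    finally show "M (germ N (Some |` points N) a) = germ N' (Some |` points N') (S a)" .
  next
    fix a b c f g assume ab: "a \<in> points N" "b \<in> points N"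
      and "f \<in> hom_set ?G a b" "g \<in> hom_set ?G b c"
    then obtain \<Phi> \<Phi>' \<Psi> \<Psi>' where *: "local_diffeo_over N e N e \<Phi> \<Phi>'" "\<Phi> a = Some b" "f = germ N \<Phi> a"
      "local_diffeo_over N e N e \<Psi> \<Psi>'" "\<Psi> b = Some c" "g = germ N \<Psi> b"
      unfolding hom_germ_groupoid by blast
    obtain \<Phi>2 \<Psi>2 where over: "local_diffeo_over N' e' N' e' (conj a b \<Phi>) \<Phi>2"
      "local_diffeo_over N' e' N' e' (conj b c \<Psi>) \<Psi>2"
      using conj_over(1)[OF *(1,2)] conj_over(1)[OF *(4,5)] by blast
    have "M (germ_compose N g f) = M (germ N (\<Psi> \<circ>\<^sub>m \<Phi>) a)"
      unfolding *(3,6) germ_compose_over[OF N *(1,4,2,5)] ..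
    also have "\<dots> = germ N' (conj a c (\<Psi> \<circ>\<^sub>m \<Phi>)) (S a)"
      by (rule M[OF local_diffeo_over_comp[OF N N N *(1,4)]]) (use *(2,5) in \<open>simp add: map_comp_eq_Some\<close>)
    also have "\<dots> = germ N' (conj b c \<Psi> \<circ>\<^sub>m conj a b \<Phi>) (S a)"
    proof (rule germ_eqI)
      show "openin (D_topology N') (dom (conj a b \<Phi>))" by (rule local_diffeo_over_open[OF over(1)])
      show "S a \<in> dom (conj a b \<Phi>)" using conj_over(2)[OF *(1,2)] by blast
      fix x assume "x \<in> dom (conj a b \<Phi>)"
      then obtain y u w where "\<Theta>' a x = Some y" "\<Phi> y = Some u" "\<Theta> b u = Some w"
        unfolding conj_def by (auto simp: map_comp_eq_Some)
      moreover from this have "\<Theta>' b w = Some u" using local_diffeo_over_inverse[OF \<Theta>(1)[OF ab(2)]] by simp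
      ultimately show "conj a c (\<Psi> \<circ>\<^sub>m \<Phi>) x = (conj b c \<Psi> \<circ>\<^sub>m conj a b \<Phi>) x"
        by (simp add: conj_def map_comp_def)
    qed
    also have "\<dots> = germ_compose N' (M g) (M f)"
      unfolding *(3,6) M[OF *(1,2)] M[OF *(4,5)]
      by (rule germ_compose_over[OF N' over conj_over(2)[OF *(1,2)] conj_over(2)[OF *(4,5)], symmetric])
    finally show "M (germ_compose N g f) = germ_compose N' (M g) (M f)" .
  qed
  have full: "\<exists>f\<in>hom_set ?G a b. M f = g"
    if ab: "a \<in> points N" "b \<in> points N" and g: "g \<in> hom_set ?G' (S a) (S b)" for a b g
  proof -
    obtain \<Psi> \<Psi>' where *: "local_diffeo_over N' e' N' e' \<Psi> \<Psi>'" "\<Psi> (S a) = Some (S b)" "g = germ N' \<Psi> (S a)"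
      using g unfolding hom_germ_groupoid by blast
    define \<Phi> where "\<Phi> = \<Theta>' b \<circ>\<^sub>m (\<Psi> \<circ>\<^sub>m \<Theta> a)"
    obtain \<Phi>' where \<Phi>: "local_diffeo_over N e N e \<Phi> \<Phi>'"
      using local_diffeo_over_comp[OF N N' N local_diffeo_over_comp[OF N N' N' \<Theta>(1)[OF ab(1)] *(1)]
          local_diffeo_over_sym[OF \<Theta>(1)[OF ab(2)]]] unfolding \<Phi>_def by blast
    have \<Phi>ab: "\<Phi> a = Some b"
      unfolding \<Phi>_def map_comp_eq_Some using \<Theta>(2)[OF ab(1)] *(2) S(2)[OF ab(2)] by blast
    have "germ N' (conj a b \<Phi>) (S a) = germ N' \<Psi> (S a)"
    proof (rule germ_eqI)
      let ?V = "dom (\<Theta>' a) \<inter> \<Psi> -` Some ` dom (\<Theta>' b)"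
      show "openin (D_topology N') ?V"
        by (intro openin_Int local_diffeo_over_preimage[OF N' N' *(1)]
            local_diffeo_over_open[OF local_diffeo_over_sym[OF \<Theta>(1)]] ab)
      show "S a \<in> ?V" using S(2)[OF ab(1)] S(2)[OF ab(2)] *(2) by auto
      fix x assume "x \<in> ?V"
      then obtain y u w where "\<Theta>' a x = Some y" "\<Psi> x = Some u" "\<Theta>' b u = Some w" by auto
      moreover from this have "\<Theta> a y = Some x" "\<Theta> b w = Some u"
        using local_diffeo_over_inverse[OF \<Theta>(1)] ab by auto
      ultimately show "conj a b \<Phi> x = \<Psi> x" by (simp add: conj_def \<Phi>_def map_comp_def)
    qed
    then have "M (germ N \<Phi> a) = g" using M[OF \<Phi> \<Phi>ab] *(3) by simp
    then show ?thesis using \<Phi> \<Phi>ab unfolding hom_germ_groupoid[abs_def] Bex_def by blast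
  qed
  have faithful: "inj_on M (hom_set ?G a b)" if ab: "a \<in> points N" "b \<in> points N" for a b
  proof (rule inj_onI)
    fix f g assume "f \<in> hom_set ?G a b" "g \<in> hom_set ?G a b" and eq: "M f = M g"
    then obtain \<Phi> \<Phi>' \<Psi> \<Psi>' where *: "local_diffeo_over N e N e \<Phi> \<Phi>'" "\<Phi> a = Some b" "f = germ N \<Phi> a"
      "local_diffeo_over N e N e \<Psi> \<Psi>'" "\<Psi> a = Some b" "g = germ N \<Psi> a"
      unfolding hom_germ_groupoid by blast
    obtain \<Psi>2 where over: "local_diffeo_over N' e' N' e' (conj a b \<Psi>) \<Psi>2"
      using conj_over(1)[OF *(4,5)] by blast
    have "germ N' (conj a b \<Phi>) (S a) = germ N' (conj a b \<Psi>) (S a)"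
      using eq unfolding *(3,6) M[OF *(1,2)] M[OF *(4,5)] .
    then obtain V where V: "openin (D_topology N') V" "S a \<in> V"
      "\<forall>x\<in>V. \<exists>y. conj a b \<Phi> x = Some y \<and> conj a b \<Psi> x = Some y"
      using germ_eqD[OF local_diffeo_over_open[OF over] conj_over(2)[OF *(4,5)]] by blast
    show "f = g"
      unfolding *(3,6)
    proof (rule germ_eqI)
      show "openin (D_topology N) (\<Theta> a -` Some ` V)"
        by (rule local_diffeo_over_preimage[OF N N' \<Theta>(1)[OF ab(1)] V(1)])
      show "a \<in> \<Theta> a -` Some ` V" using \<Theta>(2)[OF ab(1)] V(2) by simp
      fix x assume "x \<in> \<Theta> a -` Some ` V"
      then obtain y where y: "\<Theta> a x = Some y" "y \<in> V" by auto
      then have "\<Theta>' a y = Some x" using local_diffeo_over_inverse[OF \<Theta>(1)[OF ab(1)]] by simp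
      then obtain u1 u2 w where u: "\<Phi> x = Some u1" "\<Theta> b u1 = Some w" "\<Psi> x = Some u2" "\<Theta> b u2 = Some w"
        using V(3)[rule_format, OF y(2)] by (auto simp: conj_def map_comp_eq_Some)
      then have "\<Theta>' b w = Some u1" "\<Theta>' b w = Some u2"
        using local_diffeo_over_inverse[OF \<Theta>(1)[OF ab(2)]] by auto
      then show "\<Phi> x = \<Psi> x" using u by simp
    qed
  qed
  have dense: "\<exists>a\<in>points N. isomorphic_objects ?G' (S a) c" if c: "c \<in> points N'" for c
  proof -
    have "e' c \<in> e ` points N" using image c by blast
    then obtain a where a: "a \<in> points N" "e a = e' c" by auto
    obtain f f' where f: "local_diffeo_over N e N' e' f f'" "f a = Some c" using link[OF a(1) c a(2)] by blast
    define \<Psi> where "\<Psi> = f \<circ>\<^sub>m \<Theta>' a"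
    define \<Psi>' where "\<Psi>' = \<Theta> a \<circ>\<^sub>m f'"
    have \<Psi>: "local_diffeo_over N' e' N' e' \<Psi> \<Psi>'"
      unfolding \<Psi>_def \<Psi>'_def
      by (rule local_diffeo_over_comp[OF N' N N' local_diffeo_over_sym[OF \<Theta>(1)[OF a(1)]] f(1)])
    note \<Psi>' = local_diffeo_over_sym[OF \<Psi>]
    have v: "\<Psi> (S a) = Some c" unfolding \<Psi>_def map_comp_eq_Some using S(2)[OF a(1)] f(2) by blast
    then have v': "\<Psi>' c = Some (S a)" using local_diffeo_over_inverse[OF \<Psi>] by simp
    have inv: "germ_compose N' (germ N' h y) (germ N' k x) = germ N' (Some |` points N') x"
      if hk: "local_diffeo_over N' e' N' e' k h" "k x = Some y" for h k x y
    proof -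
      have hy: "h y = Some x" using local_diffeo_over_inverse[OF hk(1)] hk(2) by simp
      have "germ N' (h \<circ>\<^sub>m k) x = germ N' (Some |` points N') x"
      proof (rule germ_eqI[OF local_diffeo_over_open[OF hk(1)]])
        show "x \<in> dom k" using hk(2) by blast
        fix t assume "t \<in> dom k"
        then obtain s where s: "k t = Some s" by blast
        moreover have "h s = Some t" using local_diffeo_over_inverse[OF hk(1)] s by simp
        ultimately show "(h \<circ>\<^sub>m k) t = (Some |` points N') t"
          using local_diffeo_over_points[OF hk(1) s] by (simp add: map_comp_def)
      qed
      then show ?thesis
        using germ_compose_over[OF N' hk(1) local_diffeo_over_sym[OF hk(1)] hk(2) hy] by simp
    qed
    have "germ N' \<Psi> (S a) \<in> hom_set ?G' (S a) c" "germ N' \<Psi>' c \<in> hom_set ?G' c (S a)"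
      unfolding hom_germ_groupoid using \<Psi> \<Psi>' v v' by blast+
    then show ?thesis
      using inv[OF \<Psi> v] inv[OF \<Psi>' v'] a(1)
      unfolding isomorphic_objects_def germ_groupoid_simps by blast
  qed
  have "is_equivalence ?G ?G' S M"
    unfolding is_equivalence_def germ_groupoid_simps using functorial full faithful dense by blast
  then show ?thesis unfolding equivalent_categories_def by blast
qed

section \<open>Nebulas\<close>

lemma points_nebula: "points (nebula n \<F>) = Sigma \<F> (\<lambda>F. Rn n \<inter> dom F)"
  by (simp add: nebula_def sum_diff_def subset_diff_def euclidean_diff_def)

lemma plots_nebula:
  "(m, p) \<in> plots (nebula n \<F>) \<longleftrightarrow>
     openin (Euclidean_space m) (dom p) \<and> ran p \<subseteq> points (nebula n \<F>) \<and>
     (\<forall>s\<in>dom p. \<exists>F\<in>\<F>. \<exists>q. (m, q) \<in> smooth_parametrizations n \<and> ran q \<subseteq> dom F \<and>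
        s \<in> dom q \<and> dom q \<subseteq> dom p \<and> (\<forall>t\<in>dom q. p t = Some (F, the (q t))))"
  unfolding points_nebula
  by (simp add: nebula_def sum_diff_def subset_diff_def euclidean_diff_def parametrizations_def conj_assoc)

lemma constant_smooth_parametrization:
  assumes "openin (Euclidean_space m) U" "x \<in> Rn n"
  shows "(m, (\<lambda>_. Some x) |` U) \<in> smooth_parametrizations n"
proof -
  have d: "dom ((\<lambda>_. Some x) |` U) = U" by auto
  have "Ck k m U (\<lambda>r. the (((\<lambda>_. Some x) |` U) r) i)" for k i
    by (rule Ck_cong[OF assms(1) Ck_const[of k m U "x i"]]) simp
  moreover have "ran ((\<lambda>_. Some x) |` U) \<subseteq> Rn n"
    using assms(2) by (auto simp: ran_def restrict_map_def split: if_splits)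
  ultimately show ?thesis using assms(1) unfolding smooth_parametrization_iff d by blast
qed

text \<open>
  Plots of the nebula are given locally in one sheet by smooth parametrizations, so stability under
  smooth reparametrization is the composition of smooth parametrizations.
\<close>
lemma diffeology_nebula: "diffeology (nebula n \<F>)"
  unfolding diffeology_def
proof (intro conjI allI impI)
  show "plots (nebula n \<F>) \<subseteq> parametrizations (points (nebula n \<F>))"
    unfolding parametrizations_def by (auto simp: plots_nebula)
next
  fix m U x assume U: "openin (Euclidean_space m) U" and x: "x \<in> points (nebula n \<F>)"
  obtain F r where Fr: "x = (F, r)" "F \<in> \<F>" "r \<in> Rn n" "r \<in> dom F" using x by (auto simp: points_nebula)
  have q: "(m, (\<lambda>_. Some r) |` U) \<in> smooth_parametrizations n"
    by (rule constant_smooth_parametrization[OF U Fr(3)])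
  have d: "dom ((\<lambda>_. Some r) |` U) = U" "dom ((\<lambda>_. Some x) |` U) = U" by auto
  have "ran ((\<lambda>_. Some r) |` U) \<subseteq> dom F" "ran ((\<lambda>_. Some x) |` U) \<subseteq> points (nebula n \<F>)"
    using x Fr(4) by (auto simp: ran_def restrict_map_def split: if_splits)
  then show "(m, (\<lambda>_. Some x) |` U) \<in> plots (nebula n \<F>)"
    unfolding plots_nebula d using U q Fr(1,2) d
    by (intro conjI ballI bexI[of _ F] exI[of _ "(\<lambda>_. Some r) |` U"]) auto
next
  have "(m, p) \<in> plots (nebula n \<F>)"
    if mp: "(m, p) \<in> parametrizations (points (nebula n \<F>))"
      and loc: "\<forall>r\<in>dom p. \<exists>V. openin (Euclidean_space m) V \<and> r \<in> V \<and> (m, p |` V) \<in> plots (nebula n \<F>)"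
    for m p
    unfolding plots_nebula
  proof (intro conjI ballI)
    show "openin (Euclidean_space m) (dom p)" "ran p \<subseteq> points (nebula n \<F>)"
      using mp by (auto simp: parametrizations_def)
    fix s assume s: "s \<in> dom p"
    then obtain V where V: "s \<in> V" "(m, p |` V) \<in> plots (nebula n \<F>)" using loc by blast
    then have "s \<in> dom (p |` V)" using s by simp
    then obtain F q where F: "F \<in> \<F>" and q: "(m, q) \<in> smooth_parametrizations n" "ran q \<subseteq> dom F"
        "s \<in> dom q" "dom q \<subseteq> dom (p |` V)" "\<forall>t\<in>dom q. (p |` V) t = Some (F, the (q t))"
      using V(2) unfolding plots_nebula by blast
    have "dom q \<subseteq> dom p" "\<forall>t\<in>dom q. p t = Some (F, the (q t))"
      using q(4,5) by (auto simp: restrict_map_def split: if_splits)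
    then show "\<exists>F\<in>\<F>. \<exists>q. (m, q) \<in> smooth_parametrizations n \<and> ran q \<subseteq> dom F \<and>
        s \<in> dom q \<and> dom q \<subseteq> dom p \<and> (\<forall>t\<in>dom q. p t = Some (F, the (q t)))"
      using F q(1-3) by blast
  qed
  then show "\<forall>(m, p)\<in>parametrizations (points (nebula n \<F>)).
      (\<forall>r\<in>dom p. \<exists>V. openin (Euclidean_space m) V \<and> r \<in> V \<and> (m, p |` V) \<in> plots (nebula n \<F>)) \<longrightarrow>
      (m, p) \<in> plots (nebula n \<F>)" by blast
next
  fix m p k r
  assume p: "(m, p) \<in> plots (nebula n \<F>)" and r: "(k, r) \<in> smooth_parametrizations m" and sub: "ran r \<subseteq> dom p"
  have dom: "dom (p \<circ>\<^sub>m r) = dom r" using sub by (force simp: map_comp_def ran_def split: option.splits)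
  show "(k, p \<circ>\<^sub>m r) \<in> plots (nebula n \<F>)"
    unfolding plots_nebula dom
  proof (intro conjI ballI)
    show "openin (Euclidean_space k) (dom r)" using r by (simp add: smooth_parametrization_iff)
    show "ran (p \<circ>\<^sub>m r) \<subseteq> points (nebula n \<F>)" using p ran_map_comp[of p r] unfolding plots_nebula by blast
    fix s assume "s \<in> dom r"
    then obtain y where y: "r s = Some y" by blast
    then have "y \<in> dom p" by (intro subsetD[OF sub] ranI)
    then obtain F q where F: "F \<in> \<F>" and q: "(m, q) \<in> smooth_parametrizations n" "ran q \<subseteq> dom F"
        "y \<in> dom q" "\<forall>t\<in>dom q. p t = Some (F, the (q t))"
      using p \<open>y \<in> dom p\<close> unfolding plots_nebula by blast
    show "\<exists>F\<in>\<F>. \<exists>q. (k, q) \<in> smooth_parametrizations n \<and> ran q \<subseteq> dom F \<and>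
        s \<in> dom q \<and> dom q \<subseteq> dom r \<and> (\<forall>t\<in>dom q. (p \<circ>\<^sub>m r) t = Some (F, the (q t)))"
    proof (intro bexI[OF _ F] exI[of _ "q \<circ>\<^sub>m r"] conjI ballI)
      show "(k, q \<circ>\<^sub>m r) \<in> smooth_parametrizations n" by (rule smooth_parametrization_compose[OF q(1) r])
      show "ran (q \<circ>\<^sub>m r) \<subseteq> dom F" using q(2) ran_map_comp[of q r] by blast
      show "s \<in> dom (q \<circ>\<^sub>m r)" using y q(3) by (simp add: dom_map_comp)
      show "dom (q \<circ>\<^sub>m r) \<subseteq> dom r" by (auto simp: dom_map_comp)
      fix t assume "t \<in> dom (q \<circ>\<^sub>m r)"
      then obtain u where "r t = Some u" "u \<in> dom q" by (auto simp: dom_map_comp)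
      then show "(p \<circ>\<^sub>m r) t = Some (F, the ((q \<circ>\<^sub>m r) t))" using q(4) by simp
    qed
  qed
qed

lemma openin_nebula_slice:
  assumes F: "F \<in> \<F>" and U: "openin (Euclidean_space n) U" "U \<subseteq> dom F"
  shows "openin (D_topology (nebula n \<F>)) ({F} \<times> U)"
  unfolding openin_D_topology
proof (intro conjI ballI, use F U openin_subset[OF U(1)] in \<open>auto simp: points_nebula\<close>)
  fix m p assume p: "(m, p) \<in> plots (nebula n \<F>)"
  show "openin (Euclidean_space m) (p -` Some ` ({F} \<times> U))"
  proof (subst openin_subopen, intro ballI)
    fix s assume "s \<in> p -` Some ` ({F} \<times> U)"
    then obtain u where u: "p s = Some (F, u)" "u \<in> U" by auto
    then obtain F' q where q: "(m, q) \<in> smooth_parametrizations n" "s \<in> dom q"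
        "\<forall>t\<in>dom q. p t = Some (F', the (q t))"
      using p unfolding plots_nebula by blast
    have FF: "F' = F" "q s = Some u" using q(2,3) u(1) by auto
    show "\<exists>T. openin (Euclidean_space m) T \<and> s \<in> T \<and> T \<subseteq> p -` Some ` ({F} \<times> U)"
    proof (intro exI[of _ "q -` Some ` U"] conjI)
      show "openin (Euclidean_space m) (q -` Some ` U)" by (rule smooth_parametrization_preimage[OF q(1) U(1)])
      show "s \<in> q -` Some ` U" using FF u(2) by simp
      show "q -` Some ` U \<subseteq> p -` Some ` ({F} \<times> U)" using q(3) FF(1) by force
    qed
  qed
qed

definition slice_map :: "'f \<Rightarrow> 'g \<Rightarrow> ('r \<rightharpoonup> 's) \<Rightarrow> ('f \<times> 'r \<rightharpoonup> 'g \<times> 's)" where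
  "slice_map F F' q = (\<lambda>(G, x). if G = F then map_option (Pair F') (q x) else None)"

lemma slice_map_eq_Some: "slice_map F F' q (G, x) = Some (G', y) \<longleftrightarrow> G = F \<and> G' = F' \<and> q x = Some y"
  by (auto simp: slice_map_def)

lemma dom_slice_map: "dom (slice_map F F' q) = {F} \<times> dom q"
  by (auto simp: slice_map_def split: if_splits)

lemma local_smooth_slice_map:
  assumes F: "F \<in> \<F>" and F': "F' \<in> \<F>'" and q: "(n, q) \<in> smooth_parametrizations n'"
    and dom: "dom q \<subseteq> dom F" and ran: "ran q \<subseteq> dom F'"
  shows "local_smooth (nebula n \<F>) (nebula n' \<F>') (slice_map F F' q)"
  unfolding local_smooth_def
proof (intro conjI allI impI)
  have qo: "openin (Euclidean_space n) (dom q)" and qR: "ran q \<subseteq> Rn n'" using q by (auto simp: smooth_parametrization_iff)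
  show "openin (D_topology (nebula n \<F>)) (dom (slice_map F F' q))"
    unfolding dom_slice_map by (rule openin_nebula_slice[OF F qo dom])
  show rs: "ran (slice_map F F' q) \<subseteq> points (nebula n' \<F>')"
  proof
    fix z assume "z \<in> ran (slice_map F F' q)"
    then obtain G x where "slice_map F F' q (G, x) = Some (fst z, snd z)" by (auto simp: ran_def)
    then obtain y where "z = (F', y)" "y \<in> ran q"
      unfolding slice_map_eq_Some by (metis prod.collapse ranI)
    then show "z \<in> points (nebula n' \<F>')" using F' qR ran by (auto simp: points_nebula)
  qed
  fix m p assume p: "(m, p) \<in> plots (nebula n \<F>)" and sub: "ran p \<subseteq> dom (slice_map F F' q)"
  have d: "dom (slice_map F F' q \<circ>\<^sub>m p) = dom p" using sub by (force simp: dom_map_comp ran_def)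
  show "(m, slice_map F F' q \<circ>\<^sub>m p) \<in> plots (nebula n' \<F>')"
    unfolding plots_nebula d
  proof (intro conjI ballI)
    show "openin (Euclidean_space m) (dom p)" using p by (simp add: plots_nebula)
    show "ran (slice_map F F' q \<circ>\<^sub>m p) \<subseteq> points (nebula n' \<F>')"
      using rs ran_map_comp[of "slice_map F F' q" p] by blast
    fix s assume "s \<in> dom p"
    then obtain G r where r: "(m, r) \<in> smooth_parametrizations n" "s \<in> dom r" "dom r \<subseteq> dom p"
        "\<forall>t\<in>dom r. p t = Some (G, the (r t))"
      using p unfolding plots_nebula by blast
    have val: "G = F \<and> the (r t) \<in> dom q" if "t \<in> dom r" for t
    proof -
      have "(G, the (r t)) \<in> ran p" using r(4) that by (auto simp: ran_def)
      then show ?thesis using sub unfolding dom_slice_map by blast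
    qed
    have dqr: "dom (q \<circ>\<^sub>m r) = dom r" using val by (force simp: dom_map_comp)
    show "\<exists>H\<in>\<F>'. \<exists>q'. (m, q') \<in> smooth_parametrizations n' \<and> ran q' \<subseteq> dom H \<and> s \<in> dom q' \<and>
        dom q' \<subseteq> dom p \<and> (\<forall>t\<in>dom q'. (slice_map F F' q \<circ>\<^sub>m p) t = Some (H, the (q' t)))"
    proof (intro bexI[OF _ F'] exI[of _ "q \<circ>\<^sub>m r"] conjI ballI, unfold dqr)
      show "(m, q \<circ>\<^sub>m r) \<in> smooth_parametrizations n'" by (rule smooth_parametrization_compose[OF q r(1)])
      show "ran (q \<circ>\<^sub>m r) \<subseteq> dom F'" using ran ran_map_comp[of q r] by blast
      show "s \<in> dom r" "dom r \<subseteq> dom p" by (fact r)+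
      fix t assume t: "t \<in> dom r"
      then obtain u w where "r t = Some u" "q u = Some w" using val[OF t] by auto
      then show "(slice_map F F' q \<circ>\<^sub>m p) t = Some (F', the ((q \<circ>\<^sub>m r) t))"
        using r(4) t val[OF t] by (auto simp: slice_map_def)
    qed
  qed
qed

lemma local_diffeo_pair_slice_map:
  assumes F: "F \<in> \<F>" and F': "F' \<in> \<F>'"
    and q: "(n, q) \<in> smooth_parametrizations n'" "(n', q') \<in> smooth_parametrizations n"
    and dom: "dom q \<subseteq> dom F" "dom q' \<subseteq> dom F'"
    and inv: "\<And>x y. q x = Some y \<longleftrightarrow> q' y = Some x"
  shows "local_diffeo_pair (nebula n \<F>) (nebula n' \<F>') (slice_map F F' q) (slice_map F' F q')"
  unfolding local_diffeo_pair_def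
proof (intro conjI allI)
  have "ran q = dom q'" "ran q' = dom q" using inv by (auto simp: ran_def dom_def)
  then show "local_smooth (nebula n \<F>) (nebula n' \<F>') (slice_map F F' q)"
    "local_smooth (nebula n' \<F>') (nebula n \<F>) (slice_map F' F q')"
    using assms by (simp_all add: local_smooth_slice_map)
  fix x y
  show "(slice_map F F' q x = Some y) = (slice_map F' F q' y = Some x)"
    using inv by (cases x; cases y) (auto simp: slice_map_eq_Some)
qed

section \<open>Lifting plots through charts\<close>

definition chart_lift :: "nat \<Rightarrow> 'a chart \<Rightarrow> ((nat \<Rightarrow> real) \<rightharpoonup> 'a)" where
  "chart_lift n = (\<lambda>(\<Gamma>, f). (\<lambda>r. f (orbit_rel n \<Gamma> `` {r})) |` Rn n)"

lemma strict_family_eq: "strict_family n \<A> = chart_lift n ` \<A>"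
  by (simp add: strict_family_def chart_lift_def)

lemma orbit_eq:
  assumes \<Gamma>: "subgroup \<Gamma> (Aff n)" and x: "x \<in> Rn n" and "y \<in> Rn n"
  shows "orbit_rel n \<Gamma> `` {x} = orbit_rel n \<Gamma> `` {y} \<longleftrightarrow> (\<exists>\<gamma>\<in>\<Gamma>. y = \<gamma> x)"
proof -
  have orb: "orbit_rel n \<Gamma> `` {z} = (\<lambda>\<gamma>. \<gamma> z) ` \<Gamma>" if "z \<in> Rn n" for z
    using that by (auto simp: orbit_rel_def)
  show ?thesis
  proof
    assume eq: "orbit_rel n \<Gamma> `` {x} = orbit_rel n \<Gamma> `` {y}"
    obtain \<iota> where "\<iota> \<in> \<Gamma>" "\<iota> y = y" using affine_group_id[OF \<Gamma>] \<open>y \<in> Rn n\<close> by blast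
    then have "y \<in> orbit_rel n \<Gamma> `` {y}" unfolding orb[OF \<open>y \<in> Rn n\<close>] by (intro image_eqI[of _ _ \<iota>]) simp_all
    then have "y \<in> orbit_rel n \<Gamma> `` {x}" using eq by simp
    then show "\<exists>\<gamma>\<in>\<Gamma>. y = \<gamma> x" unfolding orb[OF x] by blast
  next
    assume "\<exists>\<gamma>\<in>\<Gamma>. y = \<gamma> x"
    then obtain \<gamma> where \<gamma>: "\<gamma> \<in> \<Gamma>" "y = \<gamma> x" by blast
    obtain \<delta> where \<delta>: "\<delta> \<in> \<Gamma>" "\<delta> (\<gamma> x) = x" using affine_group_inv[OF \<Gamma> \<gamma>(1)] x by blast
    have sub: "(\<lambda>\<epsilon>. \<epsilon> (\<beta> z)) ` \<Gamma> \<subseteq> (\<lambda>\<epsilon>. \<epsilon> z) ` \<Gamma>" if "\<beta> \<in> \<Gamma>" "z \<in> Rn n" for \<beta> z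
    proof
      fix w assume "w \<in> (\<lambda>\<epsilon>. \<epsilon> (\<beta> z)) ` \<Gamma>"
      then obtain \<epsilon> where \<epsilon>: "\<epsilon> \<in> \<Gamma>" "w = \<epsilon> (\<beta> z)" by blast
      obtain \<epsilon>' where "\<epsilon>' \<in> \<Gamma>" "\<epsilon>' z = \<epsilon> (\<beta> z)"
        using affine_group_comp[OF \<Gamma> \<epsilon>(1) \<open>\<beta> \<in> \<Gamma>\<close>] \<open>z \<in> Rn n\<close> by blast
      then show "w \<in> (\<lambda>\<epsilon>. \<epsilon> z) ` \<Gamma>" using \<epsilon>(2) by (intro image_eqI[of _ _ \<epsilon>']) simp_all
    qed
    show "orbit_rel n \<Gamma> `` {x} = orbit_rel n \<Gamma> `` {y}"
      unfolding orb[OF x] orb[OF \<open>y \<in> Rn n\<close>]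
      using sub[OF \<gamma>(1) x] sub[OF \<delta>(1) \<open>y \<in> Rn n\<close>] \<gamma>(2) \<delta>(2) by auto
  qed
qed

text \<open>
  The projection to the orbit space is a plot because the inclusion of \<open>U\<close> lifts it.
\<close>
lemma orbit_plot:
  assumes "openin (Euclidean_space n) U"
  shows "(n, (\<lambda>r. Some (orbit_rel n \<Gamma> `` {r})) |` U) \<in> plots (quotient_diff (euclidean_diff n) (orbit_rel n \<Gamma>))"
proof -
  have U: "U \<subseteq> Rn n" using assms openin_subset by blast
  have d: "dom ((\<lambda>r. Some (orbit_rel n \<Gamma> `` {r})) |` U) = U" "dom (Some |` U) = U" by auto
  have "ran ((\<lambda>r. Some (orbit_rel n \<Gamma> `` {r})) |` U) \<subseteq> Rn n // orbit_rel n \<Gamma>"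
    using U by (auto simp: ran_def restrict_map_def intro!: quotientI split: if_splits)
  then have "(n, (\<lambda>r. Some (orbit_rel n \<Gamma> `` {r})) |` U) \<in> parametrizations (Rn n // orbit_rel n \<Gamma>)"
    using assms d by (simp add: parametrizations_def)
  moreover have "\<exists>q. (n, q) \<in> smooth_parametrizations n \<and> s \<in> dom q \<and> dom q \<subseteq> U \<and>
      (\<forall>t\<in>dom q. ((\<lambda>r. Some (orbit_rel n \<Gamma> `` {r})) |` U) t = Some (orbit_rel n \<Gamma> `` {the (q t)}))" if "s \<in> U" for s
    using inclusion_smooth[OF assms] that d by (intro exI[of _ "Some |` U"]) auto
  ultimately show ?thesis
    unfolding quotient_diff_def euclidean_diff_def by (simp add: d)
qed

lemma chart_lift_eq_Some:
  "chart_lift n (\<Gamma>, f) r = Some z \<longleftrightarrow> r \<in> Rn n \<and> f (orbit_rel n \<Gamma> `` {r}) = Some z"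
  by (auto simp: chart_lift_def restrict_map_def)

lemma chart_lift_plot:
  assumes c: "(\<Gamma>, f) \<in> charts n X"
  shows "(n, chart_lift n (\<Gamma>, f)) \<in> plots X" "openin (Euclidean_space n) (dom (chart_lift n (\<Gamma>, f)))"
proof -
  let ?Q = "quotient_diff (euclidean_diff n) (orbit_rel n \<Gamma>)" and ?F = "chart_lift n (\<Gamma>, f)"
  let ?P = "\<lambda>r. Some (orbit_rel n \<Gamma> `` {r})"
  obtain f' where f: "local_diffeo_pair ?Q X f f'"
    using c unfolding charts_def local_diffeo_iff_pair by blast
  have "openin (D_topology ?Q) (dom f)" using f by (simp add: local_diffeo_pair_def local_smooth_def)
  moreover have "openin (Euclidean_space n) (Rn n)" by simp
  ultimately have "openin (Euclidean_space n) ((?P |` Rn n) -` Some ` dom f)"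
    using orbit_plot unfolding openin_D_topology by blast
  moreover have "(?P |` Rn n) -` Some ` dom f = dom ?F"
    by (auto simp: chart_lift_def restrict_map_def image_iff split: if_splits)
  ultimately show d: "openin (Euclidean_space n) (dom ?F)" by simp
  have "ran (?P |` dom ?F) \<subseteq> dom f"
    by (auto simp: ran_def chart_lift_eq_Some restrict_map_def split: if_splits)
  then have "(n, f \<circ>\<^sub>m (?P |` dom ?F)) \<in> plots X"
    using orbit_plot[OF d, of \<Gamma>] f by (simp add: local_diffeo_pair_def local_smooth_def)
  moreover have "f \<circ>\<^sub>m (?P |` dom ?F) = ?F"
    by (rule ext) (auto simp: chart_lift_def restrict_map_def map_comp_def split: if_splits)
  ultimately show "(n, ?F) \<in> plots X" by simp
qed

text \<open>
  Charts are injective on orbits, so the fibres of the lifted chart are the orbits.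
\<close>
lemma chart_lift_fibre:
  assumes c: "(\<Gamma>, f) \<in> charts n X" and F: "chart_lift n (\<Gamma>, f) x = Some z"
  shows "chart_lift n (\<Gamma>, f) y = Some z \<longleftrightarrow> (\<exists>\<gamma>\<in>\<Gamma>. y = \<gamma> x)"
proof -
  have \<Gamma>: "subgroup \<Gamma> (Aff n)" using c by (simp add: charts_def)
  obtain f' where f: "local_diffeo_pair (quotient_diff (euclidean_diff n) (orbit_rel n \<Gamma>)) X f f'"
    using c unfolding charts_def local_diffeo_iff_pair by blast
  then have inj: "f a = Some w \<Longrightarrow> f b = Some w \<Longrightarrow> a = b" for a b w
    by (metis local_diffeo_pair_def option.inject)
  have x: "x \<in> Rn n" "f (orbit_rel n \<Gamma> `` {x}) = Some z" using F by (auto simp: chart_lift_eq_Some)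
  show ?thesis
  proof
    assume "chart_lift n (\<Gamma>, f) y = Some z"
    then have y: "y \<in> Rn n" "f (orbit_rel n \<Gamma> `` {y}) = Some z" by (auto simp: chart_lift_eq_Some)
    show "\<exists>\<gamma>\<in>\<Gamma>. y = \<gamma> x" using inj[OF x(2) y(2)] orbit_eq[OF \<Gamma> x(1) y(1)] by blast
  next
    assume *: "\<exists>\<gamma>\<in>\<Gamma>. y = \<gamma> x"
    then have y: "y \<in> Rn n" using affine_group_maps[OF \<Gamma>] x(1) by blast
    show "chart_lift n (\<Gamma>, f) y = Some z" using orbit_eq[OF \<Gamma> x(1) y] * x y by (simp add: chart_lift_eq_Some)
  qed
qed

text \<open>
  A plot that meets the image of a chart becomes, through the inverse of the chart, a plot of the orbit
  space, and these lift locally by definition of the quotient diffeology.  The lift through \<open>s\<close>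
  ends in the orbit of \<open>r\<close>; an element of \<open>\<Gamma>\<close> moves it to \<open>r\<close> without affecting the projection.
\<close>
lemma lift_plot_through_chart:
  assumes X: "diffeology X" and c: "(\<Gamma>, f) \<in> charts n X" and P: "(m, P) \<in> plots X"
    and s: "P s = Some z" "chart_lift n (\<Gamma>, f) r = Some z"
  obtains q where "(m, q) \<in> smooth_parametrizations n" "q s = Some r" "dom q \<subseteq> dom P"
    "\<And>t u. q t = Some u \<Longrightarrow> chart_lift n (\<Gamma>, f) u = P t" "ran q \<subseteq> dom (chart_lift n (\<Gamma>, f))"
proof -
  let ?Q = "quotient_diff (euclidean_diff n) (orbit_rel n \<Gamma>)" and ?F = "chart_lift n (\<Gamma>, f)"
  have \<Gamma>: "subgroup \<Gamma> (Aff n)" using c by (simp add: charts_def)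
  obtain f' where f: "local_diffeo_pair ?Q X f f'"
    using c unfolding charts_def local_diffeo_iff_pair by blast
  then have ff': "f a = Some w \<longleftrightarrow> f' w = Some a" for a w by (simp add: local_diffeo_pair_def)
  have f': "local_smooth X ?Q f'" using f by (simp add: local_diffeo_pair_def)
  define V where "V = P -` Some ` dom f'"
  have V: "openin (Euclidean_space m) V"
    using f' P unfolding V_def local_smooth_def openin_D_topology by blast
  have PV: "(m, P |` V) \<in> plots X" by (rule plot_restrict[OF X P V]) (auto simp: V_def)
  have "ran (P |` V) \<subseteq> dom f'" by (auto simp: V_def ran_def restrict_map_def split: if_splits)
  then have lift: "(m, f' \<circ>\<^sub>m (P |` V)) \<in> plots ?Q" using f' PV by (simp add: local_smooth_def)
  have r: "r \<in> Rn n" "f (orbit_rel n \<Gamma> `` {r}) = Some z" using s(2) by (simp_all add: chart_lift_eq_Some)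
  have "s \<in> V" using s(1) r(2) ff' by (auto simp: V_def)
  then have "s \<in> dom (f' \<circ>\<^sub>m (P |` V))" using s(1) r(2) ff' by (auto simp: dom_map_comp)
  moreover have "\<forall>s\<in>dom (f' \<circ>\<^sub>m (P |` V)). \<exists>q. (m, q) \<in> smooth_parametrizations n \<and> s \<in> dom q \<and>
      dom q \<subseteq> dom (f' \<circ>\<^sub>m (P |` V)) \<and>
      (\<forall>t\<in>dom q. (f' \<circ>\<^sub>m (P |` V)) t = Some (orbit_rel n \<Gamma> `` {the (q t)}))"
    using lift unfolding quotient_diff_def euclidean_diff_def by simp
  ultimately obtain q0 where q0: "(m, q0) \<in> smooth_parametrizations n" "s \<in> dom q0" "dom q0 \<subseteq> dom (f' \<circ>\<^sub>m (P |` V))"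
      "\<forall>t\<in>dom q0. (f' \<circ>\<^sub>m (P |` V)) t = Some (orbit_rel n \<Gamma> `` {the (q0 t)})"
    by blast
  have rq0: "ran q0 \<subseteq> Rn n" using q0(1) by (simp add: smooth_parametrization_iff)
  have F0: "\<exists>w. P t = Some w \<and> ?F u = Some w" if "q0 t = Some u" for t u
  proof -
    have "(f' \<circ>\<^sub>m (P |` V)) t = Some (orbit_rel n \<Gamma> `` {u})" using q0(4) that by force
    then obtain w where w: "P t = Some w" "f' w = Some (orbit_rel n \<Gamma> `` {u})"
      by (auto simp: map_comp_eq_Some restrict_map_def split: if_splits)
    have "u \<in> Rn n" using rq0 that by (auto simp: ran_def)
    then have "?F u = Some w" using w(2) ff' by (simp add: chart_lift_eq_Some)
    then show ?thesis using w(1) by simp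
  qed
  obtain u0 where u0: "q0 s = Some u0" using q0(2) by blast
  then have "?F u0 = Some z" using F0[OF u0] s(1) by simp
  then obtain \<gamma> where \<gamma>: "\<gamma> \<in> \<Gamma>" "r = \<gamma> u0" using chart_lift_fibre[OF c] s(2) by blast
  define q where "q = map_option \<gamma> \<circ> q0"
  have Fq: "\<exists>w. P t = Some w \<and> ?F u = Some w" if "q t = Some u" for t u
  proof -
    obtain u1 where u1: "q0 t = Some u1" "u = \<gamma> u1" using \<open>q t = Some u\<close> by (auto simp: q_def)
    obtain w where w: "?F u1 = Some w" "P t = Some w" using F0[OF u1(1)] by blast
    then show ?thesis using chart_lift_fibre[OF c w(1), of u] u1(2) \<gamma>(1) by blast
  qed
  show thesis
  proof (rule that[of q])
    show "(m, q) \<in> smooth_parametrizations n"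
      unfolding q_def by (rule smooth_parametrization_affine[OF q0(1) affine_group_affine[OF \<Gamma> \<gamma>(1)]])
    show "q s = Some r" using u0 \<gamma>(2) by (simp add: q_def)
    show "dom q \<subseteq> dom P" using q0(3) by (auto simp: q_def dom_map_comp restrict_map_def split: if_splits)
    show "?F u = P t" if "q t = Some u" for t u using Fq[OF that] by auto
    show "ran q \<subseteq> dom ?F" using Fq unfolding ran_def by blast
  qed
qed

lemma lift_self_map_affine:
  assumes c: "(\<Gamma>, f) \<in> charts n X" and h: "(n, h) \<in> smooth_parametrizations n" and r: "h r = Some r"
    and dom: "dom h \<subseteq> dom (chart_lift n (\<Gamma>, f))"
    and eq: "\<And>x y. h x = Some y \<Longrightarrow> chart_lift n (\<Gamma>, f) y = chart_lift n (\<Gamma>, f) x"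
  obtains \<gamma> U where "\<gamma> \<in> \<Gamma>" "openin (Euclidean_space n) U" "r \<in> U" "U \<subseteq> dom h" "\<And>x. x \<in> U \<Longrightarrow> h x = Some (\<gamma> x)"
proof (rule countable_affine_rigidity[OF h])
  have \<Gamma>: "subgroup \<Gamma> (Aff n)" "countable \<Gamma>" using c by (auto simp: charts_def)
  show "r \<in> dom h" using r by blast
  show "countable \<Gamma>" by (rule \<Gamma>(2))
  show "affine_on n \<gamma>" if "\<gamma> \<in> \<Gamma>" for \<gamma> using affine_group_affine[OF \<Gamma>(1) that] .
  show "\<exists>\<gamma>\<in>\<Gamma>. h x = Some (\<gamma> x)" if x: "x \<in> dom h" for x
  proof -
    obtain y z where "h x = Some y" "chart_lift n (\<Gamma>, f) x = Some z" using x dom by blast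
    then show ?thesis using chart_lift_fibre[OF c, of x z y] eq[of x y] by auto
  qed
qed (rule that)

text \<open>
  The two lifts \<open>q0\<close> and \<open>p0\<close> need not be inverse to each other.  Near \<open>r\<close> the composite \<open>p0 \<circ> q0\<close> is
  an element \<open>\<gamma>\<close> of \<open>\<Gamma>\<close>, and replacing \<open>p0\<close> by \<open>q1 = \<gamma>\<^sup>-\<^sup>1 \<circ> p0\<close> gives a left inverse of \<open>q0\<close>.  Near \<open>r'\<close>
  the map \<open>k = q0 \<circ> q1\<close> is an element \<open>\<gamma>'\<close> of \<open>\<Gamma>'\<close>.  It is idempotent where \<open>q1\<close> takes values in the set
  on which it is a left inverse, and an injective idempotent map is the identity.
\<close>
lemma link_charts:
  assumes X: "diffeology X" and X': "diffeology X'" and g: "diffeomorphism X X' g"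
    and c: "(\<Gamma>, f) \<in> charts n X" and c': "(\<Gamma>', f') \<in> charts n' X'"
    and F: "F = chart_lift n (\<Gamma>, f)" and F': "F' = chart_lift n' (\<Gamma>', f')"
    and r: "F r = Some z" "g z = Some z'" "F' r' = Some z'"
  obtains q q' where "(n, q) \<in> smooth_parametrizations n'" "(n', q') \<in> smooth_parametrizations n"
    "q r = Some r'" "\<And>x y. q x = Some y \<longleftrightarrow> q' y = Some x" "dom q \<subseteq> dom F" "dom q' \<subseteq> dom F'"
    "\<And>x y. q x = Some y \<Longrightarrow> F' y = (g \<circ>\<^sub>m F) x"
proof -
  let ?g' = "map_inv g"
  have gs: "smooth_map X X' g" "smooth_map X' X ?g'" and inj: "inj_on g (dom g)"
    using g by (auto simp: diffeomorphism_def)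
  have gg': "?g' b = Some a \<longleftrightarrow> g a = Some b" for a b by (rule map_inv_eq_Some[OF inj])
  have gF: "(n, g \<circ>\<^sub>m F) \<in> plots X'" "(n', ?g' \<circ>\<^sub>m F') \<in> plots X"
    using chart_lift_plot(1)[OF c] chart_lift_plot(1)[OF c'] gs
    unfolding smooth_map_def F F' by auto
  have vals: "(g \<circ>\<^sub>m F) r = Some z'" "(?g' \<circ>\<^sub>m F') r' = Some z"
    using r gg' by (simp_all add: map_comp_def)
  obtain q0 where q0: "(n, q0) \<in> smooth_parametrizations n'" "q0 r = Some r'" "dom q0 \<subseteq> dom (g \<circ>\<^sub>m F)"
    "\<And>t u. q0 t = Some u \<Longrightarrow> F' u = (g \<circ>\<^sub>m F) t" "ran q0 \<subseteq> dom F'"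
    using lift_plot_through_chart[OF X' c' gF(1) vals(1) r(3)[unfolded F']] unfolding F' by blast
  obtain p0 where p0: "(n', p0) \<in> smooth_parametrizations n" "p0 r' = Some r" "dom p0 \<subseteq> dom (?g' \<circ>\<^sub>m F')"
    "\<And>t u. p0 t = Some u \<Longrightarrow> F u = (?g' \<circ>\<^sub>m F') t" "ran p0 \<subseteq> dom F"
    using lift_plot_through_chart[OF X c gF(2) vals(2) r(1)[unfolded F]] unfolding F by blast
  have over_q: "\<exists>a b. F x = Some a \<and> g a = Some b \<and> F' y = Some b" if "q0 x = Some y" for x y
  proof -
    have "x \<in> dom (g \<circ>\<^sub>m F)" using q0(3) that by blast
    then show ?thesis using q0(4)[OF that] by (auto simp: map_comp_eq_Some)
  qed
  have over_p: "\<exists>a b. F x = Some a \<and> g a = Some b \<and> F' y = Some b" if "p0 y = Some x" for x y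
  proof -
    have "y \<in> dom (?g' \<circ>\<^sub>m F')" using p0(3) that by blast
    then obtain a where a: "(?g' \<circ>\<^sub>m F') y = Some a" by blast
    then obtain b where "F' y = Some b" "g a = Some b" unfolding map_comp_eq_Some gg' by blast
    then show ?thesis using p0(4)[OF that] a by simp
  qed
  have g_inj: "a = a'" if "g a = Some b" "g a' = Some b" for a a' b
    using that gg' by (metis option.inject)
  define h where "h = p0 \<circ>\<^sub>m q0"
  have h: "(n, h) \<in> smooth_parametrizations n" unfolding h_def by (rule smooth_parametrization_compose[OF p0(1) q0(1)])
  have hF: "F y = F x \<and> x \<in> dom F" if hx: "h x = Some y" for x y
  proof -
    obtain u where u: "q0 x = Some u" "p0 u = Some y" using hx by (auto simp: h_def map_comp_eq_Some)
    show ?thesis using over_q[OF u(1)] over_p[OF u(2)] g_inj by fastforce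
  qed
  obtain \<gamma> U where \<gamma>: "\<gamma> \<in> \<Gamma>" and U: "openin (Euclidean_space n) U" "r \<in> U" "U \<subseteq> dom h"
    "\<And>x. x \<in> U \<Longrightarrow> h x = Some (\<gamma> x)"
  proof (rule lift_self_map_affine[OF c h])
    show "h r = Some r" using q0(2) p0(2) by (simp add: h_def)
    show "dom h \<subseteq> dom (chart_lift n (\<Gamma>, f))" using hF unfolding F by blast
    show "\<And>x y. h x = Some y \<Longrightarrow> chart_lift n (\<Gamma>, f) y = chart_lift n (\<Gamma>, f) x" using hF unfolding F by blast
  qed blast
  have \<Gamma>: "subgroup \<Gamma> (Aff n)" and \<Gamma>': "subgroup \<Gamma>' (Aff n')" using c c' by (simp_all add: charts_def)
  have UR: "U \<subseteq> Rn n" using U(1) openin_subset by blast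
  obtain \<delta> where \<delta>: "\<delta> \<in> \<Gamma>" "\<And>x. x \<in> Rn n \<Longrightarrow> \<delta> (\<gamma> x) = x" using affine_group_inv[OF \<Gamma> \<gamma>] by blast
  define q1 where "q1 = map_option \<delta> \<circ> p0"
  have q1: "(n', q1) \<in> smooth_parametrizations n"
    unfolding q1_def by (rule smooth_parametrization_affine[OF p0(1) affine_group_affine[OF \<Gamma> \<delta>(1)]])
  have left: "\<exists>y. q0 x = Some y \<and> q1 y = Some x" if x: "x \<in> U" for x
  proof -
    have "h x = Some (\<gamma> x)" using U(4) x .
    then obtain y where "q0 x = Some y" "p0 y = Some (\<gamma> x)" by (auto simp: h_def map_comp_eq_Some)
    moreover from this have "q1 y = Some x" using \<delta>(2) UR x by (auto simp: q1_def)
    ultimately show ?thesis by blast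
  qed
  have q1r: "q1 r' = Some r" using left[OF U(2)] q0(2) by auto
  have over_q1: "\<exists>a b. F x = Some a \<and> g a = Some b \<and> F' y = Some b" if q1y: "q1 y = Some x" for x y
  proof -
    obtain u where u: "p0 y = Some u" "x = \<delta> u" using q1y by (auto simp: q1_def)
    obtain a b where ab: "F u = Some a" "g a = Some b" "F' y = Some b" using over_p[OF u(1)] by blast
    have "F x = Some a" using chart_lift_fibre[OF c, of u a x] ab(1) u(2) \<delta>(1) unfolding F by blast
    then show ?thesis using ab by blast
  qed
  define k where "k = q0 \<circ>\<^sub>m q1"
  have k: "(n', k) \<in> smooth_parametrizations n'" unfolding k_def by (rule smooth_parametrization_compose[OF q0(1) q1])
  have kF: "F' y = F' x \<and> x \<in> dom F'" if kx: "k x = Some y" for x y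
  proof -
    obtain u where u: "q1 x = Some u" "q0 u = Some y" using kx by (auto simp: k_def map_comp_eq_Some)
    show ?thesis using over_q1[OF u(1)] over_q[OF u(2)] by fastforce
  qed
  obtain \<gamma>' U' where \<gamma>': "\<gamma>' \<in> \<Gamma>'" and U': "openin (Euclidean_space n') U'" "r' \<in> U'" "U' \<subseteq> dom k"
    "\<And>x. x \<in> U' \<Longrightarrow> k x = Some (\<gamma>' x)"
  proof (rule lift_self_map_affine[OF c' k])
    show "k r' = Some r'" using q0(2) q1r by (simp add: k_def)
    show "dom k \<subseteq> dom (chart_lift n' (\<Gamma>', f'))" using kF unfolding F' by blast
    show "\<And>x y. k x = Some y \<Longrightarrow> chart_lift n' (\<Gamma>', f') y = chart_lift n' (\<Gamma>', f') x" using kF unfolding F' by blast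
  qed blast
  have U'R: "U' \<subseteq> Rn n'" using U'(1) openin_subset by blast
  define V where "V = U' \<inter> q1 -` Some ` U \<inter> k -` Some ` U'"
  have V: "openin (Euclidean_space n') V"
    unfolding V_def by (intro openin_Int U'(1) smooth_parametrization_preimage[OF q1 U(1)]
        smooth_parametrization_preimage[OF k U'(1)])
  have r'V: "r' \<in> V" using U(2) U'(2) q1r q0(2) by (simp add: V_def k_def)
  have right: "\<exists>x. q1 y = Some x \<and> x \<in> U \<and> q0 x = Some y" if y: "y \<in> V" for y
  proof -
    obtain x where x: "q1 y = Some x" "x \<in> U" using y by (auto simp: V_def)
    obtain w where w: "k y = Some w" "w \<in> U'" "y \<in> U'" using y by (auto simp: V_def)
    have "q0 x = Some w" using x w(1) by (simp add: k_def)
    moreover from this have "q1 w = Some x" using left[OF x(2)] by auto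
    ultimately have "k w = Some w" by (simp add: k_def)
    then have "\<gamma>' w = \<gamma>' y" using U'(4)[OF w(2)] U'(4)[OF w(3)] w(1) by simp
    \<comment> \<open>\<open>\<gamma>'\<close> is injective\<close>
    then have "w = y" using affine_group_inv[OF \<Gamma>' \<gamma>'] U'R w(2,3) by (metis subsetD)
    then show ?thesis using x \<open>q0 x = Some w\<close> by blast
  qed
  define D where "D = U \<inter> q0 -` Some ` V"
  have D: "openin (Euclidean_space n) D"
    unfolding D_def by (intro openin_Int U(1) smooth_parametrization_preimage[OF q0(1) V])
  define q where "q = q0 |` D"
  define q' where "q' = q1 |` V"
  have qE: "q x = Some y \<longleftrightarrow> x \<in> U \<and> y \<in> V \<and> q0 x = Some y" for x y
    by (auto simp: q_def D_def restrict_map_def)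
  have q'E: "q' y = Some x \<longleftrightarrow> y \<in> V \<and> q1 y = Some x" for x y
    by (auto simp: q'_def restrict_map_def)
  show thesis
  proof (rule that[of q q'])
    show "(n, q) \<in> smooth_parametrizations n'" unfolding q_def by (rule smooth_parametrization_restrict[OF q0(1) D])
    show "(n', q') \<in> smooth_parametrizations n" unfolding q'_def by (rule smooth_parametrization_restrict[OF q1 V])
    show "q r = Some r'" unfolding qE using U(2) r'V q0(2) by blast
    show "q x = Some y \<longleftrightarrow> q' y = Some x" for x y
      unfolding qE q'E using left right by fastforce
    show "dom q \<subseteq> dom F" using over_q qE by fast
    show "dom q' \<subseteq> dom F'" using over_q1 q'E by fast
    show "F' y = (g \<circ>\<^sub>m F) x" if "q x = Some y" for x y
      using that q0(4) unfolding qE by blast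
  qed
qed

section \<open>Structure groupoids\<close>

lemma nebula_strict_family_points:
  assumes "\<nu> \<in> points (nebula n (strict_family n \<A>))"
  obtains \<Gamma> f r z where "(\<Gamma>, f) \<in> \<A>" "\<nu> = (chart_lift n (\<Gamma>, f), r)" "chart_lift n (\<Gamma>, f) r = Some z" "ev \<nu> = z"
  using assms unfolding points_nebula strict_family_eq by (force simp: ev_def)

lemma ev_image:
  assumes A: "atlas n X \<A>"
  shows "ev ` points (nebula n (strict_family n \<A>)) = points X"
proof
  have ran: "(\<Union>(\<Gamma>, f)\<in>\<A>. ran f) = points X" and sub: "\<A> \<subseteq> charts n X" using A by (auto simp: atlas_def)
  show "ev ` points (nebula n (strict_family n \<A>)) \<subseteq> points X"
  proof
    fix z assume "z \<in> ev ` points (nebula n (strict_family n \<A>))"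
    then obtain \<nu> where \<nu>: "\<nu> \<in> points (nebula n (strict_family n \<A>))" "z = ev \<nu>" by blast
    obtain \<Gamma> f r where "(\<Gamma>, f) \<in> \<A>" "chart_lift n (\<Gamma>, f) r = Some z"
      using nebula_strict_family_points[OF \<nu>(1)] \<nu>(2) by metis
    then have "z \<in> (\<Union>(\<Gamma>, f)\<in>\<A>. ran f)" by (force simp: chart_lift_eq_Some ran_def)
    then show "z \<in> points X" using ran by simp
  qed
  show "points X \<subseteq> ev ` points (nebula n (strict_family n \<A>))"
  proof
    fix z assume "z \<in> points X"
    then have "z \<in> (\<Union>(\<Gamma>, f)\<in>\<A>. ran f)" using ran by simp
    then obtain \<Gamma> f where "(\<Gamma>, f) \<in> \<A>" "z \<in> ran f" by auto
    then obtain C where C: "(\<Gamma>, f) \<in> \<A>" "f C = Some z" by (auto simp: ran_def)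
    have "local_diffeo (quotient_diff (euclidean_diff n) (orbit_rel n \<Gamma>)) X f"
      using sub C(1) by (auto simp: charts_def)
    then have "dom f \<subseteq> Rn n // orbit_rel n \<Gamma>"
      using openin_D_topology_points by (force simp: local_diffeo_def quotient_diff_def euclidean_diff_def)
    then have "C \<in> Rn n // orbit_rel n \<Gamma>" using C(2) by blast
    then obtain r where r: "r \<in> Rn n" "C = orbit_rel n \<Gamma> `` {r}" by (rule quotientE)
    then have F: "chart_lift n (\<Gamma>, f) r = Some z" using C(2) by (simp add: chart_lift_eq_Some)
    then have "(chart_lift n (\<Gamma>, f), r) \<in> points (nebula n (strict_family n \<A>))"
      using C(1) r(1) by (auto simp: points_nebula strict_family_eq)
    moreover have "ev (chart_lift n (\<Gamma>, f), r) = z" using F by (simp add: ev_def)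
    ultimately show "z \<in> ev ` points (nebula n (strict_family n \<A>))" by force
  qed
qed

text \<open>
  Composing the evaluation map with an injective \<open>g\<close> does not change which local diffeomorphisms
  preserve it.
\<close>
lemma structure_groupoid_as_germ_groupoid:
  assumes A: "atlas n X \<A>" and g: "dom g = points X" "inj_on g (dom g)"
  shows "structure_groupoid n \<A> = germ_groupoid (nebula n (strict_family n \<A>)) (\<lambda>\<nu>. the (g (ev \<nu>)))"
proof -
  let ?N = "nebula n (strict_family n \<A>)"
  have "the (g (ev (the (\<Phi> \<mu>)))) = the (g (ev \<mu>)) \<longleftrightarrow> ev (the (\<Phi> \<mu>)) = ev \<mu>"
    if \<Phi>: "local_diffeo ?N ?N \<Phi>" and \<mu>: "\<mu> \<in> dom \<Phi>" for \<Phi> \<mu>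
  proof -
    have "dom \<Phi> \<subseteq> points ?N" "ran \<Phi> \<subseteq> points ?N"
      using \<Phi> openin_D_topology_points unfolding local_diffeo_def by blast+
    moreover have "the (\<Phi> \<mu>) \<in> ran \<Phi>" using \<mu> by (metis domD option.sel ranI)
    ultimately have "\<mu> \<in> points ?N" "the (\<Phi> \<mu>) \<in> points ?N" using \<mu> by blast+
    then have "ev \<mu> \<in> dom g" "ev (the (\<Phi> \<mu>)) \<in> dom g" using ev_image[OF A] g(1) by blast+
    then show ?thesis using g(2) by (metis domD inj_onD option.sel)
  qed
  then have "local_diffeo ?N ?N \<Phi> \<Longrightarrow> (\<forall>\<mu>\<in>dom \<Phi>. the (g (ev (the (\<Phi> \<mu>)))) = the (g (ev \<mu>)))
      \<longleftrightarrow> (\<forall>\<mu>\<in>dom \<Phi>. ev (the (\<Phi> \<mu>)) = ev \<mu>)" for \<Phi> by (rule ball_cong[OF refl])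
  then show ?thesis by (simp add: structure_groupoid_def germ_groupoid_def Let_def cong: conj_cong)
qed

theorem structure_groupoids_equivalent:
  assumes X: "diffeology X" and X': "diffeology X'" and g: "diffeomorphism X X' g"
    and A: "atlas n X \<A>" and A': "atlas n' X' \<A>'"
  shows "equivalent_categories (structure_groupoid n \<A>) (structure_groupoid n' \<A>')"
proof -
  let ?N = "nebula n (strict_family n \<A>)" and ?N' = "nebula n' (strict_family n' \<A>')"
  let ?e = "\<lambda>\<nu>. the (g (ev \<nu>))"
  have gd: "dom g = points X" "inj_on g (dom g)" "ran g = points X'"
    using g by (auto simp: diffeomorphism_def smooth_map_def)
  have G: "structure_groupoid n \<A> = germ_groupoid ?N ?e"
    by (rule structure_groupoid_as_germ_groupoid[OF A gd(1,2)])
  have G': "structure_groupoid n' \<A>' = germ_groupoid ?N' ev"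
    by (simp add: structure_groupoid_def germ_groupoid_def Let_def)
  show ?thesis
    unfolding G G'
  proof (rule germ_groupoids_equivalent[OF diffeology_nebula diffeology_nebula])
    have "?e ` points ?N = (\<lambda>z. the (g z)) ` points X" using ev_image[OF A] by (metis image_image)
    also have "\<dots> = points X'" unfolding gd(3)[symmetric] gd(1)[symmetric] by (force simp: ran_def image_iff)
    finally show "?e ` points ?N = ev ` points ?N'" using ev_image[OF A'] by simp
    fix \<nu> \<nu>' assume \<nu>: "\<nu> \<in> points ?N" "\<nu>' \<in> points ?N'" and eq: "?e \<nu> = ev \<nu>'"
    obtain \<Gamma> f r z where c: "(\<Gamma>, f) \<in> \<A>" "\<nu> = (chart_lift n (\<Gamma>, f), r)"
      "chart_lift n (\<Gamma>, f) r = Some z" "ev \<nu> = z" by (rule nebula_strict_family_points[OF \<nu>(1)])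
    obtain \<Gamma>' f' r' z' where c': "(\<Gamma>', f') \<in> \<A>'" "\<nu>' = (chart_lift n' (\<Gamma>', f'), r')"
      "chart_lift n' (\<Gamma>', f') r' = Some z'" "ev \<nu>' = z'" by (rule nebula_strict_family_points[OF \<nu>(2)])
    let ?F = "chart_lift n (\<Gamma>, f)" and ?F' = "chart_lift n' (\<Gamma>', f')"
    have ch: "(\<Gamma>, f) \<in> charts n X" "(\<Gamma>', f') \<in> charts n' X'" using A A' c(1) c'(1) by (auto simp: atlas_def)
    have "z \<in> dom g" using ev_image[OF A] \<nu>(1) c(4) gd(1) by blast
    then have gz: "g z = Some z'" using eq c(4) c'(4) by auto
    obtain q q' where q: "(n, q) \<in> smooth_parametrizations n'" "(n', q') \<in> smooth_parametrizations n"
      "q r = Some r'" "\<And>x y. q x = Some y \<longleftrightarrow> q' y = Some x" "dom q \<subseteq> dom ?F" "dom q' \<subseteq> dom ?F'"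
      "\<And>x y. q x = Some y \<Longrightarrow> ?F' y = (g \<circ>\<^sub>m ?F) x"
      by (rule link_charts[OF X X' g ch refl refl c(3) gz c'(3)]) blast
    have mem: "?F \<in> strict_family n \<A>" "?F' \<in> strict_family n' \<A>'" using c(1) c'(1) by (simp_all add: strict_family_eq)
    have "local_diffeo_over ?N ?e ?N' ev (slice_map ?F ?F' q) (slice_map ?F' ?F q')"
      unfolding local_diffeo_over_def
    proof (intro conjI allI impI)
      show "local_diffeo_pair ?N ?N' (slice_map ?F ?F' q) (slice_map ?F' ?F q')"
        by (rule local_diffeo_pair_slice_map[OF mem q(1,2,5,6,4)])
      fix \<mu> \<mu>' assume "slice_map ?F ?F' q \<mu> = Some \<mu>'"
      then obtain x y where xy: "\<mu> = (?F, x)" "\<mu>' = (?F', y)" "q x = Some y"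
        by (cases \<mu>; cases \<mu>') (auto simp: slice_map_eq_Some)
      then obtain a where a: "?F x = Some a" using q(5) by blast
      then show "ev \<mu>' = ?e \<mu>" using q(7)[OF xy(3)] xy(1,2) by (simp add: ev_def)
    qed
    moreover have "slice_map ?F ?F' q \<nu> = Some \<nu>'" using q(3) c(2) c'(2) by (simp add: slice_map_eq_Some)
    ultimately show "\<exists>f g. local_diffeo_over ?N ?e ?N' ev f g \<and> f \<nu> = Some \<nu>'" by blast
  qed
qed

lemma diffeomorphic_refl:
  assumes "diffeology X"
  shows "diffeomorphic X X"
proof -
  let ?i = "Some |` points X"
  have id: "?i \<circ>\<^sub>m p = p" if "(m, p) \<in> plots X" for m p
    by (rule identity_comp_plot[OF assms that])
  have i: "?i x = Some y \<longleftrightarrow> ?i y = Some x" for x y by (auto simp: restrict_map_def)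
  have "smooth_map X X ?i"
    using id by (auto simp: smooth_map_def ran_def restrict_map_def split: if_splits)
  moreover have "ran ?i = points X" by (auto simp: ran_def restrict_map_def)
  ultimately have "diffeomorphism X X ?i"
    using map_inv_unique[of ?i ?i, OF i] by (simp add: diffeomorphism_def)
  then show ?thesis unfolding diffeomorphic_def by blast
qed

theorem mainTheorem4:
  shows "(\<forall>n (X :: 'a diffspace) \<A> \<A>'.
            quasifold n X \<and> has_locally_finite_atlas n X \<and> atlas n X \<A> \<and> atlas n X \<A>' \<longrightarrow>
            equivalent_categories (structure_groupoid n \<A>) (structure_groupoid n \<A>')) \<and>
         (\<forall>n n' (X :: 'a diffspace) (X' :: 'b diffspace) \<A> \<A>'.
            quasifold n X \<and> has_locally_finite_atlas n X \<and>
            quasifold n' X' \<and> has_locally_finite_atlas n' X' \<and>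
            diffeomorphic X X' \<and> atlas n X \<A> \<and> atlas n' X' \<A>' \<longrightarrow>
            equivalent_categories (structure_groupoid n \<A>) (structure_groupoid n' \<A>'))"
proof (intro conjI allI impI; elim conjE)
  fix n and X :: "'a diffspace" and \<A> \<A>'
  assume "quasifold n X" "atlas n X \<A>" "atlas n X \<A>'"
  then show "equivalent_categories (structure_groupoid n \<A>) (structure_groupoid n \<A>')"
    using diffeomorphic_refl structure_groupoids_equivalent
    unfolding quasifold_def diffeomorphic_def by blast
next
  fix n n' and X :: "'a diffspace" and X' :: "'b diffspace" and \<A> \<A>'
  assume "quasifold n X" "quasifold n' X'" "diffeomorphic X X'" "atlas n X \<A>" "atlas n' X' \<A>'"
  then show "equivalent_categories (structure_groupoid n \<A>) (structure_groupoid n' \<A>')"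
    using structure_groupoids_equivalent unfolding quasifold_def diffeomorphic_def by blast
qed

end
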